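(* Let $\psi:\mathbb{R}\to\mathbb{C}$ be a $2\pi$-periodic function satisfying the Lipschitz condition $|\psi(u)-\psi(v)|\le C|u-v|$ for all $u,v\in[-\pi,\pi]$, with some constant $C>0$. Put $\varphi(u)=\psi(u)\sinh(2u)$ and let $f$ be the function on $(0,\infty)$ given by $$f(x)=x\int_{-\pi}^{\pi}J_0(2x\cosh u)\,\varphi(u)\,du,\qquad x>0.$$ Define, for $n\in\mathbb{N}$, $$a_n=\int_0^\infty\left[J^2_{in/2}(x)+Y^2_{in/2}(x)\right]f(x)\,dx,$$ and $$\Phi_n(x)=x\int_0^\pi J_0(2x\cosh u)\,\sinh(2u)\,\sin(nu)\,du,\qquad x>0.$$ Then for all $x>0$, $$f(x)=\sum_{n=1}^\infty \sinh\left(\frac{\pi n}{2}\right)\Phi_n(x)\,a_n.$$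
   Context: $J_\nu$ and $Y_\nu$ denote the Bessel functions of the first and second kind of (complex) order $\nu$; the orders $in/2$ are purely imaginary. *)

theory Defs
  imports "HOL-Analysis.Analysis"
begin

text \<open>Bessel function of the first kind of complex order nu at a real argument x > 0,
  via its power series; rGamma (= 1/Gamma, entire) avoids poles.\<close>
definition besselJ :: "complex \<Rightarrow> real \<Rightarrow> complex" where
  "besselJ \<nu> x =
     (\<Sum>k. (-1) ^ k * complex_of_real ((x / 2) ^ (2 * k)) / fact k
            * rGamma (of_nat k + \<nu> + 1)) * (complex_of_real (x / 2)) powr \<nu>"

text \<open>Bessel function of the second kind, for non-integer order (this is the case
  for the purely imaginary orders i n/2, n \<ge> 1, used below).\<close>
definition besselY :: "complex \<Rightarrow> real \<Rightarrow> complex" where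
  "besselY \<nu> x = (besselJ \<nu> x * cos (\<nu> * of_real pi) - besselJ (- \<nu>) x) / sin (\<nu> * of_real pi)"

definition improper_integral_0_inf :: "(real \<Rightarrow> complex) \<Rightarrow> complex" where
  "improper_integral_0_inf g = Lim at_top (\<lambda>R. integral {0..R} g)"

end

theory Submission
  imports Defs "HOL-Real_Asymp.Real_Asymp"
begin

text \<open>
  Put $M = J_\nu^2 + Y_\nu^2$ with $\nu = in/2$. As $J_0$ and $\cosh$ are even, only the odd part
  $g(u) = \psi(u) - \psi(-u)$ of $\psi$ matters, and $f(x) = x \int_0^\pi J_0(2x\cosh u) \sinh(2u) g(u) du$.
  The theorem follows from the Fourier sine series of $g$ (which, $g$ being Lipschitz, converges after
  integration against the kernel) and the formula
  $\sinh(\pi n/2) a_n = (2/\pi) \int_0^\pi g(u) \sin(nu) du$.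

  For the latter, write $M$ as a combination of $J_\nu^2$, $J_{-\nu}^2$ and $J_\nu J_{-\nu}$. Weber's second
  exponential integral and Schlaefli's integral for $I_\nu$ give the Gaussian moments
  $\int_0^\infty (x/\beta) e^{-x^2/\beta} M(x) dx$ as integrals of $e^{-\beta q}$ over $q = (1 \pm \cos A)/2$ and
  $q = \cosh^2 u$. Since $(x/\beta) e^{-x^2/\beta}$ is the Hankel transform
  $x \int_0^\infty J_0(2x\sqrt q) h(q) dq$ of $h(q) = e^{-\beta q}$, this is the pairing of $M$ with such
  transforms for exponential $h$. Approximation by sums of exponentials extends it to smooth $h$; when
  $h$ vanishes for $q \le 1$ only the integral over $q = \cosh^2 u$ survives, whose kernel is
  $2\sin(nu)/(\pi\sinh(\pi n/2))$. Energy estimates for the Bessel equation supply the dominating functions,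
  and mollification passes to Lipschitz $g$.\<close>

subsection \<open>Bessel functions as power series\<close>

text \<open>The obstacle is that the pairing cannot be computed by exchanging integrals. The
  available bounds are 1/x for J^2 + Y^2 and x^{-1/2} for J_0, so for a fixed q the product x J_0(2x
  sqrt q) (J^2 + Y^2) is only controlled by x^{-1/2}. Against a Gaussian everything converges
  absolutely, which is why the moments can be had from power series alone, without contour integrals
  or asymptotic expansions. What makes the passage to the limit possible is one integration by parts
  in q: it gains a factor 1/x, so that transforms of functions with bounded derivative are
  O(x^{-1/2}) and an integrable x^{-3/2} remains. Every approximation must therefore control a
  function and its derivative by one constant. This dictates the two approximation schemes:
  polynomials in e^{-q} are fitted to a density of h and not to h itself, and the mollifier has to
  preserve the Lipschitz constant.\<close>

definition bcoef :: "complex \<Rightarrow> nat \<Rightarrow> complex" where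
  "bcoef \<nu> k = (-1) ^ k / fact k * rGamma (of_nat k + \<nu> + 1)"

text \<open>J_\<nu>(x) is (x/2)^\<nu> times this function at z = x^2/4; it is the Bessel-Clifford
  function at -z. Removing the power leaves an entire function, and in the variable z
  differentiation merely raises the order, up to sign.\<close>

definition bser :: "complex \<Rightarrow> complex \<Rightarrow> complex" where
  "bser \<nu> z = (\<Sum>k. bcoef \<nu> k * z ^ k)"

text \<open>Each step of the functional equation divides by \<nu> + k + 1, whose modulus is at least
  k + 1 because Re \<nu> is nonnegative. This half-plane contains both imaginary orders and the
  orders 0, 1, 2 that occur with J_0.\<close>

lemma norm_rGamma_shift_le:
  assumes "Re \<nu> \<ge> 0"
  shows "norm (rGamma (of_nat k + \<nu> + 1)) \<le> norm (rGamma (\<nu> + 1)) / fact k"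
proof (induction k)
  case 0
  then show ?case by simp
next
  case (Suc k)
  let ?z = "of_nat k + \<nu> + 1"
  have eq: "rGamma ?z = ?z * rGamma (of_nat (Suc k) + \<nu> + 1)"
    using rGamma_plus1[of ?z] by (simp add: algebra_simps)
  have "real (Suc k) \<le> Re ?z" using assms by simp
  also have "\<dots> \<le> norm ?z" by (rule complex_Re_le_cmod)
  finally have "real (Suc k) * norm (rGamma (of_nat (Suc k) + \<nu> + 1)) \<le> norm (rGamma ?z)"
    unfolding eq norm_mult by (rule mult_right_mono) simp
  also note Suc
  finally have "real (Suc k) * norm (rGamma (of_nat (Suc k) + \<nu> + 1)) \<le> norm (rGamma (\<nu> + 1)) / fact k" .
  then have "norm (rGamma (of_nat (Suc k) + \<nu> + 1)) \<le> norm (rGamma (\<nu> + 1)) / fact k / real (Suc k)"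
    by (subst pos_le_divide_eq) (auto simp: mult.commute)
  then show ?case by (simp add: mult.commute)
qed

lemma norm_bcoef_le:
  assumes "Re \<nu> \<ge> 0"
  shows "norm (bcoef \<nu> k) \<le> norm (rGamma (\<nu> + 1)) / (fact k)\<^sup>2"
  using norm_rGamma_shift_le[OF assms, of k]
  by (simp add: bcoef_def norm_mult norm_divide norm_power power2_eq_square field_simps)

lemma norm_bcoef_le':
  assumes "Re \<nu> \<ge> 0"
  shows "norm (bcoef \<nu> k) \<le> norm (rGamma (\<nu> + 1)) / fact k"
proof -
  have "(1::real) \<le> fact k" by simp
  then have "(fact k::real) \<le> (fact k)\<^sup>2" by (simp add: power2_eq_square)
  then have "norm (rGamma (\<nu> + 1)) / (fact k)\<^sup>2 \<le> norm (rGamma (\<nu> + 1)) / fact k"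
    by (intro divide_left_mono) auto
  with norm_bcoef_le[OF assms, of k] show ?thesis by simp
qed

lemma summable_norm_bser:
  assumes "Re \<nu> \<ge> 0"
  shows "summable (\<lambda>k. norm (bcoef \<nu> k * z ^ k))"
proof (rule summable_comparison_test')
  show "summable (\<lambda>k. norm (rGamma (\<nu> + 1)) * (norm z ^ k / fact k))"
    using summable_exp[of "norm z"] by (intro summable_mult) (simp add: field_simps)
  show "norm (norm (bcoef \<nu> k * z ^ k)) \<le> norm (rGamma (\<nu> + 1)) * (norm z ^ k / fact k)" for k
    using mult_right_mono[OF norm_bcoef_le'[OF assms, of k], of "norm z ^ k"]
    by (simp add: norm_mult norm_power)
qed

lemma summable_bser: "Re \<nu> \<ge> 0 \<Longrightarrow> summable (\<lambda>k. bcoef \<nu> k * z ^ k)"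
  by (rule summable_norm_cancel) (rule summable_norm_bser)

lemma bcoef_Suc: "of_nat (Suc k) * bcoef \<nu> (Suc k) = - bcoef (\<nu> + 1) k"
proof -
  have "of_nat (Suc k) + \<nu> + 1 = of_nat k + (\<nu> + 1) + 1" by simp
  moreover have "of_nat (Suc k) * ((-1) ^ Suc k / fact (Suc k)) = - ((-1) ^ k / fact k :: complex)"
    by (simp only: fact_Suc of_nat_mult power_Suc of_nat_fact) (simp del: of_nat_Suc)
  ultimately show ?thesis unfolding bcoef_def by (metis mult.assoc mult_minus_left)
qed

lemma has_field_derivative_bser:
  assumes "Re \<nu> \<ge> 0"
  shows "(bser \<nu> has_field_derivative - bser (\<nu> + 1) z) (at z)"
proof -
  have "((\<lambda>z. \<Sum>k. bcoef \<nu> k * z ^ k) has_field_derivative (\<Sum>k. diffs (bcoef \<nu>) k * z ^ k)) (at z)"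
    by (rule termdiffs_strong_converges_everywhere) (rule summable_bser[OF assms])
  moreover have "(\<Sum>k. diffs (bcoef \<nu>) k * z ^ k) = (\<Sum>k. - (bcoef (\<nu> + 1) k * z ^ k))"
    unfolding diffs_def bcoef_Suc by simp
  moreover have "\<dots> = - bser (\<nu> + 1) z"
    unfolding bser_def by (rule suminf_minus) (use assms in \<open>auto intro: summable_bser\<close>)
  ultimately show ?thesis by (simp add: bser_def[abs_def])
qed

lemma continuous_on_bser: "Re \<nu> \<ge> 0 \<Longrightarrow> continuous_on A (bser \<nu>)"
  using has_field_derivative_bser DERIV_isCont by (blast intro: continuous_at_imp_continuous_on)

lemma continuous_on_bser_compose [continuous_intros]:
  "Re \<nu> \<ge> 0 \<Longrightarrow> continuous_on A f \<Longrightarrow> continuous_on A (\<lambda>x. bser \<nu> (f x))"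
  using continuous_on_compose2[OF continuous_on_bser[of \<nu> UNIV]] by auto

text \<open>The three-term recurrence J_\<nu> + J_{\<nu>+2} = (2 (\<nu> + 1)/x) J_{\<nu>+1} in the
  normalisation of \<open>bser\<close>. Together with the derivative rule it closes Bessel's
  equation into a first-order system for the orders \<nu> and \<nu> + 1.\<close>

lemma bser_rec:
  assumes "Re \<nu> \<ge> 0"
  shows "bser \<nu> z = (\<nu> + 1) * bser (\<nu> + 1) z - z * bser (\<nu> + 2) z"
proof -
  have s: "summable (\<lambda>k. bcoef (\<nu> + 1) k * z ^ k)" "summable (\<lambda>k. bcoef (\<nu> + 2) k * z ^ k)"
    using assms by (auto intro!: summable_bser)
  \<comment> \<open>The last series is shifted by one place so that the identity can be checked
    coefficient by coefficient.\<close>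
  define d where "d k = (case k of 0 \<Rightarrow> 0 | Suc j \<Rightarrow> bcoef (\<nu> + 2) j * z ^ Suc j)" for k
  have "(\<lambda>k. bcoef (\<nu> + 2) k * z ^ Suc k) sums (z * bser (\<nu> + 2) z)"
    using sums_mult[OF summable_sums[OF s(2)], of z] by (simp add: bser_def algebra_simps)
  then have "(\<lambda>k. d (Suc k)) sums (z * bser (\<nu> + 2) z)" by (simp add: d_def)
  then have d: "d sums (z * bser (\<nu> + 2) z)"
    by (subst (asm) sums_Suc_iff) (simp add: d_def)
  have "(\<lambda>k. (\<nu> + 1) * (bcoef (\<nu> + 1) k * z ^ k) - d k) sums
          ((\<nu> + 1) * bser (\<nu> + 1) z - z * bser (\<nu> + 2) z)"
    using summable_sums[OF s(1)] d by (intro sums_diff sums_mult) (auto simp: bser_def)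
  moreover have "(\<nu> + 1) * (bcoef (\<nu> + 1) k * z ^ k) - d k = bcoef \<nu> k * z ^ k" for k
  proof -
    have "rGamma (of_nat k + \<nu> + 1) = (of_nat k + \<nu> + 1) * rGamma (of_nat k + (\<nu> + 1) + 1)"
      using rGamma_plus1[of "of_nat k + \<nu> + 1"] by (simp add: algebra_simps)
    then have c: "bcoef \<nu> k = (of_nat k + \<nu> + 1) * bcoef (\<nu> + 1) k"
      by (simp add: bcoef_def)
    have "d k = - of_nat k * bcoef (\<nu> + 1) k * z ^ k"
    proof (cases k)
      case (Suc j)
      with bcoef_Suc[of j "\<nu> + 1"] show ?thesis
        by (simp add: d_def algebra_simps del: of_nat_Suc)
    qed (simp add: d_def)
    then show ?thesis by (simp add: c algebra_simps)
  qed
  ultimately show ?thesis by (simp add: bser_def sums_iff)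
qed

lemma besselJ_eq_bser:
  assumes "Re \<nu> \<ge> 0"
  shows "besselJ \<nu> x = bser \<nu> (of_real ((x / 2)\<^sup>2)) * of_real (x / 2) powr \<nu>"
  unfolding besselJ_def bser_def bcoef_def
  by (intro arg_cong[of _ _ "\<lambda>s. s * _"] suminf_cong) (simp add: power_mult del: power_divide)

section \<open>Decay at infinity by an energy estimate\<close>

lemma norm_real_powr_imaginary:
  assumes "x > 0" "Re \<nu> = 0"
  shows "norm (complex_of_real x powr \<nu>) = 1"
  using assms by (simp add: norm_powr_real_powr)

text \<open>The system is Bessel's equation for a = a1 + i a2, with a' = 2 r b and b = b1 + i b2. In
  the normal form y'' + (4 + (1/4 + \<mu>^2)/r^2) y = 0 the potential decreases in r, hence so does
  the energy. This yields the right power of r without any asymptotic expansion.\<close>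

lemma energy_decreasing:
  fixes a1 a2 b1 b2 :: "real \<Rightarrow> real" and \<mu> :: real
  assumes a1: "\<And>r. r > 0 \<Longrightarrow> (a1 has_real_derivative 2 * r * b1 r) (at r)"
    and a2: "\<And>r. r > 0 \<Longrightarrow> (a2 has_real_derivative 2 * r * b2 r) (at r)"
    and b1: "\<And>r. r > 0 \<Longrightarrow> (b1 has_real_derivative 2 / r * (- b1 r + \<mu> * b2 r - a1 r)) (at r)"
    and b2: "\<And>r. r > 0 \<Longrightarrow> (b2 has_real_derivative 2 / r * (- b2 r - \<mu> * b1 r - a2 r)) (at r)"
  shows "\<exists>E\<ge>0. \<forall>r\<ge>1. (a1 r)\<^sup>2 + (a2 r)\<^sup>2 \<le> E / r \<and> (b1 r)\<^sup>2 + (b2 r)\<^sup>2 \<le> 4 * E / r ^ 3"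
proof -
  define \<kappa> where "\<kappa> = 1/8 + \<mu>\<^sup>2 / 2"
  have kappa: "\<kappa> \<ge> 0" by (simp add: \<kappa>_def)
  \<comment> \<open>A quarter of the energy $|y'|^2 + (4 + (1/4 + \mu^2)/r^2) |y|^2$ of $y(r) = \sqrt r J_{i\mu}(2r)$,
    where $J_{i\mu}(2r) = r^{i\mu} (a_1 + i a_2)$.\<close>
  define H where "H r = r ^ 3 * ((b1 r)\<^sup>2 + (b2 r)\<^sup>2)
      + 2 * r * ((1/4) * (a1 r * b1 r + a2 r * b2 r) + \<mu> / 2 * (a1 r * b2 r - a2 r * b1 r))
      + (r + \<kappa> / r) * ((a1 r)\<^sup>2 + (a2 r)\<^sup>2)" for r
  have dH: "(H has_real_derivative - \<kappa> * ((a1 r)\<^sup>2 + (a2 r)\<^sup>2) / r\<^sup>2) (at r)" if "r > 0" for r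
    unfolding H_def
    apply (rule derivative_eq_intros a1[OF that] a2[OF that] b1[OF that] b2[OF that] refl)+
    apply (use that in simp)
    apply (rule derivative_eq_intros a1[OF that] a2[OF that] b1[OF that] b2[OF that] refl)+
    using that apply (simp add: \<kappa>_def divide_simps power2_eq_square power3_eq_cube)
    apply (simp add: algebra_simps)
    done
  have mono: "H r \<le> H 1" if "r \<ge> 1" for r
  proof (rule DERIV_nonpos_imp_nonincreasing[OF that])
    show "\<exists>y. (H has_real_derivative y) (at x) \<and> y \<le> 0" if "1 \<le> x" for x
      using dH[of x] that by (intro exI[of _ "- \<kappa> * ((a1 x)\<^sup>2 + (a2 x)\<^sup>2) / x\<^sup>2"]) (auto simp: kappa divide_nonpos_nonneg mult_nonpos_nonneg)
  qed
  have bounds: "r * ((a1 r)\<^sup>2 + (a2 r)\<^sup>2) \<le> H r \<and> r ^ 3 * ((b1 r)\<^sup>2 + (b2 r)\<^sup>2) \<le> 4 * H r" if "r \<ge> 1" for r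
  proof -
    \<comment> \<open>For y = r^{1/2 + i\<mu>} a one gets y' = 2 r^{3/2 + i\<mu>} (b + p + i q): the
      number p + i q is what differentiating the power contributes. In these terms \<open>H\<close>
      becomes a sum of squares.\<close>
    define p where "p = (a1 r / 4 - \<mu> * a2 r / 2) / r\<^sup>2"
    define q where "q = (a2 r / 4 + \<mu> * a1 r / 2) / r\<^sup>2"
    have pq: "r ^ 3 * (p\<^sup>2 + q\<^sup>2) = \<kappa> / (2 * r) * ((a1 r)\<^sup>2 + (a2 r)\<^sup>2)"
      using that by (simp add: p_def q_def \<kappa>_def divide_simps power2_eq_square power3_eq_cube) (simp add: algebra_simps)
    have "H r = r ^ 3 * ((b1 r)\<^sup>2 + (b2 r)\<^sup>2) + 2 * r ^ 3 * (p * b1 r + q * b2 r) + (r + \<kappa> / r) * ((a1 r)\<^sup>2 + (a2 r)\<^sup>2)"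
      using that by (simp add: H_def p_def q_def divide_simps power2_eq_square power3_eq_cube) (simp add: algebra_simps)
    also have "\<dots> = r ^ 3 * ((b1 r + p)\<^sup>2 + (b2 r + q)\<^sup>2) - r ^ 3 * (p\<^sup>2 + q\<^sup>2) + (r + \<kappa> / r) * ((a1 r)\<^sup>2 + (a2 r)\<^sup>2)"
      by (simp add: power2_eq_square algebra_simps)
    also have "\<dots> = r ^ 3 * ((b1 r + p)\<^sup>2 + (b2 r + q)\<^sup>2) + r ^ 3 * (p\<^sup>2 + q\<^sup>2) + r * ((a1 r)\<^sup>2 + (a2 r)\<^sup>2)"
      using that unfolding pq by (simp add: field_simps)
    finally have H: "H r = r ^ 3 * ((b1 r + p)\<^sup>2 + (b2 r + q)\<^sup>2) + r ^ 3 * (p\<^sup>2 + q\<^sup>2) + r * ((a1 r)\<^sup>2 + (a2 r)\<^sup>2)" .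
    have r3: "r ^ 3 \<ge> 0" "r \<ge> 0" using that by auto
    have "b1 r ^ 2 \<le> 2 * ((b1 r + p)\<^sup>2 + p\<^sup>2)" "b2 r ^ 2 \<le> 2 * ((b2 r + q)\<^sup>2 + q\<^sup>2)"
      using sum_squares_ge_zero[of "b1 r + 2 * p" 0] sum_squares_ge_zero[of "b2 r + 2 * q" 0]
      by (simp_all add: power2_eq_square algebra_simps)
    then have "(b1 r)\<^sup>2 + (b2 r)\<^sup>2 \<le> 2 * (((b1 r + p)\<^sup>2 + (b2 r + q)\<^sup>2) + (p\<^sup>2 + q\<^sup>2))" by simp
    then have "r ^ 3 * ((b1 r)\<^sup>2 + (b2 r)\<^sup>2) \<le> r ^ 3 * (2 * (((b1 r + p)\<^sup>2 + (b2 r + q)\<^sup>2) + (p\<^sup>2 + q\<^sup>2)))"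
      using r3 by (intro mult_left_mono)
    also have "\<dots> \<le> 4 * H r" using r3 unfolding H
      by (simp add: algebra_simps)
    finally show ?thesis using r3 unfolding H by auto
  qed
  show ?thesis
  proof (intro exI[of _ "H 1"] conjI allI impI)
    show "H 1 \<ge> 0" using bounds[of 1] by (simp, meson order_trans sum_power2_ge_zero)
    fix r :: real assume r: "r \<ge> 1"
    show "(a1 r)\<^sup>2 + (a2 r)\<^sup>2 \<le> H 1 / r"
      using bounds[OF r] mono[OF r] r by (simp add: field_simps)
    show "(b1 r)\<^sup>2 + (b2 r)\<^sup>2 \<le> 4 * H 1 / r ^ 3"
      using bounds[OF r] mono[OF r] r by (simp add: field_simps)
  qed
qed

text \<open>With x = 2r these are the bounds O(r^{-1/2}) for J_\<nu>(2r) and J_{\<nu>+1}(2r); the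
  second carries a factor r, whence the cube. Order 0 is included and supplies the estimates for J_0
  and J_1.\<close>

lemma bser_decay:
  assumes "Re \<nu> = 0"
  shows "\<exists>E\<ge>0. \<forall>r\<ge>1. (norm (bser \<nu> (of_real (r\<^sup>2))))\<^sup>2 \<le> E / r
            \<and> (norm (bser (\<nu> + 1) (of_real (r\<^sup>2))))\<^sup>2 \<le> 4 * E / r ^ 3"
proof -
  define a where "a r = bser \<nu> (of_real (r\<^sup>2))" for r :: real
  define b where "b r = - bser (\<nu> + 1) (of_real (r\<^sup>2))" for r :: real
  have sq: "((\<lambda>r::real. complex_of_real (r\<^sup>2)) has_vector_derivative of_real (2 * r)) (at r)" for r
    unfolding has_real_derivative_iff_has_vector_derivative[symmetric]
    by (rule has_vector_derivative_of_real) (auto intro!: derivative_eq_intros)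
  have a': "(a has_vector_derivative of_real (2 * r) * b r) (at r)" for r
    unfolding a_def b_def using field_vector_diff_chain_at[OF sq has_field_derivative_bser] assms
    by (fastforce simp: o_def)
  have b': "(b has_vector_derivative of_real (2 / r) * (- (\<nu> + 1) * b r - a r)) (at r)" if "r > 0" for r
  proof -
    have "((\<lambda>r. - bser (\<nu> + 1) (of_real (r\<^sup>2))) has_vector_derivative
             - (of_real (2 * r) * - bser (\<nu> + 1 + 1) (of_real (r\<^sup>2)))) (at r)"
      using field_vector_diff_chain_at[OF sq has_field_derivative_bser[of "\<nu> + 1"]] assms
      by (intro has_vector_derivative_minus) (fastforce simp: o_def)
    \<comment> \<open>Differentiating the order \<nu> + 1 produces the order \<nu> + 2, which the
      recurrence eliminates.\<close>
    moreover have "of_real (2 / r) * (- (\<nu> + 1) * b r - a r) = of_real (2 * r) * bser (\<nu> + 2) (of_real (r\<^sup>2))"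
    proof -
      have "- (\<nu> + 1) * b r - a r = of_real (r\<^sup>2) * bser (\<nu> + 2) (of_real (r\<^sup>2))"
        unfolding a_def b_def using bser_rec[of \<nu> "of_real (r\<^sup>2)"] assms by (simp add: algebra_simps)
      moreover have "complex_of_real (2 / r) * of_real (r\<^sup>2) = of_real (2 * r)"
        unfolding of_real_mult[symmetric] using that by (simp add: power2_eq_square)
      ultimately show ?thesis by (metis mult.assoc)
    qed
    ultimately show ?thesis by (simp add: b_def[abs_def] add.assoc)
  qed
  have Re': "((\<lambda>r. Re (F r)) has_real_derivative Re d) (at r)" and
       Im': "((\<lambda>r. Im (F r)) has_real_derivative Im d) (at r)"
    if "(F has_vector_derivative d) (at r)" for F d r
    using bounded_linear.has_vector_derivative[OF bounded_linear_Re that]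
      bounded_linear.has_vector_derivative[OF bounded_linear_Im that]
    by (auto simp: has_real_derivative_iff_has_vector_derivative)
  define \<mu> where "\<mu> = Im \<nu>"
  have \<nu>: "\<nu> = \<i> * of_real \<mu>" using assms by (simp add: complex_eq_iff \<mu>_def)
  obtain E where "E \<ge> 0" and E: "\<And>r. r \<ge> 1 \<Longrightarrow>
      (Re (a r))\<^sup>2 + (Im (a r))\<^sup>2 \<le> E / r \<and> (Re (b r))\<^sup>2 + (Im (b r))\<^sup>2 \<le> 4 * E / r ^ 3"
  proof (rule exE[OF energy_decreasing[of "\<lambda>r. Re (a r)" "\<lambda>r. Re (b r)" "\<lambda>r. Im (a r)" "\<lambda>r. Im (b r)" \<mu>]])
    fix r :: real assume "r > 0"
    show "((\<lambda>r. Re (a r)) has_real_derivative 2 * r * Re (b r)) (at r)" using Re'[OF a'[of r]] by simp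
    show "((\<lambda>r. Im (a r)) has_real_derivative 2 * r * Im (b r)) (at r)" using Im'[OF a'[of r]] by simp
    show "((\<lambda>r. Re (b r)) has_real_derivative 2 / r * (- Re (b r) + \<mu> * Im (b r) - Re (a r))) (at r)"
      using Re'[OF b'[OF \<open>r > 0\<close>]] by (simp add: \<nu> algebra_simps)
    show "((\<lambda>r. Im (b r)) has_real_derivative 2 / r * (- Im (b r) - \<mu> * Re (b r) - Im (a r))) (at r)"
      using Im'[OF b'[OF \<open>r > 0\<close>]] by (simp add: \<nu> algebra_simps)
  qed blast
  have "(norm (b r))\<^sup>2 = (norm (bser (\<nu> + 1) (of_real (r\<^sup>2))))\<^sup>2" for r by (simp add: b_def)
  then show ?thesis using \<open>E \<ge> 0\<close> E by (auto simp: cmod_power2 a_def intro!: exI[of _ E])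
qed

subsection \<open>Products of Bessel series\<close>

text \<open>Walking down the functional equation produces a falling factorial. It is written as a
  generalised binomial so that Vandermonde's convolution can be applied to products of such
  values.\<close>

lemma rGamma_minus_of_nat:
  fixes a :: complex
  shows "rGamma (a + 1 - of_nat i) = rGamma (a + 1) * fact i * (a gchoose i)"
proof (induction i)
  case (Suc i)
  have "rGamma (a + 1 - of_nat (Suc i)) = (a - of_nat i) * rGamma (a + 1 - of_nat i)"
    using rGamma_plus1[of "a - of_nat i"] by (simp add: algebra_simps)
  also have "\<dots> = rGamma (a + 1) * fact i * ((a - of_nat i) * (a gchoose i))"
    unfolding Suc by (simp only: mult_ac)
  also have "(a - of_nat i) * (a gchoose i) = of_nat (Suc i) * (a gchoose Suc i)"
    using gbinomial_mult_1[of a i] by (simp add: algebra_simps)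
  finally show ?case by (simp add: algebra_simps)
qed simp

text \<open>All reciprocal Gamma values are referred to the top index \<open>m\<close>. What is left
  of the Cauchy product is a Vandermonde convolution with complex upper arguments.\<close>

lemma bser_mult_coeff:
  "(\<Sum>j\<le>m. bcoef \<mu> j * bcoef \<rho> (m - j)) =
     (-1) ^ m * rGamma (\<mu> + of_nat m + 1) * rGamma (\<rho> + of_nat m + 1) * ((\<mu> + \<rho> + 2 * of_nat m) gchoose m)"
proof -
  have "bcoef \<mu> j * bcoef \<rho> (m - j) =
      (-1) ^ m * rGamma (\<mu> + of_nat m + 1) * rGamma (\<rho> + of_nat m + 1) *
      (((\<rho> + of_nat m) gchoose j) * ((\<mu> + of_nat m) gchoose (m - j)))" if "j \<le> m" for j
  proof -
    have 1: "rGamma (of_nat j + \<mu> + 1) = rGamma (\<mu> + of_nat m + 1) * fact (m - j) * ((\<mu> + of_nat m) gchoose (m - j))"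
      using rGamma_minus_of_nat[of "\<mu> + of_nat m" "m - j"] that by (simp add: of_nat_diff algebra_simps)
    have 2: "rGamma (of_nat (m - j) + \<rho> + 1) = rGamma (\<rho> + of_nat m + 1) * fact j * ((\<rho> + of_nat m) gchoose j)"
      using rGamma_minus_of_nat[of "\<rho> + of_nat m" j] that by (simp add: of_nat_diff algebra_simps)
    have 3: "(-1::complex) ^ j * (-1) ^ (m - j) = (-1) ^ m" using that by (simp flip: power_add)
    have "bcoef \<mu> j * bcoef \<rho> (m - j) = ((-1) ^ j * (-1) ^ (m - j)) *
       (rGamma (of_nat j + \<mu> + 1) / fact (m - j)) * (rGamma (of_nat (m - j) + \<rho> + 1) / fact j)"
      by (simp add: bcoef_def field_simps)
    then show ?thesis unfolding 1 2 3 by simp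
  qed
  then have "(\<Sum>j\<le>m. bcoef \<mu> j * bcoef \<rho> (m - j)) =
      (-1) ^ m * rGamma (\<mu> + of_nat m + 1) * rGamma (\<rho> + of_nat m + 1) *
      (\<Sum>j\<le>m. ((\<rho> + of_nat m) gchoose j) * ((\<mu> + of_nat m) gchoose (m - j)))"
    by (simp add: sum_distrib_left)
  also have "(\<Sum>j\<le>m. ((\<rho> + of_nat m) gchoose j) * ((\<mu> + of_nat m) gchoose (m - j))) =
     ((\<mu> + \<rho> + 2 * of_nat m) gchoose m)"
    using gbinomial_Vandermonde[of "\<rho> + of_nat m" "\<mu> + of_nat m" m]
    by (simp add: atLeast0AtMost algebra_simps)
  finally show ?thesis .
qed

text \<open>This is (1 + (2X + X^2))^N = (1 + X)^{2N}. As the exponent need not be a natural number,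
  the argument goes through the differential equation (1 + X) A' = 2 N A with constant term 1, whose
  solution is unique.\<close>

lemma fps_binomial_compose_square:
  fixes N :: "'a :: field_char_0"
  shows "fps_binomial N oo (fps_X * (2 + fps_X)) = fps_binomial (2 * N)"
proof -
  let ?b = "fps_X * (2 + fps_X) :: 'a fps"
  define A where "A = fps_binomial N oo ?b"
  define D where "D = fps_deriv (fps_binomial N) oo ?b"
  have b0: "fps_nth ?b 0 = 0" by simp
  have nz: "(1 + fps_X :: 'a fps) \<noteq> 0"
    by (metis fps_X_nth fps_add_nth fps_one_nth fps_zero_nth add.right_neutral zero_neq_one)
  have "is_unit (1 + fps_X :: 'a fps)" by (simp add: fps_is_unit_iff)
  then have dvd: "(1 + fps_X :: 'a fps) dvd F" for F by (rule unit_imp_dvd)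
  have "(1 + fps_X) * fps_deriv (fps_binomial N) = fps_const N * fps_binomial N"
    unfolding fps_binomial_deriv by (rule dvd_mult_div_cancel[OF dvd])
  then have "((1 + fps_X) * fps_deriv (fps_binomial N)) oo ?b = (fps_const N * fps_binomial N) oo ?b"
    by simp
  then have 1: "(1 + ?b) * D = fps_const N * A"
    by (simp add: fps_compose_mult_distrib[OF b0] fps_compose_add_distrib D_def A_def)
  have "fps_deriv A = D * (2 + 2 * fps_X)"
    unfolding A_def D_def by (subst fps_compose_deriv[OF b0]) (simp add: algebra_simps)
  then have "(1 + fps_X) * fps_deriv A = 2 * ((1 + ?b) * D)"
    by (simp add: algebra_simps)
  also have "\<dots> = fps_const (2 * N) * A"
  proof -
    have "(2 :: 'a fps) = fps_const 2" by (simp add: numeral_fps_const)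
    then have "2 * (fps_const N * A) = fps_const (2 * N) * A"
      by (simp only: mult.assoc[symmetric] fps_const_mult)
    with 1 show ?thesis by simp
  qed
  finally have "fps_deriv A = fps_const (2 * N) * A / (1 + fps_X)"
    using nonzero_mult_div_cancel_left[OF nz, of "fps_deriv A"] by simp
  then have "A = fps_const (fps_nth A 0) * fps_binomial (2 * N)"
    by (subst (asm) fps_binomial_ODE_unique)
  moreover have "fps_nth A 0 = 1" by (simp add: A_def fps_compose_nth)
  ultimately show ?thesis by (simp add: A_def)
qed

text \<open>Extracts the coefficient of X^m from the preceding identity: in (2X + X^2)^j the index k
  = m - j counts the factors from which X^2 is taken.\<close>

lemma gbinomial_double:
  fixes N :: "'a :: field_char_0"
  shows "(2 * N) gchoose m =
    (\<Sum>k\<le>m. (N gchoose (m - k)) * of_nat ((m - k) choose k) * 2 ^ (m - 2 * k))"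
proof -
  have coeff: "fps_nth ((fps_X * (2 + fps_X)) ^ j) m = (of_nat (j choose (m - j)) * 2 ^ (m - 2 * (m - j)) :: 'a)"
    if "j \<le> m" for j
  proof -
    have "(2 + fps_X :: 'a fps) ^ j = (\<Sum>i\<le>j. of_nat (j choose i) * fps_X ^ i * 2 ^ (j - i))"
      by (subst add.commute) (rule binomial_ring)
    also have "\<dots> = (\<Sum>i\<le>j. fps_const (of_nat (j choose i) * 2 ^ (j - i)) * fps_X ^ i)"
    proof (rule sum.cong[OF refl])
      fix i
      have "(of_nat (j choose i) :: 'a fps) = fps_const (of_nat (j choose i))" by (simp add: fps_of_nat)
      moreover have "(2 :: 'a fps) ^ (j - i) = fps_const (2 ^ (j - i))"
        by (simp only: numeral_fps_const fps_const_power)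
      ultimately show "of_nat (j choose i) * fps_X ^ i * 2 ^ (j - i)
          = fps_const (of_nat (j choose i) * 2 ^ (j - i)) * (fps_X ^ i :: 'a fps)"
        by (simp only: fps_const_mult[symmetric] mult_ac)
    qed
    finally have "(2 + fps_X :: 'a fps) ^ j = (\<Sum>i\<le>j. fps_const (of_nat (j choose i) * 2 ^ (j - i)) * fps_X ^ i)" .
    then have "fps_nth ((2 + fps_X :: 'a fps) ^ j) (m - j) =
        fps_nth (\<Sum>i\<le>j. fps_const (of_nat (j choose i) * 2 ^ (j - i)) * fps_X ^ i) (m - j)" by simp
    also have "\<dots> =
        (\<Sum>i\<le>j. if m - j = i then of_nat (j choose i) * 2 ^ (j - i) else 0)"
      unfolding fps_sum_nth by (intro sum.cong refl) (simp add: fps_X_power_nth)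
    also have "\<dots> = (if m - j \<le> j then of_nat (j choose (m - j)) * 2 ^ (j - (m - j)) else 0)"
      by (subst sum.delta') auto
    also have "\<dots> = of_nat (j choose (m - j)) * 2 ^ (m - 2 * (m - j))"
    proof (cases "m - j \<le> j")
      case True
      then have "j - (m - j) = m - 2 * (m - j)" using that by simp
      with True show ?thesis by simp
    qed (simp add: binomial_eq_0)
    finally show ?thesis using that by (simp add: power_mult_distrib fps_X_power_mult_nth)
  qed
  have "(2 * N) gchoose m = fps_nth (fps_binomial N oo (fps_X * (2 + fps_X))) m"
    by (simp add: fps_binomial_compose_square)
  also have "\<dots> = (\<Sum>j\<le>m. (N gchoose j) * (of_nat (j choose (m - j)) * 2 ^ (m - 2 * (m - j))))"
    unfolding fps_compose_nth using coeff by (auto simp: atLeast0AtMost intro!: sum.cong)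
  also have "\<dots> = (\<Sum>k\<le>m. (N gchoose (m - k)) * (of_nat ((m - k) choose (m - (m - k))) * 2 ^ (m - 2 * (m - (m - k)))))"
    by (rule sum.reindex_bij_witness[of _ "\<lambda>k. m - k" "\<lambda>k. m - k"]) auto
  also have "\<dots> = (\<Sum>k\<le>m. (N gchoose (m - k)) * of_nat ((m - k) choose k) * 2 ^ (m - 2 * k))"
    by (rule sum.cong) auto
  finally show ?thesis .
qed

lemma sum_even_atMost:
  fixes F :: "nat \<Rightarrow> 'a :: comm_monoid_add"
  shows "(\<Sum>i\<le>m. if even i then F (i div 2) else 0) = (\<Sum>k\<le>m div 2. F k)"
proof -
  have "(\<Sum>i\<le>m. if even i then F (i div 2) else 0) = (\<Sum>i\<in>{i. i \<le> m \<and> even i}. F (i div 2))"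
    by (subst sum.inter_filter[symmetric]) auto
  also have "\<dots> = (\<Sum>k\<le>m div 2. F k)"
    by (rule sum.reindex_bij_witness[of _ "\<lambda>k. 2 * k" "\<lambda>i. i div 2"]) auto
  finally show ?thesis .
qed

text \<open>Comparison of coefficients in Kummer's second formula for the confluent hypergeometric function.\<close>
lemma kummer_coeff:
  fixes \<nu> :: complex
  shows "(\<Sum>i\<le>m. (if even i then rGamma (\<nu> + of_nat (i div 2) + 1) / fact (i div 2) else 0)
              * ((-2) ^ (m - i) / fact (m - i)))
       = (-1) ^ m * rGamma (\<nu> + of_nat m + 1) * ((2 * \<nu> + 2 * of_nat m) gchoose m)"
proof -
  define N where "N = \<nu> + of_nat m"
  define F where "F k = rGamma (\<nu> + of_nat k + 1) / fact k * ((-2) ^ (m - 2 * k) / fact (m - 2 * k))" for k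
  have F: "F k = (-1) ^ m * rGamma (N + 1) * ((N gchoose (m - k)) * of_nat ((m - k) choose k) * 2 ^ (m - 2 * k))"
    if "2 * k \<le> m" for k
  proof -
    \<comment> \<open>After referring the reciprocal Gamma value to the top one, the factorials
      combine to a binomial coefficient and the summand becomes that of
      \<open>gbinomial_double\<close>.\<close>
    have 1: "rGamma (\<nu> + of_nat k + 1) = rGamma (N + 1) * fact (m - k) * (N gchoose (m - k))"
      using rGamma_minus_of_nat[of N "m - k"] that by (simp add: N_def of_nat_diff algebra_simps)
    have "m - k - k = m - 2 * k" by simp
    then have "fact k * fact (m - 2 * k) * ((m - k) choose k) = fact (m - k)"
      using binomial_fact_lemma[of k "m - k"] that by simp
    then have "of_nat (fact k * fact (m - 2 * k) * ((m - k) choose k)) = (of_nat (fact (m - k)) :: complex)"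
      by (simp only:)
    then have "fact k * fact (m - 2 * k) * of_nat ((m - k) choose k) = (fact (m - k) :: complex)"
      by (simp only: of_nat_mult of_nat_fact)
    then have 2: "of_nat ((m - k) choose k) = (fact (m - k) / (fact k * fact (m - 2 * k)) :: complex)"
      by (metis fact_nonzero mult_eq_0_iff nonzero_mult_div_cancel_left)
    have "(-2::complex) ^ (m - 2 * k) = (-1) ^ (m - 2 * k) * 2 ^ (m - 2 * k)"
      by (simp flip: power_mult_distrib)
    moreover have "(-1::complex) ^ (m - 2 * k) = (-1) ^ m"
      using that by (simp add: minus_one_power_iff)
    ultimately have 3: "(-2::complex) ^ (m - 2 * k) = (-1) ^ m * 2 ^ (m - 2 * k)"
      by simp
    show ?thesis unfolding F_def 1 2 3 by simp
  qed
  have "(\<Sum>i\<le>m. (if even i then rGamma (\<nu> + of_nat (i div 2) + 1) / fact (i div 2) else 0)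
              * ((-2) ^ (m - i) / fact (m - i))) = (\<Sum>i\<le>m. if even i then F (i div 2) else 0)"
    by (rule sum.cong) (auto simp: F_def)
  also have "\<dots> = (\<Sum>k\<le>m div 2. F k)" by (rule sum_even_atMost)
  also have "\<dots> = (\<Sum>k\<le>m div 2. (-1) ^ m * rGamma (N + 1) * ((N gchoose (m - k)) * of_nat ((m - k) choose k) * 2 ^ (m - 2 * k)))"
    by (intro sum.cong F) auto
  also have "\<dots> = (\<Sum>k\<le>m. (-1) ^ m * rGamma (N + 1) * ((N gchoose (m - k)) * of_nat ((m - k) choose k) * 2 ^ (m - 2 * k)))"
    by (intro sum.mono_neutral_left) (auto simp: binomial_eq_0)
  also have "\<dots> = (-1) ^ m * rGamma (N + 1) * ((2 * N) gchoose m)"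
    by (simp add: gbinomial_double sum_distrib_left)
  finally show ?thesis by (simp add: N_def algebra_simps)
qed

subsection \<open>Weber's second exponential integral\<close>

text \<open>The form in which sums and integrals are exchanged throughout. Only the partial sums of
  the functions need a majorant; the convergence of the series of integrals is part of the
  conclusion.\<close>

lemma dominated_sums:
  fixes f :: "nat \<Rightarrow> 'a :: euclidean_space \<Rightarrow> 'b :: euclidean_space"
  assumes f: "\<And>k. (f k has_integral I k) S" and h: "h integrable_on S"
    and le: "\<And>n x. x \<in> S \<Longrightarrow> norm (\<Sum>k<n. f k x) \<le> h x"
    and F: "\<And>x. x \<in> S \<Longrightarrow> (\<lambda>k. f k x) sums F x"
  shows "F integrable_on S" "I sums integral S F"
proof -
  have s: "((\<lambda>x. \<Sum>k<n. f k x) has_integral (\<Sum>k<n. I k)) S" for n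
    by (intro has_integral_sum f) auto
  have *: "(\<lambda>n. \<Sum>k<n. f k x) \<longlonglongrightarrow> F x" if "x \<in> S" for x
    using F[OF that] by (simp add: sums_def)
  show "F integrable_on S"
    by (rule dominated_convergence[OF has_integral_integrable[OF s] h le *])
  have "(\<lambda>n. integral S (\<lambda>x. \<Sum>k<n. f k x)) \<longlonglongrightarrow> integral S F"
    by (rule dominated_convergence[OF has_integral_integrable[OF s] h le *])
  then show "I sums integral S F"
    by (simp add: sums_def integral_unique[OF s])
qed

text \<open>Substitution t = x^2/\<beta> in Euler's integral. Powers of x^2/4 appear because J_\<mu>
  J_\<rho> carries (x/2)^{\<mu>+\<rho>} = (x^2/4)^{(\<mu>+\<rho>)/2}.\<close>

lemma gaussian_moment:
  assumes "Re z > 0" "\<beta> > 0"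
  shows "((\<lambda>x. of_real (x / \<beta> * exp (- x\<^sup>2 / \<beta>)) * of_real (x\<^sup>2 / 4) powr (z - 1))
           has_integral 1 / 2 * of_real (\<beta> / 4) powr (z - 1) * Gamma z) {0<..}"
proof -
  define f where "f t = complex_of_real t powr (z - 1) / of_real (exp t)" for t :: real
  have im: "(\<lambda>x. x\<^sup>2 / \<beta>) ` {0<..} = {0<..}"
  proof (intro equalityI subsetI)
    fix t :: real assume "t \<in> {0<..}"
    then have "t = (sqrt (\<beta> * t))\<^sup>2 / \<beta>" "sqrt (\<beta> * t) > 0" using assms by auto
    then show "t \<in> (\<lambda>x. x\<^sup>2 / \<beta>) ` {0<..}" by (metis greaterThan_iff image_eqI)
  qed (use assms in auto)
  have "f absolutely_integrable_on {0<..} \<and> integral {0<..} f = Gamma z"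
    using absolutely_integrable_Gamma_integral'[OF assms(1)] Gamma_integral_complex'[OF assms(1)]
    by (auto simp: f_def[abs_def] integral_unique)
  then have "(\<lambda>x. \<bar>2 * x / \<beta>\<bar> *\<^sub>R f (x\<^sup>2 / \<beta>)) absolutely_integrable_on {0<..} \<and>
      integral {0<..} (\<lambda>x. \<bar>2 * x / \<beta>\<bar> *\<^sub>R f (x\<^sup>2 / \<beta>)) = Gamma z"
    by (subst has_absolute_integral_change_of_variables_real)
       (use assms in \<open>auto intro!: derivative_eq_intros inj_onI simp: im\<close>)
  then have "((\<lambda>x. \<bar>2 * x / \<beta>\<bar> *\<^sub>R f (x\<^sup>2 / \<beta>)) has_integral Gamma z) {0<..}"
    unfolding absolutely_integrable_on_def by (metis integrable_integral)
  then have "((\<lambda>x. 1 / 2 * of_real (\<beta> / 4) powr (z - 1) * (\<bar>2 * x / \<beta>\<bar> *\<^sub>R f (x\<^sup>2 / \<beta>)))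
      has_integral 1 / 2 * of_real (\<beta> / 4) powr (z - 1) * Gamma z) {0<..}"
    by (rule has_integral_mult_right)
  then show ?thesis
  proof (rule has_integral_eq[rotated])
    fix x :: real assume x: "x \<in> {0<..}"
    have "complex_of_real (x\<^sup>2 / 4) = of_real (\<beta> / 4) * of_real (x\<^sup>2 / \<beta>)"
      unfolding of_real_mult[symmetric] using assms by simp
    then have "complex_of_real (x\<^sup>2 / 4) powr (z - 1) = of_real (\<beta> / 4) powr (z - 1) * of_real (x\<^sup>2 / \<beta>) powr (z - 1)"
      using assms by (simp only:) (rule powr_times_real, auto)
    then show "1 / 2 * of_real (\<beta> / 4) powr (z - 1) * (\<bar>2 * x / \<beta>\<bar> *\<^sub>R f (x\<^sup>2 / \<beta>)) =
      of_real (x / \<beta> * exp (- x\<^sup>2 / \<beta>)) * of_real (x\<^sup>2 / 4) powr (z - 1)"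
      using x assms by (simp add: f_def scaleR_conv_of_real exp_minus divide_simps)
  qed
qed

lemma gaussian_integrable:
  assumes "\<beta> > 0"
  shows "(\<lambda>x::real. x / \<beta> * exp (- x\<^sup>2 / \<beta>)) integrable_on {0<..}"
proof -
  have "((\<lambda>x::real. of_real (x / \<beta> * exp (- x\<^sup>2 / \<beta>)) * of_real (x\<^sup>2 / 4) powr (1 - 1))
           has_integral 1 / 2 * of_real (\<beta> / 4) powr (1 - 1) * Gamma (1 :: complex)) {0<..}"
    by (rule gaussian_moment) (use assms in auto)
  then have "((\<lambda>x. complex_of_real (x / \<beta> * exp (- x\<^sup>2 / \<beta>))) has_integral 1 / 2 * of_real (\<beta> / 4) powr (1 - 1) * Gamma (1 :: complex)) {0<..}"
    by (rule has_integral_eq[rotated]) (use assms in auto)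
  from has_integral_linear[OF this bounded_linear_Re] show ?thesis by (auto simp: o_def)
qed

lemma power_over_fact_le_exp: "(x::real) \<ge> 0 \<Longrightarrow> x ^ m / fact m \<le> exp x"
proof -
  assume x: "x \<ge> 0"
  have "x ^ m / fact m = (\<Sum>k\<in>{m}. x ^ k /\<^sub>R fact k)" by (simp add: divide_inverse_commute)
  also have "\<dots> \<le> (\<Sum>k. x ^ k /\<^sub>R fact k)"
    by (rule sum_le_suminf) (use x summable_exp_generic[of x] in auto)
  finally show ?thesis by (simp add: exp_def)
qed

lemma sum_power_over_fact_le_exp: "(x::real) \<ge> 0 \<Longrightarrow> (\<Sum>m<n. x ^ m / fact m) \<le> exp x"
proof -
  assume x: "x \<ge> 0"
  have "(\<Sum>m<n. x ^ m / fact m) = (\<Sum>m<n. x ^ m /\<^sub>R fact m)" by (simp add: divide_inverse_commute)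
  also have "\<dots> \<le> (\<Sum>k. x ^ k /\<^sub>R fact k)"
    by (rule sum_le_suminf) (use x summable_exp_generic[of x] in auto)
  finally show ?thesis by (simp add: exp_def)
qed

text \<open>The bound x^{2m}/(m!)^2 for the terms is split into (2\<beta>)^m/m! times
  (x^2/(2\<beta>))^m/m!. The first factor is at most e^{2\<beta>}; the second sums to
  e^{x^2/(2\<beta>)} and consumes half of the Gaussian exponent. A Gaussian of parameter 2\<beta>
  remains as majorant.\<close>

lemma gaussian_series:
  assumes s: "Re s = 0" and \<beta>: "\<beta> > 0"
    and p: "\<And>m. norm (p m) \<le> A * 4 ^ m / (fact m)\<^sup>2"
    and F: "\<And>x. x > 0 \<Longrightarrow> (\<lambda>m. p m * of_real (x\<^sup>2 / 4) ^ m) sums F x"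
  shows "(\<lambda>x. of_real (x / \<beta> * exp (- x\<^sup>2 / \<beta>)) * (of_real (x\<^sup>2 / 4) powr s * F x)) integrable_on {0<..}"
    and "(\<lambda>m. 1 / 2 * of_real (\<beta> / 4) powr s * (p m * of_real (\<beta> / 4) ^ m * Gamma (s + of_nat m + 1))) sums
      integral {0<..} (\<lambda>x. of_real (x / \<beta> * exp (- x\<^sup>2 / \<beta>)) * (of_real (x\<^sup>2 / 4) powr s * F x))"
proof -
  define f where "f m x = of_real (x / \<beta> * exp (- x\<^sup>2 / \<beta>)) * (of_real (x\<^sup>2 / 4) powr s * (p m * of_real (x\<^sup>2 / 4) ^ m))" for m x
  define h where "h x = 2 * A * exp (2 * \<beta>) * (x / (2 * \<beta>) * exp (- x\<^sup>2 / (2 * \<beta>)))" for x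
  have A: "A \<ge> 0" using order_trans[OF norm_ge_zero p[of 0]] by simp
  have powr: "complex_of_real y powr s * of_real y ^ m = of_real y powr (s + of_nat m)" if "y > 0" for y m
    using that by (simp add: powr_add powr_nat')
  have 1: "(f m has_integral 1 / 2 * of_real (\<beta> / 4) powr s * (p m * of_real (\<beta> / 4) ^ m * Gamma (s + of_nat m + 1))) {0<..}" for m
  proof -
    have "((\<lambda>x. of_real (x / \<beta> * exp (- x\<^sup>2 / \<beta>)) * of_real (x\<^sup>2 / 4) powr (s + of_nat m))
           has_integral 1 / 2 * of_real (\<beta> / 4) powr (s + of_nat m) * Gamma (s + of_nat m + 1)) {0<..}"
      using gaussian_moment[of "s + of_nat m + 1" \<beta>] s \<beta> by simp
    from has_integral_mult_right[OF this, of "p m"]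
    have "((\<lambda>x. p m * (of_real (x / \<beta> * exp (- x\<^sup>2 / \<beta>)) * of_real (x\<^sup>2 / 4) powr (s + of_nat m)))
           has_integral p m * (1 / 2 * of_real (\<beta> / 4) powr (s + of_nat m) * Gamma (s + of_nat m + 1))) {0<..}" .
    then have "(f m has_integral p m * (1 / 2 * of_real (\<beta> / 4) powr (s + of_nat m) * Gamma (s + of_nat m + 1))) {0<..}"
      by (rule has_integral_eq[rotated]) (simp add: f_def powr[symmetric] del: of_real_divide of_real_power of_real_mult)
    also have "p m * (1 / 2 * of_real (\<beta> / 4) powr (s + of_nat m) * Gamma (s + of_nat m + 1)) =
       1 / 2 * of_real (\<beta> / 4) powr s * (p m * of_real (\<beta> / 4) ^ m * Gamma (s + of_nat m + 1))"
      using \<beta> by (simp add: powr[symmetric] del: of_real_divide)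
    finally show ?thesis .
  qed
  have 2: "h integrable_on {0<..}"
    unfolding h_def using gaussian_integrable[of "2 * \<beta>"] \<beta> by (intro integrable_on_mult_right) auto
  have 3: "norm (\<Sum>m<n. f m x) \<le> h x" if "x \<in> {0<..}" for n x
  proof -
    have x: "x > 0" using that by simp
    have trm: "norm (p m * of_real (x\<^sup>2 / 4) ^ m) \<le> A * exp (2 * \<beta>) * ((x\<^sup>2 / (2 * \<beta>)) ^ m / fact m)" for m
    proof -
      have "norm (p m * of_real (x\<^sup>2 / 4) ^ m) = norm (p m) * (x\<^sup>2 / 4) ^ m"
        by (simp add: norm_mult norm_power)
      also have "\<dots> \<le> A * 4 ^ m / (fact m)\<^sup>2 * (x\<^sup>2 / 4) ^ m"
        by (intro mult_right_mono p) auto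
      also have "\<dots> = A * ((2 * \<beta>) ^ m / fact m) * ((x\<^sup>2 / (2 * \<beta>)) ^ m / fact m)"
        using \<beta> by (simp add: power_divide power2_eq_square power_mult_distrib)
      also have "\<dots> \<le> A * exp (2 * \<beta>) * ((x\<^sup>2 / (2 * \<beta>)) ^ m / fact m)"
        using A \<beta> by (intro mult_right_mono mult_left_mono power_over_fact_le_exp) auto
      finally show ?thesis .
    qed
    have "norm (\<Sum>m<n. p m * of_real (x\<^sup>2 / 4) ^ m) \<le> (\<Sum>m<n. A * exp (2 * \<beta>) * ((x\<^sup>2 / (2 * \<beta>)) ^ m / fact m))"
      by (intro sum_norm_le trm)
    also have "\<dots> \<le> A * exp (2 * \<beta>) * exp (x\<^sup>2 / (2 * \<beta>))"
      unfolding sum_distrib_left[symmetric]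
      using A \<beta> by (intro mult_left_mono sum_power_over_fact_le_exp) auto
    finally have le: "norm (\<Sum>m<n. p m * of_real (x\<^sup>2 / 4) ^ m) \<le> A * exp (2 * \<beta>) * exp (x\<^sup>2 / (2 * \<beta>))" .
    have "(\<Sum>m<n. f m x) = of_real (x / \<beta> * exp (- x\<^sup>2 / \<beta>)) * (of_real (x\<^sup>2 / 4) powr s * (\<Sum>m<n. p m * of_real (x\<^sup>2 / 4) ^ m))"
      by (simp add: f_def sum_distrib_left)
    also have "norm \<dots> = \<bar>x / \<beta> * exp (- x\<^sup>2 / \<beta>)\<bar> * norm (\<Sum>m<n. p m * of_real (x\<^sup>2 / 4) ^ m)"
      using norm_real_powr_imaginary[OF _ s, of "x\<^sup>2 / 4"] x by (simp only: norm_mult norm_of_real) simp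
    also have "\<dots> \<le> \<bar>x / \<beta> * exp (- x\<^sup>2 / \<beta>)\<bar> * (A * exp (2 * \<beta>) * exp (x\<^sup>2 / (2 * \<beta>)))"
      by (intro mult_left_mono le) auto
    also have "\<dots> = A * exp (2 * \<beta>) * (x / \<beta>) * (exp (- x\<^sup>2 / \<beta>) * exp (x\<^sup>2 / (2 * \<beta>)))"
      using x \<beta> by simp
    also have "exp (- x\<^sup>2 / \<beta>) * exp (x\<^sup>2 / (2 * \<beta>)) = exp (- x\<^sup>2 / (2 * \<beta>))"
      using \<beta> by (simp add: exp_add[symmetric] field_simps)
    also have "A * exp (2 * \<beta>) * (x / \<beta>) * exp (- x\<^sup>2 / (2 * \<beta>)) = h x"
      by (simp add: h_def)
    finally show ?thesis .
  qed
  have 4: "(\<lambda>m. f m x) sums (of_real (x / \<beta> * exp (- x\<^sup>2 / \<beta>)) * (of_real (x\<^sup>2 / 4) powr s * F x))" if "x \<in> {0<..}" for x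
    unfolding f_def using that by (intro sums_mult F) auto
  show "(\<lambda>x. of_real (x / \<beta> * exp (- x\<^sup>2 / \<beta>)) * (of_real (x\<^sup>2 / 4) powr s * F x)) integrable_on {0<..}"
    by (rule dominated_sums(1)[OF 1 2 3 4])
  show "(\<lambda>m. 1 / 2 * of_real (\<beta> / 4) powr s * (p m * of_real (\<beta> / 4) ^ m * Gamma (s + of_nat m + 1))) sums
      integral {0<..} (\<lambda>x. of_real (x / \<beta> * exp (- x\<^sup>2 / \<beta>)) * (of_real (x\<^sup>2 / 4) powr s * F x))"
    by (rule dominated_sums(2)[OF 1 2 3 4])
qed

lemma sum_binomial_square_le: "(\<Sum>j\<le>m. (real (m choose j))\<^sup>2) \<le> 4 ^ m"
proof -
  have row: "(\<Sum>j\<le>m. real (m choose j)) = 2 ^ m"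
    using choose_row_sum[of m] by (metis of_nat_numeral of_nat_power of_nat_sum)
  have "(\<Sum>j\<le>m. (real (m choose j))\<^sup>2) \<le> (\<Sum>j\<le>m. 2 ^ m * real (m choose j))"
  proof (rule sum_mono)
    fix j assume "j \<in> {..m}"
    then have "real (m choose j) \<le> (\<Sum>j\<le>m. real (m choose j))" by (intro member_le_sum) auto
    then show "(real (m choose j))\<^sup>2 \<le> 2 ^ m * real (m choose j)"
      unfolding row by (simp add: power2_eq_square mult_right_mono)
  qed
  also have "\<dots> = 4 ^ m" unfolding sum_distrib_left[symmetric] row by (simp flip: power_mult_distrib)
  finally show ?thesis .
qed

text \<open>The convolution is estimated directly, without its closed form: 1/(j! (m-j)!)^2 is the
  squared binomial coefficient over (m!)^2, and the squares sum to at most 4^m.\<close>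

lemma norm_bser_mult_coeff_le:
  assumes "Re \<mu> \<ge> 0" "Re \<rho> \<ge> 0"
  shows "norm (\<Sum>j\<le>m. bcoef \<mu> j * bcoef \<rho> (m - j))
     \<le> norm (rGamma (\<mu> + 1)) * norm (rGamma (\<rho> + 1)) * 4 ^ m / (fact m)\<^sup>2"
proof -
  let ?A = "norm (rGamma (\<mu> + 1))" and ?B = "norm (rGamma (\<rho> + 1))"
  have "norm (\<Sum>j\<le>m. bcoef \<mu> j * bcoef \<rho> (m - j)) \<le> (\<Sum>j\<le>m. ?A * ?B / (fact m)\<^sup>2 * (real (m choose j))\<^sup>2)"
  proof (rule sum_norm_le)
    fix j assume "j \<in> {..m}"
    then have c: "real (m choose j) = fact m / (fact j * fact (m - j))" by (simp add: binomial_fact)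
    have "norm (bcoef \<mu> j * bcoef \<rho> (m - j)) \<le> ?A / (fact j)\<^sup>2 * (?B / (fact (m - j))\<^sup>2)"
      unfolding norm_mult by (intro mult_mono norm_bcoef_le assms) auto
    also have "\<dots> = ?A * ?B / (fact m)\<^sup>2 * (real (m choose j))\<^sup>2"
      unfolding c by (simp add: power_mult_distrib power_divide)
    finally show "norm (bcoef \<mu> j * bcoef \<rho> (m - j)) \<le> ?A * ?B / (fact m)\<^sup>2 * (real (m choose j))\<^sup>2" .
  qed
  also have "\<dots> \<le> ?A * ?B / (fact m)\<^sup>2 * 4 ^ m"
    unfolding sum_distrib_left[symmetric] by (intro mult_left_mono sum_binomial_square_le) auto
  finally show ?thesis by simp
qed

lemma bser_mult_sums:
  assumes "Re \<mu> \<ge> 0" "Re \<rho> \<ge> 0"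
  shows "(\<lambda>m. (\<Sum>j\<le>m. bcoef \<mu> j * bcoef \<rho> (m - j)) * z ^ m) sums (bser \<mu> z * bser \<rho> z)"
proof -
  have "(\<lambda>m. \<Sum>j\<le>m. (bcoef \<mu> j * z ^ j) * (bcoef \<rho> (m - j) * z ^ (m - j))) sums (bser \<mu> z * bser \<rho> z)"
    unfolding bser_def by (rule Cauchy_product_sums) (use assms in \<open>auto intro: summable_norm_bser\<close>)
  moreover have "(\<Sum>j\<le>m. (bcoef \<mu> j * z ^ j) * (bcoef \<rho> (m - j) * z ^ (m - j))) =
      (\<Sum>j\<le>m. bcoef \<mu> j * bcoef \<rho> (m - j)) * z ^ m" for m
    unfolding sum_distrib_right
    by (rule sum.cong) (auto simp: mult_ac simp flip: power_add)
  ultimately show ?thesis by simp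
qed

text \<open>The power series of the product of two Bessel functions is integrated term by term. For
  imaginary orders the common power of x has modulus 1, so \<open>gaussian_series\<close>
  applies.\<close>

lemma weber_product:
  assumes \<mu>: "Re \<mu> = 0" and \<rho>: "Re \<rho> = 0" and \<beta>: "\<beta> > 0"
  defines "c \<equiv> \<lambda>m. (-1) ^ m * rGamma (\<mu> + of_nat m + 1) * rGamma (\<rho> + of_nat m + 1)
     * ((\<mu> + \<rho> + 2 * of_nat m) gchoose m) * of_real (\<beta> / 4) ^ m * Gamma ((\<mu> + \<rho>) / 2 + of_nat m + 1)"
  shows "(\<lambda>x. of_real (x / \<beta> * exp (- x\<^sup>2 / \<beta>)) * (besselJ \<mu> x * besselJ \<rho> x)) integrable_on {0<..}"
    and "(\<lambda>m. 1 / 2 * of_real (\<beta> / 4) powr ((\<mu> + \<rho>) / 2) * c m) sums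
      integral {0<..} (\<lambda>x. of_real (x / \<beta> * exp (- x\<^sup>2 / \<beta>)) * (besselJ \<mu> x * besselJ \<rho> x))"
proof -
  define p where "p m = (\<Sum>j\<le>m. bcoef \<mu> j * bcoef \<rho> (m - j))" for m
  define F where "F x = bser \<mu> (of_real (x\<^sup>2 / 4)) * bser \<rho> (of_real (x\<^sup>2 / 4))" for x :: real
  have J: "besselJ \<mu> x * besselJ \<rho> x = of_real (x\<^sup>2 / 4) powr ((\<mu> + \<rho>) / 2) * F x" if "x > 0" for x
  proof -
    have "complex_of_real (x\<^sup>2 / 4) = of_real (x / 2) * of_real (x / 2)"
      unfolding of_real_mult[symmetric] by (simp add: power2_eq_square)
    then have "complex_of_real (x\<^sup>2 / 4) powr ((\<mu> + \<rho>) / 2) = of_real (x / 2) powr ((\<mu> + \<rho>) / 2) * of_real (x / 2) powr ((\<mu> + \<rho>) / 2)"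
      using that by (simp add: powr_times_real del: of_real_divide)
    also have "\<dots> = of_real (x / 2) powr \<mu> * of_real (x / 2) powr \<rho>"
      unfolding powr_add[symmetric] by simp
    finally show ?thesis using that \<mu> \<rho> by (simp add: besselJ_eq_bser F_def power_divide)
  qed
  have le: "norm (p m) \<le> norm (rGamma (\<mu> + 1)) * norm (rGamma (\<rho> + 1)) * 4 ^ m / (fact m)\<^sup>2" for m
    unfolding p_def by (rule norm_bser_mult_coeff_le) (use \<mu> \<rho> in auto)
  have sums: "(\<lambda>m. p m * of_real (x\<^sup>2 / 4) ^ m) sums F x" for x
    unfolding p_def F_def by (rule bser_mult_sums) (use \<mu> \<rho> in auto)
  have re: "Re ((\<mu> + \<rho>) / 2) = 0" using \<mu> \<rho> by simp
  note * = gaussian_series[OF re \<beta> le sums]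
  have eq: "of_real (x / \<beta> * exp (- x\<^sup>2 / \<beta>)) * (of_real (x\<^sup>2 / 4) powr ((\<mu> + \<rho>) / 2) * F x) =
     of_real (x / \<beta> * exp (- x\<^sup>2 / \<beta>)) * (besselJ \<mu> x * besselJ \<rho> x)" if "x \<in> {0<..}" for x
    using J[of x] that by simp
  show "(\<lambda>x. of_real (x / \<beta> * exp (- x\<^sup>2 / \<beta>)) * (besselJ \<mu> x * besselJ \<rho> x)) integrable_on {0<..}"
    by (rule integrable_eq[OF *(1) eq])
  have "p m * of_real (\<beta> / 4) ^ m * Gamma ((\<mu> + \<rho>) / 2 + of_nat m + 1) = c m" for m
    by (simp add: p_def c_def bser_mult_coeff)
  with *(2) show "(\<lambda>m. 1 / 2 * of_real (\<beta> / 4) powr ((\<mu> + \<rho>) / 2) * c m) sums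
      integral {0<..} (\<lambda>x. of_real (x / \<beta> * exp (- x\<^sup>2 / \<beta>)) * (besselJ \<mu> x * besselJ \<rho> x))"
    by (simp only: integral_cong[OF eq])
qed

text \<open>The modified Bessel function I_\<nu>(2w) without its factor w^\<nu>.\<close>

definition Iser :: "complex \<Rightarrow> real \<Rightarrow> complex" where
  "Iser \<nu> w = (\<Sum>k. rGamma (\<nu> + of_nat k + 1) / fact k * of_real w ^ (2 * k))"

lemma summable_norm_Iser:
  assumes "Re \<nu> \<ge> 0"
  shows "summable (\<lambda>k. norm (rGamma (\<nu> + of_nat k + 1) / fact k * of_real w ^ (2 * k)))"
proof -
  have "norm (rGamma (\<nu> + of_nat k + 1) / fact k * of_real w ^ (2 * k)) = norm (bcoef \<nu> k * of_real (w\<^sup>2) ^ k)" for k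
    by (simp add: bcoef_def norm_mult norm_divide norm_power power_mult add_ac)
  with summable_norm_bser[OF assms, of "of_real (w\<^sup>2)"] show ?thesis by simp
qed

lemma Iser_sums:
  "Re \<nu> \<ge> 0 \<Longrightarrow> (\<lambda>k. rGamma (\<nu> + of_nat k + 1) / fact k * of_real w ^ (2 * k)) sums Iser \<nu> w"
  unfolding Iser_def by (rule summable_sums) (rule summable_norm_cancel, rule summable_norm_Iser)

text \<open>Kummer's second formula as a Cauchy product of the series of \<open>Iser\<close> with
  the exponential series; \<open>kummer_coeff\<close> evaluates its coefficients.\<close>

lemma kummer_sums:
  assumes "Re \<nu> \<ge> 0"
  shows "(\<lambda>m. (-1) ^ m * rGamma (\<nu> + of_nat m + 1) * ((2 * \<nu> + 2 * of_nat m) gchoose m) * of_real w ^ m)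
     sums (Iser \<nu> w * exp (- 2 * of_real w))"
proof -
  \<comment> \<open>The even power series is padded with zero odd coefficients, so that it can be
    multiplied with the exponential series.\<close>
  define d where "d i = (if even i then rGamma (\<nu> + of_nat (i div 2) + 1) / fact (i div 2) else 0)" for i
  have sm: "strict_mono (\<lambda>k::nat. 2 * k)" by (rule strict_monoI) simp
  have d0: "d i = 0" if "i \<notin> range (\<lambda>k. 2 * k)" for i using that by (auto simp: d_def)
  have d2: "d (2 * k) * of_real w ^ (2 * k) = rGamma (\<nu> + of_nat k + 1) / fact k * of_real w ^ (2 * k)" for k
    by (simp add: d_def)
  have 1: "(\<lambda>i. d i * of_real w ^ i) sums Iser \<nu> w"
    using Iser_sums[OF assms, of w] sums_mono_reindex[OF sm, of "\<lambda>i. d i * of_real w ^ i" "Iser \<nu> w"]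
    by (simp add: d0 d2)
  have 2: "summable (\<lambda>i. norm (d i * of_real w ^ i))"
    using summable_norm_Iser[OF assms, of w] summable_mono_reindex[OF sm, of "\<lambda>i. norm (d i * of_real w ^ i)"]
    by (simp add: d0 d2 del: norm_mult norm_divide)
  define e where "e l = (-2 * complex_of_real w) ^ l / fact l" for l
  have 3: "e sums exp (- 2 * of_real w)" "summable (\<lambda>l. norm (e l))"
    unfolding e_def using exp_converges[of "-2 * complex_of_real w"] summable_norm_exp[of "-2 * complex_of_real w"]
    by (simp_all add: scaleR_conv_of_real divide_inverse mult.commute)
  have "(\<lambda>m. \<Sum>i\<le>m. (d i * of_real w ^ i) * e (m - i)) sums ((\<Sum>i. d i * of_real w ^ i) * (\<Sum>l. e l))"
    by (rule Cauchy_product_sums[OF 2 3(2)])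
  also have "(\<Sum>i. d i * of_real w ^ i) = Iser \<nu> w" using 1 by (simp add: sums_iff)
  also have "(\<Sum>l. e l) = exp (- 2 * of_real w)" using 3 by (simp add: sums_iff)
  also have "(\<lambda>m. \<Sum>i\<le>m. (d i * of_real w ^ i) * e (m - i)) =
    (\<lambda>m. (-1) ^ m * rGamma (\<nu> + of_nat m + 1) * ((2 * \<nu> + 2 * of_nat m) gchoose m) * of_real w ^ m)"
  proof
    fix m
    have "(\<Sum>i\<le>m. (d i * of_real w ^ i) * e (m - i)) = (\<Sum>i\<le>m. d i * ((-2) ^ (m - i) / fact (m - i))) * of_real w ^ m"
      unfolding sum_distrib_right
    proof (rule sum.cong[OF refl])
      fix i assume "i \<in> {..m}"
      then have "complex_of_real w ^ m = of_real w ^ i * of_real w ^ (m - i)" by (simp flip: power_add)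
      moreover have "e (m - i) = (-2) ^ (m - i) / fact (m - i) * of_real w ^ (m - i)"
        unfolding e_def power_mult_distrib by simp
      ultimately show "(d i * of_real w ^ i) * e (m - i) = d i * ((-2) ^ (m - i) / fact (m - i)) * of_real w ^ m"
        by simp
    qed
    then show "(\<Sum>i\<le>m. (d i * of_real w ^ i) * e (m - i)) =
      (-1) ^ m * rGamma (\<nu> + of_nat m + 1) * ((2 * \<nu> + 2 * of_nat m) gchoose m) * of_real w ^ m"
      using kummer_coeff[of \<nu> m] unfolding d_def by (simp only:)
  qed
  finally show ?thesis .
qed

lemma Gamma_times_rGamma:
  fixes z :: complex
  assumes "Re z > 0"
  shows "rGamma z * Gamma z = 1"
proof -
  have "z \<notin> \<int>\<^sub>\<le>\<^sub>0" using assms by (auto elim!: nonpos_Ints_cases)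
  then show ?thesis by (simp add: rGamma_inverse_Gamma Gamma_eq_zero_iff)
qed

text \<open>The factor \<Gamma>(\<nu> + m + 1) of the moment cancels one of the two reciprocal
  Gammas, and the rest is Kummer's series at w = \<beta>/4. The value is thus (1/2) e^{-\<beta>/2}
  I_\<nu>(\<beta>/2).\<close>

lemma weber_square:
  assumes \<nu>: "Re \<nu> = 0" and \<beta>: "\<beta> > 0"
  shows "integral {0<..} (\<lambda>x. of_real (x / \<beta> * exp (- x\<^sup>2 / \<beta>)) * (besselJ \<nu> x * besselJ \<nu> x))
     = 1 / 2 * of_real (\<beta> / 4) powr \<nu> * (Iser \<nu> (\<beta> / 4) * exp (- of_real (\<beta> / 2)))"
proof -
  have A: "(\<lambda>m. 1 / 2 * of_real (\<beta> / 4) powr ((\<nu> + \<nu>) / 2) * ((-1) ^ m * rGamma (\<nu> + of_nat m + 1) * rGamma (\<nu> + of_nat m + 1)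
     * ((\<nu> + \<nu> + 2 * of_nat m) gchoose m) * of_real (\<beta> / 4) ^ m * Gamma ((\<nu> + \<nu>) / 2 + of_nat m + 1)))
     sums integral {0<..} (\<lambda>x. of_real (x / \<beta> * exp (- x\<^sup>2 / \<beta>)) * (besselJ \<nu> x * besselJ \<nu> x))"
    by (rule weber_product(2)[OF \<nu> \<nu> \<beta>])
  have B: "(-1) ^ m * rGamma (\<nu> + of_nat m + 1) * rGamma (\<nu> + of_nat m + 1)
     * ((\<nu> + \<nu> + 2 * of_nat m) gchoose m) * of_real (\<beta> / 4) ^ m * Gamma ((\<nu> + \<nu>) / 2 + of_nat m + 1) =
     (-1) ^ m * rGamma (\<nu> + of_nat m + 1) * ((2 * \<nu> + 2 * of_nat m) gchoose m) * of_real (\<beta> / 4) ^ m" for m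
  proof -
    have "rGamma (\<nu> + of_nat m + 1) * Gamma (\<nu> + of_nat m + 1) = 1"
      by (rule Gamma_times_rGamma) (use \<nu> in simp)
    moreover have "(\<nu> + \<nu>) / 2 = \<nu>" "\<nu> + \<nu> + 2 * of_nat m = 2 * \<nu> + 2 * of_nat m" by simp_all
    moreover have "a * R * R * g * w * G = a * R * g * w * (R * G)" for a R g w G :: complex
      by (simp only: mult_ac)
    ultimately show ?thesis by (simp only: mult_1_right)
  qed
  have C: "(\<lambda>m. 1 / 2 * of_real (\<beta> / 4) powr \<nu> * ((-1) ^ m * rGamma (\<nu> + of_nat m + 1) * ((2 * \<nu> + 2 * of_nat m) gchoose m) * of_real (\<beta> / 4) ^ m))
     sums (1 / 2 * of_real (\<beta> / 4) powr \<nu> * (Iser \<nu> (\<beta> / 4) * exp (- 2 * of_real (\<beta> / 4))))"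
    by (intro sums_mult kummer_sums) (use \<nu> in simp)
  have "(\<nu> + \<nu>) / 2 = \<nu>" by simp
  with A[unfolded B] have "integral {0<..} (\<lambda>x. of_real (x / \<beta> * exp (- x\<^sup>2 / \<beta>)) * (besselJ \<nu> x * besselJ \<nu> x)) =
      1 / 2 * of_real (\<beta> / 4) powr \<nu> * (Iser \<nu> (\<beta> / 4) * exp (- 2 * of_real (\<beta> / 4)))"
    using sums_unique2 C by (simp only:)
  moreover have "- 2 * complex_of_real (\<beta> / 4) = - of_real (\<beta> / 2)" by simp
  ultimately show ?thesis by (simp only:)
qed

text \<open>For opposite orders the powers of x cancel: the moment is m! and the binomial
  coefficient is central. Both reciprocal Gammas stay, and the sum is recognised as an integral only
  with \<open>cos_power_integral\<close>.\<close>

lemma weber_mixed: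
  assumes \<nu>: "Re \<nu> = 0" and \<beta>: "\<beta> > 0"
  shows "(\<lambda>m. 1 / 2 * ((-1) ^ m * rGamma (\<nu> + of_nat m + 1) * rGamma (- \<nu> + of_nat m + 1)
            * (fact (2 * m) / fact m) * of_real (\<beta> / 4) ^ m)) sums
     integral {0<..} (\<lambda>x. of_real (x / \<beta> * exp (- x\<^sup>2 / \<beta>)) * (besselJ \<nu> x * besselJ (- \<nu>) x))"
proof -
  have "Re (- \<nu>) = 0" using \<nu> by simp
  note * = weber_product(2)[OF \<nu> this \<beta>]
  have "(-1) ^ m * rGamma (\<nu> + of_nat m + 1) * rGamma (- \<nu> + of_nat m + 1)
     * ((\<nu> + - \<nu> + 2 * of_nat m) gchoose m) * of_real (\<beta> / 4) ^ m * Gamma ((\<nu> + - \<nu>) / 2 + of_nat m + 1) =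
     (-1) ^ m * rGamma (\<nu> + of_nat m + 1) * rGamma (- \<nu> + of_nat m + 1)
            * (fact (2 * m) / fact m) * of_real (\<beta> / 4) ^ m" for m
  proof -
    have "((2 * of_nat m) gchoose m :: complex) = of_nat (2 * m choose m)"
      by (simp add: binomial_gbinomial)
    then have 1: "((\<nu> + - \<nu> + 2 * of_nat m) gchoose m) = (fact (2 * m) / (fact m * fact m) :: complex)"
      by (simp add: binomial_fact)
    have 2: "Gamma ((\<nu> + - \<nu>) / 2 + of_nat m + 1) = (fact m :: complex)"
      using Gamma_fact[of m, where ?'a = complex] by (simp add: add.commute)
    show ?thesis unfolding 1 2 by simp
  qed
  moreover have "complex_of_real (\<beta> / 4) powr ((\<nu> + - \<nu>) / 2) = 1" using \<beta> by simp
  ultimately show ?thesis using * by (simp only: mult_1_right)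
qed

subsection \<open>Schlaefli's integral\<close>

lemma has_integral_to_infinity:
  fixes F :: "real \<Rightarrow> complex"
  assumes F: "\<And>u. u \<ge> 0 \<Longrightarrow> (F has_vector_derivative F' u) (at u within {0..})"
    and h: "h integrable_on {0..}" and le: "\<And>u. u \<ge> 0 \<Longrightarrow> norm (F' u) \<le> h u"
    and lim: "(F \<longlongrightarrow> L) at_top"
  shows "(F' has_integral (L - F 0)) {0..}"
proof -
  define f where "f n u = (if u \<le> real n then F' u else 0)" for n u
  have 1: "(f n has_integral (F (real n) - F 0)) {0..}" for n
  proof -
    have "(F' has_integral (F (real n) - F 0)) {0..real n}"
      by (rule fundamental_theorem_of_calculus) (auto intro: has_vector_derivative_within_subset[OF F])
    moreover have "{0..real n} = {0..} \<inter> {..real n}" by auto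
    ultimately show ?thesis
      unfolding f_def using has_integral_restrict_Int[of "{..real n}" F' _ "{0..}"] by (auto simp: Int_commute)
  qed
  have 2: "norm (f n u) \<le> h u" if "u \<in> {0..}" for n u
    using le[of u] that order_trans[OF norm_ge_zero le[of u]] by (auto simp: f_def)
  have 3: "(\<lambda>n. f n u) \<longlonglongrightarrow> F' u" if "u \<in> {0..}" for u
  proof (rule tendsto_eventually)
    obtain N :: nat where "u \<le> N" using real_arch_simple by blast
    then show "\<forall>\<^sub>F n in sequentially. f n u = F' u"
      by (intro eventually_sequentiallyI[of N]) (auto simp: f_def)
  qed
  note dc = dominated_convergence[OF has_integral_integrable[OF 1] h 2 3]
  have "(\<lambda>n. F (real n) - F 0) \<longlonglongrightarrow> L - F 0"
    by (intro tendsto_diff tendsto_const filterlim_compose[OF lim filterlim_real_sequentially])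
  with dc(2) have "integral {0..} F' = L - F 0"
    by (simp add: integral_unique[OF 1] LIMSEQ_unique)
  with dc(1) show ?thesis by (metis integrable_integral)
qed

section \<open>Incomplete gamma functions\<close>

lemma double_exp_integrable:
  assumes "w > 0"
  shows "(\<lambda>u::real. 2 * exp (- w * exp (2 * u)) * exp (2 * u)) integrable_on {0..}"
proof (rule has_integral_integrable, rule has_integral_to_inf)
  define F where "F u = - (1 / w) * exp (- w * exp (2 * u))" for u :: real
  have F: "(F has_real_derivative 2 * exp (- w * exp (2 * u)) * exp (2 * u)) (at u within A)" for u A
    unfolding F_def by (rule derivative_eq_intros refl | use assms in simp)+
  have I: "((\<lambda>u. 2 * exp (- w * exp (2 * u)) * exp (2 * u)) has_integral (F y - F 0)) {0..y}" if "y \<ge> 0" for y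
    using that F by (intro fundamental_theorem_of_calculus) (auto simp: has_real_derivative_iff_has_vector_derivative[symmetric])
  show "(\<lambda>u. 2 * exp (- w * exp (2 * u)) * exp (2 * u)) integrable_on {0..y}" for y
    by (intro integrable_continuous_interval continuous_intros)
  have "LIM u at_top. exp (2 * u :: real) :> at_top"
    by (rule filterlim_compose[OF exp_at_top]) (rule filterlim_tendsto_pos_mult_at_top[OF tendsto_const _ filterlim_ident], simp)
  then have "LIM u at_top. w * exp (2 * u) :> at_top"
    by (rule filterlim_tendsto_pos_mult_at_top[OF tendsto_const assms])
  then have "((\<lambda>u. exp (- (w * exp (2 * u)))) \<longlongrightarrow> 0) at_top"
    by (intro filterlim_compose[OF exp_at_bot] filterlim_uminus_at_bot_at_top[THEN filterlim_compose])
  then have "((\<lambda>y. F y - F 0) \<longlongrightarrow> - (1 / w) * 0 - F 0) at_top"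
    unfolding F_def by (intro tendsto_intros) simp
  moreover have "eventually (\<lambda>y. F y - F 0 = integral {0..y} (\<lambda>u. 2 * exp (- w * exp (2 * u)) * exp (2 * u))) at_top"
    by (rule eventually_mono[OF eventually_ge_at_top[of 0]]) (rule integral_unique[OF I, symmetric])
  ultimately show "((\<lambda>y. integral {0..y} (\<lambda>u. 2 * exp (- w * exp (2 * u)) * exp (2 * u))) \<longlongrightarrow> - (1 / w) * 0 - F 0) at_top"
    by (rule Lim_transform_eventually)
qed auto

text \<open>In terms of the incomplete gamma functions, the series below is $w^c \gamma(-c, w)$, and the integrand
  \<open>gint\<close> defined afterwards integrates to $w^c \Gamma(-c, w)$ over the positive half-line.\<close>
definition phi :: "real \<Rightarrow> complex \<Rightarrow> complex" where
  "phi w c = (\<Sum>j. of_real (- w) ^ j / fact j / (of_nat j - c))"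

lemma phi_sums:
  assumes "Im c \<noteq> 0"
  shows "(\<lambda>j. of_real (- w) ^ j / fact j / (of_nat j - c)) sums phi w c"
  unfolding phi_def
proof (rule summable_sums, rule summable_comparison_test')
  show "summable (\<lambda>j. \<bar>w\<bar> ^ j / fact j * (1 / \<bar>Im c\<bar>))"
    using summable_exp[of "\<bar>w\<bar>"] by (intro summable_mult2) (simp add: field_simps)
  fix j :: nat
  have "\<bar>Im c\<bar> = \<bar>Im (of_nat j - c)\<bar>" by simp
  also have "\<dots> \<le> norm (of_nat j - c)" by (rule abs_Im_le_cmod)
  finally have "1 / norm (of_nat j - c) \<le> 1 / \<bar>Im c\<bar>" using assms by (intro divide_left_mono mult_pos_pos) linarith+
  then have "\<bar>w\<bar> ^ j / fact j * (1 / norm (of_nat j - c)) \<le> \<bar>w\<bar> ^ j / fact j * (1 / \<bar>Im c\<bar>)"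
    by (intro mult_left_mono) auto
  then show "norm (of_real (- w) ^ j / fact j / (of_nat j - c)) \<le> \<bar>w\<bar> ^ j / fact j * (1 / \<bar>Im c\<bar>)"
    by (simp add: norm_divide norm_power norm_mult)
qed

text \<open>Termwise -c/(j - c) = 1 - j/(j - c): the first part sums to the exponential, the second
  is the series at c - 1 with its index shifted.\<close>

lemma phi_rec:
  assumes "Im c \<noteq> 0"
  shows "- c * phi w c = exp (- of_real w) + of_real w * phi w (c - 1)"
proof -
  have ne: "of_nat j - c \<noteq> 0" for j using assms by (auto simp: complex_eq_iff)
  have "(\<lambda>j. of_real (- w) ^ j / fact j) sums exp (- complex_of_real w)"
    using exp_converges[of "- complex_of_real w"] by (simp add: scaleR_conv_of_real divide_inverse mult.commute)
  moreover have "(\<lambda>j. of_nat j * (of_real (- w) ^ j / fact j) / (of_nat j - c)) sums (- of_real w * phi w (c - 1))"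
  proof -
    have "(\<lambda>j. - of_real w * (of_real (- w) ^ j / fact j / (of_nat j - (c - 1)))) sums (- of_real w * phi w (c - 1))"
      by (intro sums_mult phi_sums) (use assms in simp)
    moreover have "- of_real w * (of_real (- w) ^ j / fact j / (of_nat j - (c - 1))) =
       of_nat (Suc j) * (of_real (- w) ^ Suc j / fact (Suc j)) / (of_nat (Suc j) - c)" for j
      by (simp add: algebra_simps del: of_nat_Suc) (simp add: algebra_simps)
    ultimately have "(\<lambda>j. of_nat (Suc j) * (of_real (- w) ^ Suc j / fact (Suc j)) / (of_nat (Suc j) - c)) sums (- of_real w * phi w (c - 1))"
      by (simp only:)
    then show ?thesis by (subst (asm) sums_Suc_iff) simp
  qed
  ultimately have "(\<lambda>j. of_real (- w) ^ j / fact j - of_nat j * (of_real (- w) ^ j / fact j) / (of_nat j - c)) sums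
      (exp (- of_real w) - (- of_real w * phi w (c - 1)))"
    by (rule sums_diff)
  moreover have "of_real (- w) ^ j / fact j - of_nat j * (of_real (- w) ^ j / fact j) / (of_nat j - c) =
      - c * (of_real (- w) ^ j / fact j / (of_nat j - c))" for j
  proof -
    have "a - of_nat j * a / (of_nat j - c) = - c * (a / (of_nat j - c))" for a :: complex
      using ne[of j] by (simp add: divide_simps) (simp add: algebra_simps)
    then show ?thesis .
  qed
  moreover have "(\<lambda>j. - c * (of_real (- w) ^ j / fact j / (of_nat j - c))) sums (- c * phi w c)"
    by (intro sums_mult phi_sums assms)
  ultimately show ?thesis by (simp add: sums_unique2)
qed

definition gint :: "real \<Rightarrow> complex \<Rightarrow> real \<Rightarrow> complex" where
  "gint w c u = of_real (2 * exp (- w * exp (2 * u))) * exp (- (2 * c * of_real u))"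

lemma norm_gint_le:
  assumes "Re c \<ge> - 1" "u \<ge> 0"
  shows "norm (gint w c u) \<le> 2 * exp (- w * exp (2 * u)) * exp (2 * u)"
proof -
  have "- Re c * u \<le> 1 * u" by (rule mult_right_mono) (use assms in auto)
  then show ?thesis by (simp add: gint_def norm_mult mult.commute)
qed

lemma gint_integrable:
  assumes "Re c \<ge> - 1" "w > 0"
  shows "gint w c integrable_on {0..}"
proof -
  have c: "continuous_on {0..} (gint w c)" unfolding gint_def by (intro continuous_intros)
  show ?thesis
    by (rule measurable_bounded_by_integrable_imp_integrable[OF _ double_exp_integrable[OF assms(2)]])
       (use norm_gint_le[OF assms(1)] c in \<open>auto intro!: continuous_imp_measurable_on_sets_lebesgue\<close>)
qed

text \<open>Integrates the derivative of e^{-w e^{2u} - 2cu}. The inhomogeneous term is opposite to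
  that of \<open>phi_rec\<close>, so the sum of \<open>phi\<close> and this integral obeys a
  homogeneous recurrence, the one satisfied by w^c \<Gamma>(-c).\<close>

lemma gint_rec:
  assumes "Re c \<ge> 0" "w > 0"
  shows "c * integral {0..} (gint w c) = exp (- of_real w) - of_real w * integral {0..} (gint w (c - 1))"
proof -
  define F where "F u = exp (- complex_of_real (w * exp (2 * u)) - 2 * c * of_real u)" for u
  have F: "(F has_vector_derivative - of_real w * gint w (c - 1) u - c * gint w c u) (at u within A)" for u A
  proof -
    have "((\<lambda>u. - complex_of_real (w * exp (2 * u)) - 2 * c * of_real u) has_vector_derivative
         (- of_real (2 * w * exp (2 * u)) - 2 * c)) (at u within A)"
      by (rule derivative_eq_intros has_vector_derivative_of_real refl | simp)+
    from field_vector_diff_chain_within[OF this, of exp "exp (- complex_of_real (w * exp (2 * u)) - 2 * c * of_real u)"]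
    have "(F has_vector_derivative (- of_real (2 * w * exp (2 * u)) - 2 * c) * F u) (at u within A)"
      unfolding F_def[abs_def] o_def using DERIV_exp by (blast intro: DERIV_subset)
    also have "(- of_real (2 * w * exp (2 * u)) - 2 * c) * F u = - of_real w * gint w (c - 1) u - c * gint w c u"
    proof -
      have 1: "gint w c u = 2 * F u" by (simp add: gint_def F_def exp_diff exp_minus exp_of_real[symmetric] field_simps)
      have "gint w (c - 1) u = gint w c u * of_real (exp (2 * u))"
        by (simp add: gint_def exp_of_real[symmetric] mult.assoc flip: exp_add) (simp add: algebra_simps)
      then show ?thesis unfolding 1 by (simp add: algebra_simps)
    qed
    finally show ?thesis .
  qed
  define h where "h u = (w + norm c) * (2 * exp (- w * exp (2 * u)) * exp (2 * u))" for u
  have h: "h integrable_on {0..}"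
    unfolding h_def by (intro integrable_on_mult_right double_exp_integrable assms)
  have le: "norm (- of_real w * gint w (c - 1) u - c * gint w c u) \<le> h u" if "u \<ge> 0" for u
  proof -
    have "norm (- of_real w * gint w (c - 1) u - c * gint w c u) \<le> w * norm (gint w (c - 1) u) + norm c * norm (gint w c u)"
      by (rule order_trans[OF norm_triangle_ineq4]) (use assms in \<open>simp add: norm_mult\<close>)
    also have "\<dots> \<le> w * (2 * exp (- w * exp (2 * u)) * exp (2 * u)) + norm c * (2 * exp (- w * exp (2 * u)) * exp (2 * u))"
      using assms that by (intro add_mono mult_left_mono norm_gint_le) auto
    finally show ?thesis by (simp add: h_def algebra_simps)
  qed
  have lim: "(F \<longlongrightarrow> 0) at_top"
  proof (rule Lim_null_comparison)
    show "((\<lambda>u. exp (- (w * u))) \<longlongrightarrow> 0) at_top"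
      by (intro filterlim_compose[OF exp_at_bot] filterlim_uminus_at_bot_at_top[THEN filterlim_compose]
           filterlim_tendsto_pos_mult_at_top[OF tendsto_const assms(2)] filterlim_ident)
    have "norm (F u) \<le> exp (- (w * u))" if "u \<ge> 0" for u
    proof -
      have "u \<le> exp (2 * u)" using exp_ge_add_one_self[of "2 * u"] that by linarith
      then have "w * u \<le> w * exp (2 * u)" using assms by simp
      moreover have "0 \<le> Re c * u" using assms that by simp
      ultimately show ?thesis by (simp add: F_def)
    qed
    then show "\<forall>\<^sub>F u in at_top. norm (F u) \<le> exp (- (w * u))"
      by (rule eventually_mono[OF eventually_ge_at_top[of 0]])
  qed
  have "((\<lambda>u. - of_real w * gint w (c - 1) u - c * gint w c u) has_integral (0 - F 0)) {0..}"
    by (rule has_integral_to_infinity[OF F h le lim])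
  moreover have "((\<lambda>u. - of_real w * gint w (c - 1) u - c * gint w c u) has_integral
      (- of_real w * integral {0..} (gint w (c - 1)) - c * integral {0..} (gint w c))) {0..}"
    by (intro has_integral_diff has_integral_mult_right integrable_integral gint_integrable) (use assms in auto)
  ultimately have "0 - F 0 = - of_real w * integral {0..} (gint w (c - 1)) - c * integral {0..} (gint w c)"
    by (rule has_integral_unique)
  then show ?thesis by (simp add: F_def algebra_simps)
qed

lemma integral_exp_complex:
  assumes "Re c > 0"
  shows "((\<lambda>u. 2 * exp (- (2 * c * of_real u))) has_integral 1 / c) {0..}"
proof -
  define F where "F u = - (1 / c) * exp (- (2 * c * complex_of_real u))" for u
  have c0: "c \<noteq> 0" using assms by auto
  have F: "(F has_vector_derivative 2 * exp (- (2 * c * of_real u))) (at u within A)" for u A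
    unfolding F_def
    apply (rule has_vector_derivative_real_field derivative_eq_intros refl)+
    using c0 by simp_all
  have h: "(\<lambda>u. 2 * exp (- (2 * Re c) * u)) integrable_on {0..}"
    using has_integral_exp_minus_to_infinity[of "2 * Re c" 0] assms
    by (intro integrable_on_mult_right) (auto simp: has_integral_iff)
  have lim: "(F \<longlongrightarrow> 0) at_top"
  proof -
    have "((\<lambda>u. exp (- (2 * Re c * u))) \<longlongrightarrow> 0) at_top"
      using assms by (intro filterlim_compose[OF exp_at_bot] filterlim_uminus_at_bot_at_top[THEN filterlim_compose]
           filterlim_tendsto_pos_mult_at_top[OF tendsto_const _ filterlim_ident]) auto
    then have "((\<lambda>u. exp (- (2 * c * complex_of_real u))) \<longlongrightarrow> 0) at_top"
      by (subst tendsto_norm_zero_iff[symmetric]) simp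
    from tendsto_mult_right_zero[OF this, of "- (1 / c)"] show ?thesis by (simp add: F_def[abs_def])
  qed
  have "((\<lambda>u. 2 * exp (- (2 * c * of_real u))) has_integral (0 - F 0)) {0..}"
    by (rule has_integral_to_infinity[OF F h _ lim]) (simp_all add: norm_mult)
  then show ?thesis by (simp add: F_def)
qed

lemma powr_exp_real: "complex_of_real (exp y) powr z = exp (z * of_real y)"
  by (simp add: powr_def flip: exp_of_real)

text \<open>The induction starts at order \<nu> - 1 because Euler's integral needs a positive real
  part: it converges for \<Gamma>(1 - \<nu>) but not for \<Gamma>(-\<nu>). The integral is cut at t
  = w. Above the cut t = w e^{2u} leads to \<open>gint\<close>; below it t = w e^{-2u} and expansion
  of the exponential lead to \<open>phi\<close>.\<close>

lemma gint_base:
  assumes \<nu>: "Re \<nu> = 0" "Im \<nu> \<noteq> 0" and w: "w > 0"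
  shows "integral {0..} (gint w (\<nu> - 1)) = of_real w powr (\<nu> - 1) * Gamma (1 - \<nu>) - phi w (\<nu> - 1)"
proof -
  define f where "f t = complex_of_real t powr (- \<nu>) / of_real (exp t)" for t :: real
  have f: "f absolutely_integrable_on {0<..}" "(f has_integral Gamma (1 - \<nu>)) {0<..}"
    using absolutely_integrable_Gamma_integral'[of "1 - \<nu>"] Gamma_integral_complex'[of "1 - \<nu>"] \<nu>
    by (simp_all add: f_def[abs_def])
  have f1: "f absolutely_integrable_on {w..}" and f2: "f absolutely_integrable_on {0<..w}"
    by (rule set_integrable_subset[OF f(1)]; use w in auto)+
  have "{0<..} = {0<..w} \<union> {w..}" using w by auto
  moreover have "negligible ({0<..w} \<inter> {w..})"
    by (rule negligible_subset[of "{w}"]) auto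
  ultimately have split: "Gamma (1 - \<nu>) = integral {0<..w} f + integral {w..} f"
    using f(2) integral_Un[of f "{0<..w}" "{w..}"] f1 f2
    by (simp add: integral_unique set_lebesgue_integral_eq_integral(1))
  have im1: "(\<lambda>u. w * exp (2 * u)) ` {0..} = {w..}"
  proof (intro equalityI subsetI)
    fix t assume t: "t \<in> {w..}"
    then have "t = w * exp (2 * (ln (t / w) / 2))" "ln (t / w) / 2 \<ge> 0" using w by auto
    then show "t \<in> (\<lambda>u. w * exp (2 * u)) ` {0..}" by (metis atLeast_iff image_eqI)
  qed (use w in auto)
  have im2: "(\<lambda>u. w * exp (- 2 * u)) ` {0..} = {0<..w}"
  proof (intro equalityI subsetI)
    fix t assume t: "t \<in> {0<..w}"
    then have "t = w * exp (- 2 * (- ln (t / w) / 2))" "- ln (t / w) / 2 \<ge> 0" using w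
      by auto
    then show "t \<in> (\<lambda>u. w * exp (- 2 * u)) ` {0..}" by (metis atLeast_iff image_eqI)
  qed (use w in \<open>auto simp: mult_le_cancel_left1\<close>)
  \<comment> \<open>Both substitutions have the form t = w e^y with y = 2u or y = -2u and the
    Jacobian 2 w e^y, so one identity serves them both.\<close>
  have fexp: "of_real (2 * w * exp y) * f (w * exp y) =
     of_real w powr (1 - \<nu>) * (of_real (2 * exp (- w * exp y)) * exp ((1 - \<nu>) * of_real y))" for y
  proof -
    have 1: "complex_of_real (w * exp y) powr (- \<nu>) = of_real w powr (- \<nu>) * exp (- \<nu> * of_real y)"
      using w by (simp add: powr_times_real powr_exp_real)
    have 2: "complex_of_real w powr (1 - \<nu>) = of_real w * of_real w powr (- \<nu>)"
      using w powr_add[of "of_real w" 1 "- \<nu>"] by simp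
    have 3: "exp ((1 - \<nu>) * complex_of_real y) = of_real (exp y) * exp (- \<nu> * of_real y)"
    proof -
      have "(1 - \<nu>) * complex_of_real y = of_real y + - \<nu> * of_real y" by (simp add: algebra_simps)
      then show ?thesis by (simp only: exp_add exp_of_real)
    qed
    show ?thesis unfolding f_def 1 2 3 by (simp add: exp_minus divide_inverse)
  qed
  have 1: "integral {w..} f = of_real w powr (1 - \<nu>) * integral {0..} (gint w (\<nu> - 1))"
  proof -
    have "integral {w..} f = integral {0..} (\<lambda>u. \<bar>2 * w * exp (2 * u)\<bar> *\<^sub>R f (w * exp (2 * u)))"
    proof -
      have "((\<lambda>u. w * exp (2 * u)) has_field_derivative 2 * w * exp (2 * u)) (at u within {0..})" for u
        by (auto intro!: derivative_eq_intros)
      moreover have "inj_on (\<lambda>u. w * exp (2 * u)) {0..}" using w by (auto intro!: inj_onI)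
      ultimately show ?thesis
        using has_absolute_integral_change_of_variables_real[of "{0..}" "\<lambda>u. w * exp (2 * u)" "\<lambda>u. 2 * w * exp (2 * u)" f "integral {w..} f"]
          f1 unfolding im1 by simp
    qed
    also have "\<dots> = integral {0..} (\<lambda>u. of_real w powr (1 - \<nu>) * gint w (\<nu> - 1) u)"
      by (rule integral_cong) (use fexp[of "2 * u" for u] w in
           \<open>simp add: gint_def scaleR_conv_of_real abs_mult algebra_simps\<close>)
    finally show ?thesis by simp
  qed
  have 2: "integral {0<..w} f = of_real w powr (1 - \<nu>) * phi w (\<nu> - 1)"
  proof -
    define g where "g u = of_real (2 * exp (- w * exp (- 2 * u))) * exp ((1 - \<nu>) * of_real (- 2 * u))" for u
    have "integral {0<..w} f = integral {0..} (\<lambda>u. \<bar>- 2 * w * exp (- 2 * u)\<bar> *\<^sub>R f (w * exp (- 2 * u)))"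
    proof -
      have "((\<lambda>u. w * exp (- 2 * u)) has_field_derivative - 2 * w * exp (- 2 * u)) (at u within {0..})" for u
        by (auto intro!: derivative_eq_intros)
      moreover have "inj_on (\<lambda>u. w * exp (- 2 * u)) {0..}" using w by (auto intro!: inj_onI)
      ultimately show ?thesis
        using has_absolute_integral_change_of_variables_real[of "{0..}" "\<lambda>u. w * exp (- 2 * u)" "\<lambda>u. - 2 * w * exp (- 2 * u)" f "integral {0<..w} f"]
          f2 unfolding im2 by simp
    qed
    also have "\<dots> = integral {0..} (\<lambda>u. of_real w powr (1 - \<nu>) * g u)"
      by (rule integral_cong) (use fexp[of "- 2 * u" for u] w in
           \<open>simp add: g_def scaleR_conv_of_real abs_mult algebra_simps\<close>)
    also have "\<dots> = of_real w powr (1 - \<nu>) * integral {0..} g" by simp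
    also have "integral {0..} g = phi w (\<nu> - 1)"
    proof -
      define F where "F j u = of_real (- w) ^ j / fact j * (2 * exp (- (2 * (of_nat j - (\<nu> - 1)) * of_real u)))" for j u
      have F: "(F j has_integral of_real (- w) ^ j / fact j * (1 / (of_nat j - (\<nu> - 1)))) {0..}" for j
        unfolding F_def by (intro has_integral_mult_right integral_exp_complex) (use \<nu> in simp)
      have Fexp: "F j u = 2 * exp ((1 - \<nu>) * of_real (- 2 * u)) * (of_real (- w * exp (- 2 * u)) ^ j / fact j)" for j u
      proof -
        have "exp (- (2 * (of_nat j - (\<nu> - 1)) * complex_of_real u)) = exp ((1 - \<nu>) * of_real (- 2 * u)) * exp (of_real (- 2 * u)) ^ j"
          by (simp add: exp_of_nat_mult[symmetric] algebra_simps flip: exp_add)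
        moreover have "complex_of_real (- w * exp (- 2 * u)) ^ j = of_real (- w) ^ j * exp (of_real (- 2 * u)) ^ j"
          by (simp only: of_real_mult[of "- w" "exp (- 2 * u)"] exp_of_real power_mult_distrib)
        ultimately show ?thesis unfolding F_def by (simp only: times_divide_eq_right times_divide_eq_left mult_ac)
      qed
      have h: "(\<lambda>u. 2 * exp w * exp (- 2 * u)) integrable_on {0..}"
        using has_integral_exp_minus_to_infinity[of 2 0]
        by (intro integrable_on_mult_right) (auto simp: has_integral_iff)
      have le: "norm (\<Sum>j<n. F j u) \<le> 2 * exp w * exp (- 2 * u)" if "u \<in> {0..}" for n u
      proof -
        have "norm (F j u) \<le> 2 * exp (- 2 * u) * (w ^ j / fact j)" for j
        proof -
          have "(w * exp (- 2 * u)) ^ j \<le> w ^ j" using w that by (intro power_mono) auto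
          then have "(w * exp (- 2 * u)) ^ j / fact j \<le> w ^ j / fact j" by (rule divide_right_mono) simp
          then have "2 * exp (- 2 * u) * ((w * exp (- 2 * u)) ^ j / fact j) \<le> 2 * exp (- 2 * u) * (w ^ j / fact j)"
            by (rule mult_left_mono) simp
          moreover have "norm (F j u) = 2 * exp (- 2 * u) * ((w * exp (- 2 * u)) ^ j / fact j)"
            unfolding Fexp using w \<nu> by (simp add: norm_mult norm_divide norm_power power_mult_distrib)
          ultimately show ?thesis by (simp only:)
        qed
        then have "norm (\<Sum>j<n. F j u) \<le> (\<Sum>j<n. 2 * exp (- 2 * u) * (w ^ j / fact j))"
          by (intro sum_norm_le)
        also have "\<dots> \<le> 2 * exp (- 2 * u) * exp w"
          unfolding sum_distrib_left[symmetric] using w by (intro mult_left_mono sum_power_over_fact_le_exp) auto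
        finally show ?thesis by (simp add: mult_ac)
      qed
      have sums: "(\<lambda>j. F j u) sums g u" for u
      proof -
        have "(\<lambda>j. of_real (- w * exp (- 2 * u)) ^ j / fact j) sums exp (complex_of_real (- w * exp (- 2 * u)))"
          using exp_converges[of "complex_of_real (- w * exp (- 2 * u))"] by (simp add: scaleR_conv_of_real divide_inverse mult.commute)
        from sums_mult[OF this[unfolded exp_of_real], of "2 * exp ((1 - \<nu>) * of_real (- 2 * u))"] show ?thesis
          unfolding Fexp g_def of_real_mult[of 2] by (simp only: mult_ac of_real_numeral)
      qed
      have "(\<lambda>j. of_real (- w) ^ j / fact j * (1 / (of_nat j - (\<nu> - 1)))) sums integral {0..} g"
        by (rule dominated_sums(2)[OF F h le sums])
      moreover have "(\<lambda>j. of_real (- w) ^ j / fact j * (1 / (of_nat j - (\<nu> - 1)))) sums phi w (\<nu> - 1)"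
        using phi_sums[of "\<nu> - 1" w] \<nu> by simp
      ultimately show ?thesis by (rule sums_unique2)
    qed
    finally show ?thesis .
  qed
  have "of_real w powr (\<nu> - 1) * Gamma (1 - \<nu>) =
    (of_real w powr (\<nu> - 1) * of_real w powr (1 - \<nu>)) * (phi w (\<nu> - 1) + integral {0..} (gint w (\<nu> - 1)))"
    unfolding split 1 2 by (simp add: algebra_simps)
  also have "complex_of_real w powr (\<nu> - 1) * of_real w powr (1 - \<nu>) = 1"
    using w powr_add[of "complex_of_real w" "\<nu> - 1" "1 - \<nu>"] by simp
  finally show ?thesis by simp
qed

text \<open>Matches the two recurrences with \<Gamma>(1 - c) = -c \<Gamma>(-c). Each application
  continues the formula one unit further beyond the half-plane in which Euler's integral
  converges.\<close>

lemma gint_step: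
  assumes "Re c \<ge> 0" "Im c \<noteq> 0" "w > 0"
    and "integral {0..} (gint w (c - 1)) = of_real w powr (c - 1) * Gamma (1 - c) - phi w (c - 1)"
  shows "integral {0..} (gint w c) = of_real w powr c * Gamma (- c) - phi w c"
proof -
  have c0: "c \<noteq> 0" using assms by auto
  have "- c \<notin> \<int>\<^sub>\<le>\<^sub>0" using assms by (auto elim!: nonpos_Ints_cases simp: complex_eq_iff)
  then have G: "Gamma (1 - c) = - c * Gamma (- c)" using Gamma_plus1[of "- c"] by simp
  have "of_real w * of_real w powr (c - 1) = of_real w powr c"
    using assms powr_add[of "complex_of_real w" 1 "c - 1"] by simp
  then have "c * integral {0..} (gint w c) = exp (- of_real w) + of_real w * phi w (c - 1) + c * (of_real w powr c * Gamma (- c))"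
    unfolding gint_rec[OF assms(1,3)] assms(4) G by (simp add: algebra_simps)
  also have "\<dots> = c * (of_real w powr c * Gamma (- c) - phi w c)"
    unfolding phi_rec[OF assms(2), symmetric] by (simp add: algebra_simps)
  finally show ?thesis using c0 by simp
qed

lemma gint_integral:
  assumes \<nu>: "Re \<nu> = 0" "Im \<nu> \<noteq> 0" and w: "w > 0"
  shows "integral {0..} (gint w (\<nu> + of_nat k)) = of_real w powr (\<nu> + of_nat k) * Gamma (- \<nu> - of_nat k) - phi w (\<nu> + of_nat k)"
proof (induction k)
  case 0
  show ?case using gint_step[OF _ _ w gint_base[OF \<nu> w]] \<nu> by simp
next
  case (Suc k)
  have "integral {0..} (gint w (\<nu> + of_nat (Suc k))) = of_real w powr (\<nu> + of_nat (Suc k)) * Gamma (- (\<nu> + of_nat (Suc k))) - phi w (\<nu> + of_nat (Suc k))"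
    by (rule gint_step) (use \<nu> w Suc in \<open>simp_all add: algebra_simps\<close>)
  moreover have "- (\<nu> + of_nat (Suc k)) = - \<nu> - of_nat (Suc k)" by simp
  ultimately show ?case by (simp only:)
qed

text \<open>With t = 2u this is e^{-x cosh t - \<nu> t} dt at x = 2w, the integrand of the infinite
  integral in Schlaefli's formula; the factor 2 is dt/du.\<close>

definition Qint :: "complex \<Rightarrow> real \<Rightarrow> real \<Rightarrow> complex" where
  "Qint \<nu> w u = of_real (2 * exp (- 2 * w * cosh (2 * u))) * exp (- (2 * \<nu> * of_real u))"

text \<open>The exponential e^{-2w cosh 2u} factors into e^{-w e^{2u}} and e^{-w e^{-2u}}. Only the
  second factor is expanded, and each power of it raises the order of \<open>gint\<close> by
  one.\<close>

lemma Qint_sums: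
  assumes \<nu>: "Re \<nu> = 0" and w: "w > 0"
  shows "Qint \<nu> w integrable_on {0..}"
    "(\<lambda>k. of_real (- w) ^ k / fact k * integral {0..} (gint w (\<nu> + of_nat k))) sums integral {0..} (Qint \<nu> w)"
proof -
  define F where "F k u = of_real (- w) ^ k / fact k * gint w (\<nu> + of_nat k) u" for k u
  have F: "(F k has_integral of_real (- w) ^ k / fact k * integral {0..} (gint w (\<nu> + of_nat k))) {0..}" for k
    unfolding F_def by (intro has_integral_mult_right integrable_integral gint_integrable) (use \<nu> w in auto)
  have h: "(\<lambda>u. exp w * (2 * exp (- w * exp (2 * u)) * exp (2 * u))) integrable_on {0..}"
    by (intro integrable_on_mult_right double_exp_integrable w)
  have le: "norm (\<Sum>k<n. F k u) \<le> exp w * (2 * exp (- w * exp (2 * u)) * exp (2 * u))" if "u \<in> {0..}" for n u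
  proof -
    have "norm (\<Sum>k<n. F k u) \<le> (\<Sum>k<n. (2 * exp (- w * exp (2 * u)) * exp (2 * u)) * (w ^ k / fact k))"
    proof (rule sum_norm_le)
      fix k
      have "norm (F k u) = w ^ k / fact k * norm (gint w (\<nu> + of_nat k) u)"
        unfolding F_def using w by (simp add: norm_mult norm_divide norm_power)
      also have "\<dots> \<le> w ^ k / fact k * (2 * exp (- w * exp (2 * u)) * exp (2 * u))"
        using w that \<nu> by (intro mult_left_mono norm_gint_le) auto
      finally show "norm (F k u) \<le> (2 * exp (- w * exp (2 * u)) * exp (2 * u)) * (w ^ k / fact k)"
        by (simp only: mult.commute)
    qed
    also have "\<dots> \<le> (2 * exp (- w * exp (2 * u)) * exp (2 * u)) * exp w"
      unfolding sum_distrib_left[symmetric] using w by (intro mult_left_mono sum_power_over_fact_le_exp) auto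
    finally show ?thesis by (simp only: mult.commute)
  qed
  have sums: "(\<lambda>k. F k u) sums Qint \<nu> w u" for u
  proof -
    have "(\<lambda>k. of_real (- w * exp (- 2 * u)) ^ k / fact k) sums exp (complex_of_real (- w * exp (- 2 * u)))"
      using exp_converges[of "complex_of_real (- w * exp (- 2 * u))"] by (simp add: scaleR_conv_of_real divide_inverse mult.commute)
    from sums_mult[OF this, of "gint w \<nu> u"]
    have "(\<lambda>k. gint w \<nu> u * (of_real (- w * exp (- 2 * u)) ^ k / fact k)) sums (gint w \<nu> u * exp (complex_of_real (- w * exp (- 2 * u))))" .
    also have "(\<lambda>k. gint w \<nu> u * (of_real (- w * exp (- 2 * u)) ^ k / fact k)) = (\<lambda>k. F k u)"
    proof
      fix k
      have "gint w (\<nu> + of_nat k) u = gint w \<nu> u * exp (of_real (- 2 * u)) ^ k"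
        by (simp add: gint_def exp_of_nat_mult[symmetric] algebra_simps flip: exp_add)
      moreover have "complex_of_real (- w * exp (- 2 * u)) ^ k = of_real (- w) ^ k * exp (of_real (- 2 * u)) ^ k"
        by (simp only: of_real_mult[of "- w" "exp (- 2 * u)"] exp_of_real power_mult_distrib)
      ultimately show "gint w \<nu> u * (of_real (- w * exp (- 2 * u)) ^ k / fact k) = F k u"
        unfolding F_def by (simp only: times_divide_eq_right times_divide_eq_left mult_ac)
    qed
    also have "gint w \<nu> u * exp (complex_of_real (- w * exp (- 2 * u))) = Qint \<nu> w u"
    proof -
      have "exp (- w * exp (2 * u)) * exp (- w * exp (- 2 * u)) = exp (- 2 * w * cosh (2 * u))"
        by (simp add: cosh_def algebra_simps flip: exp_add)
      then have "complex_of_real (2 * exp (- w * exp (2 * u))) * of_real (exp (- w * exp (- 2 * u))) =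
          of_real (2 * exp (- 2 * w * cosh (2 * u)))"
        by (simp only: of_real_mult[symmetric] mult.assoc)
      then show ?thesis unfolding gint_def Qint_def exp_of_real by (simp only: mult_ac)
    qed
    finally show ?thesis .
  qed
  show "Qint \<nu> w integrable_on {0..}" by (rule dominated_sums(1)[OF F h le sums])
  show "(\<lambda>k. of_real (- w) ^ k / fact k * integral {0..} (gint w (\<nu> + of_nat k))) sums integral {0..} (Qint \<nu> w)"
    by (rule dominated_sums(2)[OF F h le sums])
qed

section \<open>Angular integrals and Schlaefli's formula\<close>

lemma integral_exp_ii:
  fixes c :: complex
  assumes "c \<noteq> 0"
  shows "((\<lambda>A. exp (\<i> * c * of_real A)) has_integral 2 * sin (c * of_real pi) / c) {- pi..pi}"
proof -
  define F where "F A = exp (\<i> * c * complex_of_real A) / (\<i> * c)" for A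
  have "(F has_vector_derivative exp (\<i> * c * of_real A)) (at A within {-pi..pi})" for A
    unfolding F_def
    apply (rule has_vector_derivative_real_field derivative_eq_intros refl)+
    using assms by simp_all
  then have "((\<lambda>A. exp (\<i> * c * of_real A)) has_integral (F pi - F (- pi))) {-pi..pi}"
    by (intro fundamental_theorem_of_calculus) auto
  also have "F pi - F (- pi) = 2 * sin (c * of_real pi) / c"
    unfolding F_def sin_exp_eq using assms by (simp add: field_simps)
  finally show ?thesis .
qed

lemma sin_nat_minus:
  "sin ((of_nat j - (\<nu> + of_nat k)) * complex_of_real pi) = - ((-1) ^ j) * (-1) ^ k * sin (\<nu> * of_real pi)"
proof -
  have 1: "sin (real j * pi - real k * pi) = 0" "cos (real j * pi - real k * pi) = (-1) ^ j * (-1) ^ k"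
    by (simp_all add: sin_diff cos_diff)
  have "(of_nat j - (\<nu> + of_nat k)) * complex_of_real pi = of_real (real j * pi - real k * pi) - \<nu> * of_real pi"
    by (simp add: algebra_simps)
  then show ?thesis
    by (simp only: sin_diff sin_of_real cos_of_real 1) simp
qed

text \<open>Expanding the exponential of w e^{iA}, the j-th term integrates to a multiple of sin((j
  - c) pi)/(j - c) with c = \<nu> + k. The sine contributes the sign (-1)^j, which turns w^j into
  the (-w)^j of \<open>phi\<close>.\<close>

lemma cis_integral:
  assumes "Im \<nu> \<noteq> 0" and w: "w > 0"
  shows "((\<lambda>A. exp (of_real w * cis A) * exp (- (\<i> * (\<nu> + of_nat k) * of_real A))) has_integral
     - 2 * (-1) ^ k * sin (\<nu> * of_real pi) * phi w (\<nu> + of_nat k)) {-pi..pi}"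
proof -
  let ?c = "\<nu> + of_nat k"
  define F where "F j A = of_real w ^ j / fact j * exp (\<i> * (of_nat j - ?c) * of_real A)" for j A
  define T where "T j = of_real w ^ j / fact j * (2 * sin ((of_nat j - ?c) * of_real pi) / (of_nat j - ?c))" for j
  have F: "(F j has_integral T j) {-pi..pi}" for j
    unfolding F_def T_def by (intro has_integral_mult_right integral_exp_ii) (use assms in \<open>auto simp: complex_eq_iff\<close>)
  have Fexp: "F j A = exp (- (\<i> * ?c * of_real A)) * ((of_real w * cis A) ^ j / fact j)" for j A
    unfolding F_def cis_conv_exp power_mult_distrib
    by (simp add: exp_of_nat_mult[symmetric] algebra_simps flip: exp_add)
  have h: "(\<lambda>A. exp (\<bar>Im \<nu>\<bar> * pi) * exp w) integrable_on {-pi..pi}"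
    by (rule integrable_const_ivl)
  have le: "norm (\<Sum>j<n. F j A) \<le> exp (\<bar>Im \<nu>\<bar> * pi) * exp w" if "A \<in> {-pi..pi}" for n A
  proof -
    have "Im \<nu> * A \<le> \<bar>Im \<nu>\<bar> * \<bar>A\<bar>" by (metis abs_ge_self abs_mult)
    also have "\<dots> \<le> \<bar>Im \<nu>\<bar> * pi" using that by (intro mult_left_mono) auto
    finally have "norm (exp (- (\<i> * ?c * complex_of_real A))) \<le> exp (\<bar>Im \<nu>\<bar> * pi)" by simp
    then have "norm (F j A) \<le> exp (\<bar>Im \<nu>\<bar> * pi) * (w ^ j / fact j)" for j
      unfolding Fexp norm_mult using w by (intro mult_mono) (auto simp: norm_divide norm_power norm_mult)
    then have "norm (\<Sum>j<n. F j A) \<le> (\<Sum>j<n. exp (\<bar>Im \<nu>\<bar> * pi) * (w ^ j / fact j))"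
      by (intro sum_norm_le)
    also have "\<dots> \<le> exp (\<bar>Im \<nu>\<bar> * pi) * exp w"
      unfolding sum_distrib_left[symmetric] using w by (intro mult_left_mono sum_power_over_fact_le_exp) auto
    finally show ?thesis .
  qed
  have sums: "(\<lambda>j. F j A) sums (exp (of_real w * cis A) * exp (- (\<i> * ?c * of_real A)))" for A
  proof -
    have "(\<lambda>j. (of_real w * cis A) ^ j / fact j) sums exp (of_real w * cis A)"
      using exp_converges[of "of_real w * cis A"] by (simp add: scaleR_conv_of_real divide_inverse mult.commute)
    from sums_mult[OF this, of "exp (- (\<i> * ?c * of_real A))"] show ?thesis
      unfolding Fexp by (simp only: mult.commute)
  qed
  have T: "T j = - 2 * (-1) ^ k * sin (\<nu> * of_real pi) * (of_real (- w) ^ j / fact j / (of_nat j - ?c))" for j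
  proof -
    have "complex_of_real (- w) ^ j = (-1) ^ j * of_real w ^ j" by (metis mult_minus1 of_real_minus power_mult_distrib)
    then show ?thesis unfolding T_def sin_nat_minus by simp
  qed
  have "T sums integral {-pi..pi} (\<lambda>A. exp (of_real w * cis A) * exp (- (\<i> * ?c * of_real A)))"
    by (rule dominated_sums(2)[OF F h le sums])
  moreover have "T sums (- 2 * (-1) ^ k * sin (\<nu> * of_real pi) * phi w ?c)"
    unfolding T by (intro sums_mult phi_sums) (use assms in simp)
  ultimately have "integral {-pi..pi} (\<lambda>A. exp (of_real w * cis A) * exp (- (\<i> * ?c * of_real A))) =
      - 2 * (-1) ^ k * sin (\<nu> * of_real pi) * phi w ?c"
    by (rule sums_unique2)
  with dominated_sums(1)[OF F h le sums] show ?thesis by (simp add: has_integral_iff)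
qed

text \<open>Here e^{2w cos A} is the product of the exponentials of w e^{iA} and w e^{-iA}. Only the
  second is expanded, so that the terms line up with those of \<open>Qint_sums\<close>.\<close>

lemma cos_integral_sums:
  assumes \<nu>: "Im \<nu> \<noteq> 0" and w: "w > 0"
  shows "(\<lambda>k. - 2 * sin (\<nu> * of_real pi) * (of_real (- w) ^ k / fact k * phi w (\<nu> + of_nat k))) sums
     integral {-pi..pi} (\<lambda>A. exp (of_real (2 * w * cos A)) * exp (- (\<i> * \<nu> * of_real A)))"
proof -
  define F where "F k A = of_real w ^ k / fact k * (exp (of_real w * cis A) * exp (- (\<i> * (\<nu> + of_nat k) * of_real A)))" for k A
  define T where "T k = of_real w ^ k / fact k * (- 2 * (-1) ^ k * sin (\<nu> * of_real pi) * phi w (\<nu> + of_nat k))" for k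
  have F: "(F k has_integral T k) {-pi..pi}" for k
    unfolding F_def T_def by (intro has_integral_mult_right cis_integral assms)
  have Fexp: "F k A = (exp (of_real w * cis A) * exp (- (\<i> * \<nu> * of_real A))) * ((of_real w * cis (- A)) ^ k / fact k)" for k A
    unfolding F_def cis_conv_exp power_mult_distrib
    by (simp add: exp_of_nat_mult[symmetric] algebra_simps flip: exp_add)
  have h: "(\<lambda>A. exp w * exp (\<bar>Im \<nu>\<bar> * pi) * exp w) integrable_on {-pi..pi}"
    by (rule integrable_const_ivl)
  have le: "norm (\<Sum>k<n. F k A) \<le> exp w * exp (\<bar>Im \<nu>\<bar> * pi) * exp w" if "A \<in> {-pi..pi}" for n A
  proof -
    have "Im \<nu> * A \<le> \<bar>Im \<nu>\<bar> * \<bar>A\<bar>" by (metis abs_ge_self abs_mult)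
    also have "\<dots> \<le> \<bar>Im \<nu>\<bar> * pi" using that by (intro mult_left_mono) auto
    finally have 1: "norm (exp (- (\<i> * \<nu> * complex_of_real A))) \<le> exp (\<bar>Im \<nu>\<bar> * pi)" by simp
    have "w * cos A \<le> w * 1" using w by (intro mult_left_mono) auto
    then have 2: "norm (exp (of_real w * cis A)) \<le> exp w" by simp
    have "norm (F k A) \<le> exp w * exp (\<bar>Im \<nu>\<bar> * pi) * (w ^ k / fact k)" for k
      unfolding Fexp norm_mult using w 1 2 by (intro mult_mono) (auto simp: norm_divide norm_power norm_mult)
    then have "norm (\<Sum>k<n. F k A) \<le> (\<Sum>k<n. exp w * exp (\<bar>Im \<nu>\<bar> * pi) * (w ^ k / fact k))"
      by (intro sum_norm_le)
    also have "\<dots> \<le> exp w * exp (\<bar>Im \<nu>\<bar> * pi) * exp w"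
      unfolding sum_distrib_left[symmetric] using w by (intro mult_left_mono sum_power_over_fact_le_exp) auto
    finally show ?thesis .
  qed
  have sums: "(\<lambda>k. F k A) sums (exp (of_real (2 * w * cos A)) * exp (- (\<i> * \<nu> * of_real A)))" for A
  proof -
    have "(\<lambda>k. (of_real w * cis (- A)) ^ k / fact k) sums exp (of_real w * cis (- A))"
      using exp_converges[of "of_real w * cis (- A)"] by (simp add: scaleR_conv_of_real divide_inverse mult.commute)
    from sums_mult[OF this, of "exp (of_real w * cis A) * exp (- (\<i> * \<nu> * of_real A))"]
    have "(\<lambda>k. F k A) sums (exp (of_real w * cis A) * exp (- (\<i> * \<nu> * of_real A)) * exp (of_real w * cis (- A)))"
      unfolding Fexp .
    also have "exp (of_real w * cis A) * exp (- (\<i> * \<nu> * of_real A)) * exp (of_real w * cis (- A)) =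
      (exp (of_real w * cis A + of_real w * cis (- A))) * exp (- (\<i> * \<nu> * of_real A))"
      by (simp only: exp_add mult_ac)
    also have "of_real w * cis A + of_real w * cis (- A) = of_real (2 * w * cos A)"
      by (simp add: complex_eq_iff)
    finally show ?thesis .
  qed
  have "T k = - 2 * sin (\<nu> * of_real pi) * (of_real (- w) ^ k / fact k * phi w (\<nu> + of_nat k))" for k
  proof -
    have "complex_of_real (- w) ^ k = (-1) ^ k * of_real w ^ k" by (metis mult_minus1 of_real_minus power_mult_distrib)
    then show ?thesis unfolding T_def by simp
  qed
  then show ?thesis using dominated_sums(2)[OF F h le sums] by simp
qed

text \<open>In the k-th terms of the two expansions the \<open>phi\<close> contributions cancel.
  What remains is \<Gamma>(-\<nu> - k) times a sine, which the reflection formula turns into the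
  coefficient of I_\<nu>. No contour has to be deformed.\<close>

lemma schlaefli:
  assumes \<nu>: "Re \<nu> = 0" "Im \<nu> \<noteq> 0" and w: "w > 0"
  shows "of_real w powr \<nu> * Iser \<nu> w =
     1 / (2 * of_real pi) * integral {-pi..pi} (\<lambda>A. exp (of_real (2 * w * cos A)) * exp (- (\<i> * \<nu> * of_real A)))
     - sin (\<nu> * of_real pi) / of_real pi * integral {0..} (Qint \<nu> w)"
proof -
  let ?P = "integral {-pi..pi} (\<lambda>A. exp (of_real (2 * w * cos A)) * exp (- (\<i> * \<nu> * of_real A)))"
  let ?Q = "integral {0..} (Qint \<nu> w)"
  let ?s = "sin (\<nu> * of_real pi)"
  have "(\<lambda>k. 1 / (2 * of_real pi) * (- 2 * ?s * (of_real (- w) ^ k / fact k * phi w (\<nu> + of_nat k)))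
        - ?s / of_real pi * (of_real (- w) ^ k / fact k * integral {0..} (gint w (\<nu> + of_nat k))))
      sums (1 / (2 * of_real pi) * ?P - ?s / of_real pi * ?Q)"
    by (intro sums_diff sums_mult cos_integral_sums Qint_sums assms)
  moreover have "1 / (2 * of_real pi) * (- 2 * ?s * (of_real (- w) ^ k / fact k * phi w (\<nu> + of_nat k)))
        - ?s / of_real pi * (of_real (- w) ^ k / fact k * integral {0..} (gint w (\<nu> + of_nat k))) =
      of_real w powr \<nu> * (rGamma (\<nu> + of_nat k + 1) / fact k * of_real w ^ (2 * k))" for k
  proof -
    have s0: "sin (- (\<nu> + of_nat k) * of_real pi) = - ((-1) ^ k) * ?s"
      using sin_nat_minus[of 0 \<nu> k] by simp
    have "sin (of_real pi * - (\<nu> + of_nat k)) \<noteq> 0"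
      by (subst sin_eq_0) (use \<nu> in \<open>auto simp: complex_eq_iff\<close>)
    then have s1: "?s \<noteq> 0" using s0 by (auto simp: mult.commute)
    define e where "e = (-1 :: complex) ^ k"
    have e: "e * e = 1" by (simp add: e_def flip: power_mult_distrib)
    have "Gamma (- (\<nu> + of_nat k)) * Gamma (1 - - (\<nu> + of_nat k)) = of_real pi / (- e * ?s)"
      using Gamma_reflection_complex[of "- (\<nu> + of_nat k)"] s0 unfolding e_def by (simp only: mult.commute)
    moreover have "rGamma (1 - - (\<nu> + of_nat k)) * Gamma (1 - - (\<nu> + of_nat k)) = 1"
      by (rule Gamma_times_rGamma) (use \<nu> in simp)
    ultimately have "Gamma (- (\<nu> + of_nat k)) = of_real pi / (- e * ?s) * rGamma (1 - - (\<nu> + of_nat k))"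
      by (metis mult.assoc mult.commute mult.left_neutral)
    moreover have "1 - - (\<nu> + of_nat k) = \<nu> + of_nat k + 1" "- (\<nu> + of_nat k) = - \<nu> - of_nat k" by simp_all
    ultimately have G0: "Gamma (- \<nu> - of_nat k) = of_real pi / (- e * ?s) * rGamma (\<nu> + of_nat k + 1)"
      by (simp only:)
    have alg1: "- s / p * (p / (- e * s) * R) = e * R" if "s \<noteq> 0" "p \<noteq> 0" for s p R :: complex
    proof -
      have "- s / p * (p / (- e * s) * R) = R / e" using that by (simp add: divide_simps)
      also have "\<dots> = e * R" using e by (metis divide_eq_eq mult.assoc mult.commute mult.right_neutral mult_eq_0_iff zero_neq_one)
      finally show ?thesis .
    qed
    have G: "- ?s / of_real pi * Gamma (- \<nu> - of_nat k) = e * rGamma (\<nu> + of_nat k + 1)"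
      unfolding G0 by (rule alg1) (use s1 in simp_all)
    have pw: "complex_of_real w powr (\<nu> + of_nat k) = of_real w powr \<nu> * of_real w ^ k"
      using w by (simp add: powr_add powr_nat')
    have neg: "complex_of_real (- w) ^ k = e * of_real w ^ k"
      unfolding e_def by (metis mult_minus1 of_real_minus power_mult_distrib)
    have alg2: "1 / (2 * p) * (- 2 * s * (X * \<phi>)) - s / p * (X * (W * g - \<phi>)) = X * W * (- s / p * g)"
      if "p \<noteq> 0" for s p X W g \<phi> :: complex
      using that by (simp add: field_simps)
    have "1 / (2 * of_real pi) * (- 2 * ?s * (of_real (- w) ^ k / fact k * phi w (\<nu> + of_nat k)))
        - ?s / of_real pi * (of_real (- w) ^ k / fact k * integral {0..} (gint w (\<nu> + of_nat k))) =
       (of_real (- w) ^ k / fact k) * (of_real w powr (\<nu> + of_nat k)) * (- ?s / of_real pi * Gamma (- \<nu> - of_nat k))"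
      unfolding gint_integral[OF \<nu> w] by (rule alg2) simp
    also have "\<dots> = (e * e) * (of_real w powr \<nu> * (rGamma (\<nu> + of_nat k + 1) / fact k * (of_real w ^ k * of_real w ^ k)))"
      unfolding G pw neg by simp
    also have "\<dots> = of_real w powr \<nu> * (rGamma (\<nu> + of_nat k + 1) / fact k * of_real w ^ (2 * k))"
      by (simp add: e mult_2 power_add)
    finally show ?thesis .
  qed
  moreover have "(\<lambda>k. of_real w powr \<nu> * (rGamma (\<nu> + of_nat k + 1) / fact k * of_real w ^ (2 * k))) sums (of_real w powr \<nu> * Iser \<nu> w)"
    by (intro sums_mult Iser_sums) (use \<nu> in simp)
  ultimately show ?thesis by (simp only: sums_unique2)
qed

subsection \<open>Gaussian moments of $J_\nu^2 + Y_\nu^2$\<close>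

lemma exp_power_sums: "(\<lambda>k. z ^ k / fact k) sums exp (z :: complex)"
  using exp_converges[of z] by (simp add: scaleR_conv_of_real divide_inverse mult.commute)

text \<open>Two integrations by parts relate the exponents 2m and 2m + 2 by the recurrence that the
  right-hand side also satisfies; the case m = 0 is the reflection formula.\<close>

lemma cos_power_integral:
  assumes \<nu>: "Re \<nu> = 0" "Im \<nu> \<noteq> 0"
  shows "((\<lambda>B. of_real (cos (B / 2) ^ (2 * m)) * exp (- (\<i> * \<nu> * of_real B))) has_integral
      2 * of_real pi / 4 ^ m * fact (2 * m) * rGamma (\<nu> + of_nat m + 1) * rGamma (- \<nu> + of_nat m + 1)) {-pi..pi}"
proof -
  define T where "T m = integral {-pi..pi} (\<lambda>B. complex_of_real (cos (B / 2) ^ (2 * m)) * exp (- (\<i> * \<nu> * of_real B)))" for m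
  have I: "((\<lambda>B. complex_of_real (cos (B / 2) ^ (2 * m)) * exp (- (\<i> * \<nu> * of_real B))) has_integral T m) {-pi..pi}" for m
    unfolding T_def by (intro integrable_integral integrable_continuous_interval continuous_intros) auto
  have step: "(of_nat (Suc m) ^ 2 - \<nu>\<^sup>2) * T (Suc m) = of_nat (Suc m) * of_nat (2 * m + 1) / 2 * T m" for m
  proof -
    define y where "y B = cos (B / 2) ^ (2 * Suc m)" for B :: real
    define y1 where "y1 B = - real (Suc m) * (cos (B / 2) ^ (2 * m + 1) * sin (B / 2))" for B :: real
    define y2 where "y2 B = real (Suc m) * (real (2 * m + 1) / 2 * cos (B / 2) ^ (2 * m) - real (Suc m) * cos (B / 2) ^ (2 * Suc m))" for B :: real
    have y': "(y has_real_derivative y1 B) (at B within A)" for B A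
    proof -
      have "((\<lambda>B. cos (B / 2)) has_real_derivative - sin (B / 2) / 2) (at B within A)"
        by (auto intro!: derivative_eq_intros)
      then have "(y has_real_derivative real (2 * Suc m) * (- sin (B / 2) / 2 * cos (B / 2) ^ (2 * Suc m - Suc 0))) (at B within A)"
        unfolding y_def by (rule DERIV_power)
      moreover have "2 * Suc m - Suc 0 = 2 * m + 1" by simp
      moreover have "real (2 * Suc m) * (- sin (B / 2) / 2 * cos (B / 2) ^ (2 * m + 1)) = y1 B"
        unfolding y1_def by (simp add: field_simps)
      ultimately show ?thesis by (simp only:)
    qed
    have "(y1 has_real_derivative - real (Suc m) * (real (2 * m + 1) * cos (B / 2) ^ (2 * m) * (- sin (B / 2) / 2) * sin (B / 2)
           + cos (B / 2) ^ (2 * m + 1) * (cos (B / 2) / 2))) (at B within A)" for B A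
      unfolding y1_def by ((rule derivative_eq_intros refl | simp)+, simp add: mult_ac)
    moreover have "- real (Suc m) * (real (2 * m + 1) * cos (B / 2) ^ (2 * m) * (- sin (B / 2) / 2) * sin (B / 2)
           + cos (B / 2) ^ (2 * m + 1) * (cos (B / 2) / 2)) = y2 B" for B
    proof -
      have sq: "sin (B / 2) * sin (B / 2) = 1 - (cos (B / 2))\<^sup>2" using sin_cos_squared_add[of "B / 2"] by (simp add: power2_eq_square)
      have alg: "r * c * (- s / 2) * s = - r / 2 * c * (s * s)" for r c s :: real by simp
      have "real (2 * m + 1) * cos (B / 2) ^ (2 * m) * (- sin (B / 2) / 2) * sin (B / 2) =
         - real (2 * m + 1) / 2 * cos (B / 2) ^ (2 * m) * (1 - (cos (B / 2))\<^sup>2)" unfolding sq[symmetric] by (rule alg)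
      moreover have "cos (B / 2) ^ (2 * m + 1) * (cos (B / 2) / 2) = cos (B / 2) ^ (2 * m) * (cos (B / 2))\<^sup>2 / 2"
        by (simp add: power2_eq_square)
      moreover have "cos (B / 2) ^ (2 * Suc m) = cos (B / 2) ^ (2 * m) * (cos (B / 2))\<^sup>2"
        by (simp add: power2_eq_square)
      ultimately show ?thesis unfolding y2_def by (simp only:) (simp add: field_simps)
    qed
    ultimately have y1': "(y1 has_real_derivative y2 B) (at B within A)" for B A by simp
    define E where "E B = exp (- (\<i> * \<nu> * complex_of_real B))" for B
    have E': "(E has_vector_derivative - (\<i> * \<nu>) * E B) (at B within A)" for B A
      unfolding E_def by (rule has_vector_derivative_real_field derivative_eq_intros refl | simp)+
    \<comment> \<open>Chosen so that F' = (y'' + \<nu>^2 y) E. It vanishes at both endpoints because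
      cos(pi/2) = 0 is a factor of both \<open>y\<close> and \<open>y1\<close>.\<close>
    define F where "F B = (of_real (y1 B) + \<i> * \<nu> * of_real (y B)) * E B" for B
    have "(F has_vector_derivative (of_real (y1 B) + \<i> * \<nu> * of_real (y B)) * (- (\<i> * \<nu>) * E B)
        + (of_real (y2 B) + \<i> * \<nu> * of_real (y1 B)) * E B) (at B within A)" for B A
      unfolding F_def
      by (intro has_vector_derivative_mult E' has_vector_derivative_add has_vector_derivative_mult_right
            has_vector_derivative_of_real y' y1')
    moreover have "(of_real (y1 B) + \<i> * \<nu> * of_real (y B)) * (- (\<i> * \<nu>) * E B)
        + (of_real (y2 B) + \<i> * \<nu> * of_real (y1 B)) * E B =
       of_nat (Suc m) * of_nat (2 * m + 1) / 2 * (complex_of_real (cos (B / 2) ^ (2 * m)) * exp (- (\<i> * \<nu> * of_real B)))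
        - (of_nat (Suc m) ^ 2 - \<nu>\<^sup>2) * (complex_of_real (cos (B / 2) ^ (2 * Suc m)) * exp (- (\<i> * \<nu> * of_real B)))" for B
    proof -
      have 1: "(of_real (y1 B) + \<i> * \<nu> * of_real (y B)) * (- (\<i> * \<nu>) * E B)
        + (of_real (y2 B) + \<i> * \<nu> * of_real (y1 B)) * E B = (of_real (y2 B) + \<nu>\<^sup>2 * of_real (y B)) * E B"
        by (simp add: algebra_simps power2_eq_square)
      have 2: "complex_of_real (y2 B) = of_nat (Suc m) * of_nat (2 * m + 1) / 2 * of_real (cos (B / 2) ^ (2 * m)) -
          of_nat (Suc m) ^ 2 * of_real (y B)"
      proof -
        have "y2 B = real (Suc m) * real (2 * m + 1) / 2 * cos (B / 2) ^ (2 * m) - real (Suc m) ^ 2 * y B"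
          unfolding y2_def y_def by (simp add: algebra_simps power2_eq_square del: of_nat_Suc)
        then show ?thesis by (simp del: of_nat_Suc of_nat_add)
      qed
      have alg: "(a * c - n * z + v * z) * e = a * (c * e) - (n - v) * (z * e)" for a c n v z e :: complex
        by (simp add: algebra_simps)
      show ?thesis unfolding 1 unfolding 2 unfolding E_def y_def by (rule alg)
    qed
    ultimately have "(F has_vector_derivative of_nat (Suc m) * of_nat (2 * m + 1) / 2 * (complex_of_real (cos (B / 2) ^ (2 * m)) * exp (- (\<i> * \<nu> * of_real B)))
        - (of_nat (Suc m) ^ 2 - \<nu>\<^sup>2) * (complex_of_real (cos (B / 2) ^ (2 * Suc m)) * exp (- (\<i> * \<nu> * of_real B)))) (at B within A)" for B A
      by simp
    then have "((\<lambda>B. of_nat (Suc m) * of_nat (2 * m + 1) / 2 * (complex_of_real (cos (B / 2) ^ (2 * m)) * exp (- (\<i> * \<nu> * of_real B)))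
        - (of_nat (Suc m) ^ 2 - \<nu>\<^sup>2) * (complex_of_real (cos (B / 2) ^ (2 * Suc m)) * exp (- (\<i> * \<nu> * of_real B)))) has_integral (F pi - F (- pi))) {-pi..pi}"
      by (intro fundamental_theorem_of_calculus) auto
    moreover have "((\<lambda>B. of_nat (Suc m) * of_nat (2 * m + 1) / 2 * (complex_of_real (cos (B / 2) ^ (2 * m)) * exp (- (\<i> * \<nu> * of_real B)))
        - (of_nat (Suc m) ^ 2 - \<nu>\<^sup>2) * (complex_of_real (cos (B / 2) ^ (2 * Suc m)) * exp (- (\<i> * \<nu> * of_real B)))) has_integral
          (of_nat (Suc m) * of_nat (2 * m + 1) / 2 * T m - (of_nat (Suc m) ^ 2 - \<nu>\<^sup>2) * T (Suc m))) {-pi..pi}"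
      by (intro has_integral_diff has_integral_mult_right I)
    moreover have "F pi = 0" and "F (- pi) = 0" by (simp_all add: F_def y_def y1_def)
    ultimately have "of_nat (Suc m) * of_nat (2 * m + 1) / 2 * T m - (of_nat (Suc m) ^ 2 - \<nu>\<^sup>2) * T (Suc m) = 0"
      by (metis (no_types, lifting) diff_self has_integral_unique)
    then show ?thesis by (metis right_minus_eq)
  qed
  have "T m = 2 * of_real pi / 4 ^ m * fact (2 * m) * rGamma (\<nu> + of_nat m + 1) * rGamma (- \<nu> + of_nat m + 1)"
  proof (induction m)
    case 0
    have \<nu>0: "\<nu> \<noteq> 0" using \<nu> by auto
    have "((\<lambda>B. complex_of_real (cos (B / 2) ^ (2 * 0)) * exp (- (\<i> * \<nu> * of_real B))) has_integral 2 * sin (- \<nu> * of_real pi) / - \<nu>) {-pi..pi}"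
      using integral_exp_ii[of "- \<nu>"] \<nu>0 by simp
    then have T0: "T 0 = 2 * sin (- \<nu> * of_real pi) / - \<nu>" using I[of 0] has_integral_unique by blast
    have "\<nu> * rGamma (\<nu> + 1) * rGamma (1 - \<nu>) = sin (of_real pi * \<nu>) / of_real pi"
      using rGamma_plus1[of \<nu>] rGamma_reflection_complex[of \<nu>] by simp
    then have R: "rGamma (\<nu> + 1) * rGamma (1 - \<nu>) = sin (of_real pi * \<nu>) / of_real pi / \<nu>"
      using \<nu>0 by (simp add: field_simps)
    have "2 * of_real pi / 4 ^ 0 * fact (2 * 0) * rGamma (\<nu> + of_nat 0 + 1) * rGamma (- \<nu> + of_nat 0 + 1) =
        2 * of_real pi * (rGamma (\<nu> + 1) * rGamma (1 - \<nu>))" by simp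
    also have "\<dots> = T 0" unfolding R T0 by (simp add: mult.commute)
    finally show ?case by (rule sym)
  next
    case (Suc m)
    have ne: "of_nat (Suc m) ^ 2 - \<nu>\<^sup>2 \<noteq> 0"
    proof -
      have "Re (of_nat (Suc m) ^ 2 - \<nu>\<^sup>2) = (real (Suc m))\<^sup>2 + (Im \<nu>)\<^sup>2"
        using \<nu> by (simp add: power2_eq_square)
      also have "\<dots> > 0" using \<nu> by (intro add_nonneg_pos) auto
      finally show ?thesis by (metis less_numeral_extra(3) zero_complex.sel(1))
    qed
    have "rGamma (\<nu> + of_nat m + 1) = (\<nu> + of_nat (Suc m)) * rGamma (\<nu> + of_nat (Suc m) + 1)"
      using rGamma_plus1[of "\<nu> + of_nat (Suc m)"] by (simp add: algebra_simps)
    moreover have "rGamma (- \<nu> + of_nat m + 1) = (- \<nu> + of_nat (Suc m)) * rGamma (- \<nu> + of_nat (Suc m) + 1)"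
      using rGamma_plus1[of "- \<nu> + of_nat (Suc m)"] by (simp add: algebra_simps)
    ultimately have R: "rGamma (\<nu> + of_nat m + 1) * rGamma (- \<nu> + of_nat m + 1) =
        (of_nat (Suc m) ^ 2 - \<nu>\<^sup>2) * (rGamma (\<nu> + of_nat (Suc m) + 1) * rGamma (- \<nu> + of_nat (Suc m) + 1))"
      by (simp only:) (simp add: algebra_simps power2_eq_square del: of_nat_Suc)
    have fact: "(fact (2 * Suc m) :: complex) = 2 * of_nat (Suc m) * of_nat (2 * m + 1) * fact (2 * m)"
      by (simp add: algebra_simps)
    have "(of_nat (Suc m) ^ 2 - \<nu>\<^sup>2) * T (Suc m) = of_nat (Suc m) * of_nat (2 * m + 1) / 2 *
         (2 * of_real pi / 4 ^ m * fact (2 * m) * (rGamma (\<nu> + of_nat m + 1) * rGamma (- \<nu> + of_nat m + 1)))"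
      unfolding step Suc by (simp only: mult.assoc)
    also have "\<dots> = (of_nat (Suc m) ^ 2 - \<nu>\<^sup>2) * (2 * of_real pi / 4 ^ Suc m * fact (2 * Suc m)
        * rGamma (\<nu> + of_nat (Suc m) + 1) * rGamma (- \<nu> + of_nat (Suc m) + 1))"
      unfolding R fact by (simp del: of_nat_Suc of_nat_add)
    finally show ?case using ne by (simp only: mult_cancel_left simp_thms if_False)
  qed
  with I[of m] show ?thesis by simp
qed

text \<open>Since (1 + cos B)/2 = cos^2(B/2), expanding the exponential produces the integrals of
  \<open>cos_power_integral\<close>, which are the coefficients of
  \<open>weber_mixed\<close>.\<close>

lemma weber_mixed_integral:
  assumes \<nu>: "Re \<nu> = 0" "Im \<nu> \<noteq> 0" and \<beta>: "\<beta> > 0"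
  shows "integral {0<..} (\<lambda>x. of_real (x / \<beta> * exp (- x\<^sup>2 / \<beta>)) * (besselJ \<nu> x * besselJ (- \<nu>) x)) =
    1 / (4 * of_real pi) * integral {-pi..pi} (\<lambda>B. of_real (exp (- \<beta> * ((1 + cos B) / 2))) * exp (- (\<i> * \<nu> * of_real B)))"
proof -
  define T where "T m = 2 * of_real pi / 4 ^ m * fact (2 * m) * rGamma (\<nu> + of_nat m + 1) * rGamma (- \<nu> + of_nat m + 1)" for m
  define F where "F m B = of_real (- \<beta>) ^ m / fact m * (of_real (cos (B / 2) ^ (2 * m)) * exp (- (\<i> * \<nu> * of_real B)))" for m B
  have F: "(F m has_integral of_real (- \<beta>) ^ m / fact m * T m) {-pi..pi}" for m
    unfolding F_def T_def by (intro has_integral_mult_right cos_power_integral \<nu>)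
  have h: "(\<lambda>B. exp (\<bar>Im \<nu>\<bar> * pi) * exp \<beta>) integrable_on {-pi..pi}"
    by (rule integrable_const_ivl)
  have le: "norm (\<Sum>m<n. F m B) \<le> exp (\<bar>Im \<nu>\<bar> * pi) * exp \<beta>" if "B \<in> {-pi..pi}" for n B
  proof -
    have "Im \<nu> * B \<le> \<bar>Im \<nu>\<bar> * \<bar>B\<bar>" by (metis abs_ge_self abs_mult)
    also have "\<dots> \<le> \<bar>Im \<nu>\<bar> * pi" using that by (intro mult_left_mono) auto
    finally have 1: "norm (exp (- (\<i> * \<nu> * complex_of_real B))) \<le> exp (\<bar>Im \<nu>\<bar> * pi)" by simp
    have "norm (F m B) \<le> exp (\<bar>Im \<nu>\<bar> * pi) * (\<beta> ^ m / fact m)" for m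
    proof -
      have "\<bar>cos (B / 2)\<bar> ^ (2 * m) \<le> 1" by (rule power_le_one) auto
      then have "\<beta> ^ m / fact m * (\<bar>cos (B / 2)\<bar> ^ (2 * m) * norm (exp (- (\<i> * \<nu> * complex_of_real B)))) \<le>
         \<beta> ^ m / fact m * (1 * exp (\<bar>Im \<nu>\<bar> * pi))"
        using 1 \<beta> by (intro mult_left_mono mult_mono) auto
      moreover have "norm (F m B) = \<beta> ^ m / fact m * (\<bar>cos (B / 2)\<bar> ^ (2 * m) * norm (exp (- (\<i> * \<nu> * complex_of_real B))))"
        unfolding F_def norm_mult norm_divide norm_power norm_of_real using \<beta> by (simp add: power_abs)
      ultimately show ?thesis by (simp add: mult.commute)
    qed
    then have "norm (\<Sum>m<n. F m B) \<le> (\<Sum>m<n. exp (\<bar>Im \<nu>\<bar> * pi) * (\<beta> ^ m / fact m))"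
      by (intro sum_norm_le)
    also have "\<dots> \<le> exp (\<bar>Im \<nu>\<bar> * pi) * exp \<beta>"
      unfolding sum_distrib_left[symmetric] using \<beta> by (intro mult_left_mono sum_power_over_fact_le_exp) auto
    finally show ?thesis .
  qed
  have sums: "(\<lambda>m. F m B) sums (of_real (exp (- \<beta> * ((1 + cos B) / 2))) * exp (- (\<i> * \<nu> * of_real B)))" for B
  proof -
    have c: "(1 + cos B) / 2 = (cos (B / 2))\<^sup>2" using cos_double_cos[of "B / 2"] by simp
    have "(\<lambda>m. (complex_of_real (- \<beta> * (cos (B / 2))\<^sup>2)) ^ m / fact m) sums exp (of_real (- \<beta> * (cos (B / 2))\<^sup>2))"
      by (rule exp_power_sums)
    then have "(\<lambda>m. (complex_of_real (- \<beta> * (cos (B / 2))\<^sup>2)) ^ m / fact m * exp (- (\<i> * \<nu> * of_real B))) sums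
        (exp (of_real (- \<beta> * (cos (B / 2))\<^sup>2)) * exp (- (\<i> * \<nu> * of_real B)))"
      by (rule sums_mult2)
    moreover have "(complex_of_real (- \<beta> * (cos (B / 2))\<^sup>2)) ^ m / fact m * exp (- (\<i> * \<nu> * of_real B)) = F m B" for m
      unfolding F_def of_real_mult[of "- \<beta>"] power_mult_distrib by (simp add: power_mult)
    ultimately show ?thesis unfolding c exp_of_real by simp
  qed
  have "(\<lambda>m. 1 / (4 * of_real pi) * (of_real (- \<beta>) ^ m / fact m * T m)) sums
     (1 / (4 * of_real pi) * integral {-pi..pi} (\<lambda>B. of_real (exp (- \<beta> * ((1 + cos B) / 2))) * exp (- (\<i> * \<nu> * of_real B))))"
    by (intro sums_mult dominated_sums(2)[OF F h le sums])
  moreover have "1 / (4 * of_real pi) * (of_real (- \<beta>) ^ m / fact m * T m) =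
     1 / 2 * ((-1) ^ m * rGamma (\<nu> + of_nat m + 1) * rGamma (- \<nu> + of_nat m + 1)
            * (fact (2 * m) / fact m) * of_real (\<beta> / 4) ^ m)" for m
  proof -
    have neg: "complex_of_real (- \<beta>) ^ m = (-1) ^ m * of_real \<beta> ^ m" by (metis mult_minus1 of_real_minus power_mult_distrib)
    have "1 / (4 * p) * ((e * b) / f * (2 * p / q * g * R * S)) = 1 / 2 * (e * R * S * (g / f) * (b / q))"
      if "p \<noteq> 0" for p e b f q g R S :: complex using that by simp
    then show ?thesis unfolding neg T_def by (simp add: power_divide)
  qed
  ultimately show ?thesis using weber_mixed[OF \<nu>(1) \<beta>] by (simp only: sums_unique2)
qed

text \<open>The factor e^{-\<beta>/2} merges with Schlaefli's exponentials: -\<beta>/2 + (\<beta>/2)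
  cos A = -\<beta> (1 - cos A)/2 and -\<beta>/2 - (\<beta>/2) cosh 2u = -\<beta> cosh^2 u. This puts
  all exponents into the form -\<beta> q, with q at most 1 in the first integral and at least 1 in
  the second.\<close>

lemma weber_square_integral:
  assumes \<nu>: "Re \<nu> = 0" "Im \<nu> \<noteq> 0" and \<beta>: "\<beta> > 0"
  shows "integral {0<..} (\<lambda>x. of_real (x / \<beta> * exp (- x\<^sup>2 / \<beta>)) * (besselJ \<nu> x * besselJ \<nu> x)) =
    1 / (4 * of_real pi) * integral {-pi..pi} (\<lambda>A. of_real (exp (- \<beta> * ((1 - cos A) / 2))) * exp (- (\<i> * \<nu> * of_real A)))
    - sin (\<nu> * of_real pi) / of_real pi * integral {0..} (\<lambda>u. of_real (exp (- \<beta> * (cosh u)\<^sup>2)) * exp (- (2 * \<nu> * of_real u)))"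
    and "(\<lambda>u. of_real (exp (- \<beta> * (cosh u)\<^sup>2)) * exp (- (2 * \<nu> * of_real u))) integrable_on {0..}"
proof -
  have w: "\<beta> / 4 > 0" using \<beta> by simp
  let ?P = "integral {-pi..pi} (\<lambda>A. exp (of_real (2 * (\<beta> / 4) * cos A)) * exp (- (\<i> * \<nu> * of_real A)))"
  let ?s = "sin (\<nu> * of_real pi)"
  have e: "exp (- complex_of_real (\<beta> / 2)) = of_real (exp (- (\<beta> / 2)))" by (metis exp_of_real of_real_minus)
  have Q: "of_real (exp (- (\<beta> / 2))) * Qint \<nu> (\<beta> / 4) u = 2 * (of_real (exp (- \<beta> * (cosh u)\<^sup>2)) * exp (- (2 * \<nu> * of_real u)))" for u
  proof -
    have "- (\<beta> / 2) + - 2 * (\<beta> / 4) * cosh (2 * u) = - \<beta> * (cosh u)\<^sup>2"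
      unfolding cosh_double_cosh by (simp add: algebra_simps)
    then have "exp (- (\<beta> / 2)) * exp (- 2 * (\<beta> / 4) * cosh (2 * u)) = exp (- \<beta> * (cosh u)\<^sup>2)"
      by (simp only: exp_add[symmetric])
    then have "exp (- (\<beta> / 2)) * (2 * exp (- 2 * (\<beta> / 4) * cosh (2 * u))) = 2 * exp (- \<beta> * (cosh u)\<^sup>2)"
      by (simp only: mult.left_commute)
    then have "of_real (exp (- (\<beta> / 2))) * of_real (2 * exp (- 2 * (\<beta> / 4) * cosh (2 * u))) = (2 * of_real (exp (- \<beta> * (cosh u)\<^sup>2)) :: complex)"
      by (metis of_real_mult of_real_numeral)
    then show ?thesis unfolding Qint_def by (simp only: mult.assoc[symmetric])
  qed
  have Q': "of_real (exp (- (\<beta> / 2))) * integral {0..} (Qint \<nu> (\<beta> / 4)) =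
     2 * integral {0..} (\<lambda>u. of_real (exp (- \<beta> * (cosh u)\<^sup>2)) * exp (- (2 * \<nu> * of_real u)))"
    unfolding integral_mult_right[symmetric] Q ..
  have P: "of_real (exp (- (\<beta> / 2))) * ?P = integral {-pi..pi} (\<lambda>A. of_real (exp (- \<beta> * ((1 - cos A) / 2))) * exp (- (\<i> * \<nu> * of_real A)))"
    unfolding integral_mult_right[symmetric]
  proof (rule integral_cong)
    fix A :: real
    have "- (\<beta> / 2) + 2 * (\<beta> / 4) * cos A = - \<beta> * ((1 - cos A) / 2)"
      by (simp add: field_simps)
    then have "exp (- (\<beta> / 2)) * exp (2 * (\<beta> / 4) * cos A) = exp (- \<beta> * ((1 - cos A) / 2))"
      by (simp only: exp_add[symmetric])
    then have "complex_of_real (exp (- (\<beta> / 2))) * of_real (exp (2 * (\<beta> / 4) * cos A)) = of_real (exp (- \<beta> * ((1 - cos A) / 2)))"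
      by (metis of_real_mult)
    then show "of_real (exp (- (\<beta> / 2))) * (exp (of_real (2 * (\<beta> / 4) * cos A)) * exp (- (\<i> * \<nu> * of_real A))) =
       of_real (exp (- \<beta> * ((1 - cos A) / 2))) * exp (- (\<i> * \<nu> * of_real A))"
      unfolding exp_of_real by (simp only: mult.assoc[symmetric])
  qed
  have "integral {0<..} (\<lambda>x. of_real (x / \<beta> * exp (- x\<^sup>2 / \<beta>)) * (besselJ \<nu> x * besselJ \<nu> x)) =
     1 / 2 * ((of_real (\<beta> / 4) powr \<nu> * Iser \<nu> (\<beta> / 4)) * of_real (exp (- (\<beta> / 2))))"
    unfolding weber_square[OF \<nu>(1) \<beta>] e by (simp only: mult.assoc)
  also have "\<dots> = 1 / 2 * (1 / (2 * of_real pi) * (of_real (exp (- (\<beta> / 2))) * ?P)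
      - ?s / of_real pi * (of_real (exp (- (\<beta> / 2))) * integral {0..} (Qint \<nu> (\<beta> / 4))))"
    unfolding schlaefli[OF \<nu> w] left_diff_distrib by (simp only: mult_ac)
  also have "\<dots> = 1 / (4 * of_real pi) * integral {-pi..pi} (\<lambda>A. of_real (exp (- \<beta> * ((1 - cos A) / 2))) * exp (- (\<i> * \<nu> * of_real A)))
    - ?s / of_real pi * integral {0..} (\<lambda>u. of_real (exp (- \<beta> * (cosh u)\<^sup>2)) * exp (- (2 * \<nu> * of_real u)))"
    unfolding P Q' by (simp add: right_diff_distrib)
  finally show "integral {0<..} (\<lambda>x. of_real (x / \<beta> * exp (- x\<^sup>2 / \<beta>)) * (besselJ \<nu> x * besselJ \<nu> x)) =
    1 / (4 * of_real pi) * integral {-pi..pi} (\<lambda>A. of_real (exp (- \<beta> * ((1 - cos A) / 2))) * exp (- (\<i> * \<nu> * of_real A)))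
    - ?s / of_real pi * integral {0..} (\<lambda>u. of_real (exp (- \<beta> * (cosh u)\<^sup>2)) * exp (- (2 * \<nu> * of_real u)))" .
  have "(\<lambda>u. of_real (exp (- (\<beta> / 2))) * Qint \<nu> (\<beta> / 4) u) integrable_on {0..}"
    by (intro integrable_on_mult_right Qint_sums \<nu> w)
  then have "(\<lambda>u. 1 / 2 * (2 * (of_real (exp (- \<beta> * (cosh u)\<^sup>2)) * exp (- (2 * \<nu> * of_real u))))) integrable_on {0..}"
    unfolding Q by (rule integrable_on_mult_right)
  then show "(\<lambda>u. of_real (exp (- \<beta> * (cosh u)\<^sup>2)) * exp (- (2 * \<nu> * of_real u))) integrable_on {0..}"
    by simp
qed

section \<open>The moment of the sum of squares\<close>

lemma has_integral_linear_combination: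
  fixes f1 f2 f3 :: "real \<Rightarrow> complex"
  assumes "(f1 has_integral I1) S" "(f2 has_integral I2) S" "(f3 has_integral I3) S"
  shows "((\<lambda>x. a * f1 x + b * f2 x + c * f3 x) has_integral (a * I1 + b * I2 + c * I3)) S"
  by (intro has_integral_add has_integral_mult_right assms)

text \<open>With Y written through J_\<nu> and J_{-\<nu>}, the coefficient of J_\<nu>^2 becomes 1 +
  c^2/s^2 = 1/s^2 for s, c the sine and cosine of \<nu> pi, which makes the result symmetric in
  \<nu> and -\<nu>.\<close>

lemma bessel_square_sum:
  assumes "sin (\<nu> * of_real pi) \<noteq> 0"
  shows "(besselJ \<nu> x)\<^sup>2 + (besselY \<nu> x)\<^sup>2 =
    (besselJ \<nu> x * besselJ \<nu> x + besselJ (- \<nu>) x * besselJ (- \<nu>) x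
       - 2 * cos (\<nu> * of_real pi) * (besselJ \<nu> x * besselJ (- \<nu>) x)) / (sin (\<nu> * of_real pi))\<^sup>2"
proof -
  have *: "a\<^sup>2 + ((a * c - b) / s)\<^sup>2 = (a * a + b * b - 2 * c * (a * b)) / s\<^sup>2"
    if "s \<noteq> 0" "s\<^sup>2 + c\<^sup>2 = 1" for a b c s :: complex
  proof -
    have "a\<^sup>2 + ((a * c - b) / s)\<^sup>2 = (a\<^sup>2 * s\<^sup>2 + (a * c - b)\<^sup>2) / s\<^sup>2"
      using that(1) by (simp add: field_simps power2_eq_square)
    also have "a\<^sup>2 * s\<^sup>2 + (a * c - b)\<^sup>2 = a\<^sup>2 * (s\<^sup>2 + c\<^sup>2) + b * b - 2 * c * (a * b)"
      by (simp add: algebra_simps power2_eq_square)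
    finally show ?thesis unfolding that(2) by (simp add: power2_eq_square)
  qed
  show ?thesis unfolding besselY_def by (rule *[OF assms]) simp
qed

lemma sin_imaginary: "sin (\<i> * of_real \<mu> * of_real pi) = \<i> * of_real (sinh (\<mu> * pi))"
proof -
  have "sin (\<i> * of_real (\<mu> * pi)) = \<i> * of_real (sinh (\<mu> * pi))"
    unfolding sin_exp_eq sinh_def of_real_mult[symmetric]
    by (simp add: exp_of_real[symmetric] scaleR_conv_of_real field_simps)
  then show ?thesis by (simp add: mult.assoc)
qed

text \<open>The infinite integral in Schlaefli's formula has the factor sin(\<nu> pi), which is odd
  in \<nu>. So J_\<nu>^2 and J_{-\<nu>}^2 contribute their tails with opposite signs, and the mixed
  product has none. The difference of e^{2\<nu>u} and e^{-2\<nu>u} is the sine in the last summand,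
  and one power of sin(\<nu> pi) survives in its denominator.\<close>

lemma bessel_moment:
  assumes \<mu>: "\<mu> \<noteq> 0" and \<beta>: "\<beta> > 0"
  defines "\<nu> \<equiv> \<i> * complex_of_real \<mu>"
  defines "s \<equiv> sin (\<nu> * of_real pi)"
  shows "((\<lambda>x. of_real (x / \<beta> * exp (- x\<^sup>2 / \<beta>)) * ((besselJ \<nu> x)\<^sup>2 + (besselY \<nu> x)\<^sup>2)) has_integral
     integral {-pi..pi} (\<lambda>A. of_real (exp (- \<beta> * ((1 - cos A) / 2))) *
         ((exp (- (\<i> * \<nu> * of_real A)) + exp (\<i> * \<nu> * of_real A)) / (4 * of_real pi * s\<^sup>2)))
   + integral {-pi..pi} (\<lambda>A. of_real (exp (- \<beta> * ((1 + cos A) / 2))) *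
         (- cos (\<nu> * of_real pi) / (2 * of_real pi * s\<^sup>2) * exp (- (\<i> * \<nu> * of_real A))))
   + integral {0..} (\<lambda>u. of_real (exp (- \<beta> * (cosh u)\<^sup>2)) * of_real (2 * sin (2 * \<mu> * u) / (pi * sinh (\<mu> * pi))))) {0<..}"
proof -
  have s_eq: "s = \<i> * of_real (sinh (\<mu> * pi))" unfolding s_def \<nu>_def by (rule sin_imaginary)
  have sh: "sinh (\<mu> * pi) \<noteq> 0" using \<mu> by simp
  have s0: "s \<noteq> 0" unfolding s_eq using sh by simp
  have re: "Re \<nu> = 0" "Im \<nu> \<noteq> 0" "Re (- \<nu>) = 0" "Im (- \<nu>) \<noteq> 0" using \<mu> by (simp_all add: \<nu>_def)
  let ?c = "cos (\<nu> * of_real pi)"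
  let ?G = "\<lambda>x. complex_of_real (x / \<beta> * exp (- x\<^sup>2 / \<beta>))"
  define A1 where "A1 = integral {-pi..pi} (\<lambda>A. of_real (exp (- \<beta> * ((1 - cos A) / 2))) * exp (- (\<i> * \<nu> * of_real A)))"
  define A2 where "A2 = integral {-pi..pi} (\<lambda>A. of_real (exp (- \<beta> * ((1 - cos A) / 2))) * exp (\<i> * \<nu> * of_real A))"
  define A3 where "A3 = integral {-pi..pi} (\<lambda>A. of_real (exp (- \<beta> * ((1 + cos A) / 2))) * exp (- (\<i> * \<nu> * of_real A)))"
  define U1 where "U1 = integral {0..} (\<lambda>u. of_real (exp (- \<beta> * (cosh u)\<^sup>2)) * exp (- (2 * \<nu> * of_real u)))"
  define U2 where "U2 = integral {0..} (\<lambda>u. of_real (exp (- \<beta> * (cosh u)\<^sup>2)) * exp (2 * \<nu> * of_real u))"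
  note i1 = integrable_integral[OF weber_product(1)[OF re(1) re(1) \<beta>]]
  note i2 = integrable_integral[OF weber_product(1)[OF re(3) re(3) \<beta>]]
  note i3 = integrable_integral[OF weber_product(1)[OF re(1) re(3) \<beta>]]
  have w1: "integral {0<..} (\<lambda>x. ?G x * (besselJ \<nu> x * besselJ \<nu> x)) = 1 / (4 * of_real pi) * A1 - s / of_real pi * U1"
    unfolding A1_def U1_def s_def by (rule weber_square_integral(1)[OF re(1,2) \<beta>])
  have w2: "integral {0<..} (\<lambda>x. ?G x * (besselJ (- \<nu>) x * besselJ (- \<nu>) x)) = 1 / (4 * of_real pi) * A2 + s / of_real pi * U2"
    using weber_square_integral(1)[OF re(3,4) \<beta>] unfolding A2_def U2_def s_def by simp
  have w3: "integral {0<..} (\<lambda>x. ?G x * (besselJ \<nu> x * besselJ (- \<nu>) x)) = 1 / (4 * of_real pi) * A3"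
    unfolding A3_def by (rule weber_mixed_integral[OF re(1,2) \<beta>])
  have "((\<lambda>x. 1 / s\<^sup>2 * (?G x * (besselJ \<nu> x * besselJ \<nu> x)) + 1 / s\<^sup>2 * (?G x * (besselJ (- \<nu>) x * besselJ (- \<nu>) x))
        + (- 2 * ?c / s\<^sup>2) * (?G x * (besselJ \<nu> x * besselJ (- \<nu>) x))) has_integral
     (1 / s\<^sup>2 * (1 / (4 * of_real pi) * A1 - s / of_real pi * U1) + 1 / s\<^sup>2 * (1 / (4 * of_real pi) * A2 + s / of_real pi * U2)
        + (- 2 * ?c / s\<^sup>2) * (1 / (4 * of_real pi) * A3))) {0<..}"
    by (rule has_integral_linear_combination) (use i1 i2 i3 in \<open>simp_all only: w1 w2 w3\<close>)
  also have "(\<lambda>x. 1 / s\<^sup>2 * (?G x * (besselJ \<nu> x * besselJ \<nu> x)) + 1 / s\<^sup>2 * (?G x * (besselJ (- \<nu>) x * besselJ (- \<nu>) x))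
        + (- 2 * ?c / s\<^sup>2) * (?G x * (besselJ \<nu> x * besselJ (- \<nu>) x))) =
      (\<lambda>x. ?G x * ((besselJ \<nu> x)\<^sup>2 + (besselY \<nu> x)\<^sup>2))"
  proof
    fix x
    have *: "1 / t * (g * a) + 1 / t * (g * b) + (- 2 * c / t) * (g * d) = g * ((a + b - 2 * c * d) / t)"
      for t g a b c d :: complex by (cases "t = 0") (simp_all add: field_simps)
    show "1 / s\<^sup>2 * (?G x * (besselJ \<nu> x * besselJ \<nu> x)) + 1 / s\<^sup>2 * (?G x * (besselJ (- \<nu>) x * besselJ (- \<nu>) x))
        + (- 2 * ?c / s\<^sup>2) * (?G x * (besselJ \<nu> x * besselJ (- \<nu>) x)) = ?G x * ((besselJ \<nu> x)\<^sup>2 + (besselY \<nu> x)\<^sup>2)"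
      unfolding bessel_square_sum[OF s0[unfolded s_def]] s_def[symmetric] by (rule *)
  qed
  also have "1 / s\<^sup>2 * (1 / (4 * of_real pi) * A1 - s / of_real pi * U1) + 1 / s\<^sup>2 * (1 / (4 * of_real pi) * A2 + s / of_real pi * U2)
        + (- 2 * ?c / s\<^sup>2) * (1 / (4 * of_real pi) * A3) =
      (1 / (4 * of_real pi * s\<^sup>2) * (A1 + A2)) + (- ?c / (2 * of_real pi * s\<^sup>2) * A3) + (1 / (of_real pi * s) * (U2 - U1))"
  proof -
    have "1 / t\<^sup>2 * (1 / (4 * p) * a - t / p * u) + 1 / t\<^sup>2 * (1 / (4 * p) * b + t / p * v) + (- 2 * c / t\<^sup>2) * (1 / (4 * p) * d) =
       1 / (4 * p * t\<^sup>2) * (a + b) + - c / (2 * p * t\<^sup>2) * d + 1 / (p * t) * (v - u)"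
      if "p \<noteq> 0" "t \<noteq> 0" for p t a b c d u v :: complex
      using that by (simp add: divide_simps power2_eq_square) (simp add: algebra_simps)
    then show ?thesis using s0 by simp
  qed
  also have "1 / (4 * of_real pi * s\<^sup>2) * (A1 + A2) = integral {-pi..pi} (\<lambda>A. of_real (exp (- \<beta> * ((1 - cos A) / 2))) *
         ((exp (- (\<i> * \<nu> * of_real A)) + exp (\<i> * \<nu> * of_real A)) / (4 * of_real pi * s\<^sup>2)))"
  proof -
    have "A1 + A2 = integral {-pi..pi} (\<lambda>A. of_real (exp (- \<beta> * ((1 - cos A) / 2))) * exp (- (\<i> * \<nu> * of_real A))
         + of_real (exp (- \<beta> * ((1 - cos A) / 2))) * exp (\<i> * \<nu> * of_real A))"
      unfolding A1_def A2_def
      by (intro integral_add[symmetric] integrable_continuous_interval continuous_intros) auto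
    then show ?thesis
      by (simp only: integral_mult_right[symmetric]) (simp add: field_simps)
  qed
  also have "- ?c / (2 * of_real pi * s\<^sup>2) * A3 = integral {-pi..pi} (\<lambda>A. of_real (exp (- \<beta> * ((1 + cos A) / 2))) *
         (- ?c / (2 * of_real pi * s\<^sup>2) * exp (- (\<i> * \<nu> * of_real A))))"
    unfolding A3_def by (simp only: integral_mult_right[symmetric] mult.left_commute)
  also have "1 / (of_real pi * s) * (U2 - U1) = integral {0..} (\<lambda>u. of_real (exp (- \<beta> * (cosh u)\<^sup>2)) * of_real (2 * sin (2 * \<mu> * u) / (pi * sinh (\<mu> * pi))))"
  proof -
    have "U2 - U1 = integral {0..} (\<lambda>u. of_real (exp (- \<beta> * (cosh u)\<^sup>2)) * exp (2 * \<nu> * of_real u)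
        - of_real (exp (- \<beta> * (cosh u)\<^sup>2)) * exp (- (2 * \<nu> * of_real u)))"
      unfolding U1_def U2_def
      using weber_square_integral(2)[OF re(1,2) \<beta>] weber_square_integral(2)[OF re(3,4) \<beta>]
      by (intro integral_diff[symmetric]) simp_all
    then have "1 / (of_real pi * s) * (U2 - U1) = integral {0..} (\<lambda>u. 1 / (of_real pi * s) * (of_real (exp (- \<beta> * (cosh u)\<^sup>2)) * exp (2 * \<nu> * of_real u)
        - of_real (exp (- \<beta> * (cosh u)\<^sup>2)) * exp (- (2 * \<nu> * of_real u))))"
      by simp
    also have "\<dots> = integral {0..} (\<lambda>u. of_real (exp (- \<beta> * (cosh u)\<^sup>2)) * of_real (2 * sin (2 * \<mu> * u) / (pi * sinh (\<mu> * pi))))"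
    proof (rule integral_cong)
      fix u :: real
      have "exp (2 * \<nu> * of_real u) - exp (- (2 * \<nu> * of_real u)) = 2 * \<i> * of_real (sin (2 * \<mu> * u))"
      proof -
        have 1: "2 * \<nu> * of_real u = \<i> * of_real (2 * \<mu> * u)" by (simp add: \<nu>_def)
        have 2: "exp (\<i> * z) - exp (- (\<i> * z)) = 2 * \<i> * sin z" for z :: complex
          unfolding sin_exp_eq by (simp add: field_simps)
        show ?thesis unfolding 1 2 sin_of_real ..
      qed
      moreover have "1 / (p * (\<i> * t)) * (e * x - e * y) = e * (2 * z / (p * t))"
        if "x - y = 2 * \<i> * z" for p t e x y z :: complex
      proof -
        have "1 / (p * (\<i> * t)) * (e * x - e * y) = 1 / (p * (\<i> * t)) * (e * (x - y))" by (simp add: algebra_simps)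
        then show ?thesis unfolding that by simp
      qed
      ultimately have "1 / (of_real pi * (\<i> * of_real (sinh (\<mu> * pi)))) * (of_real (exp (- \<beta> * (cosh u)\<^sup>2)) * exp (2 * \<nu> * of_real u)
        - of_real (exp (- \<beta> * (cosh u)\<^sup>2)) * exp (- (2 * \<nu> * of_real u))) =
        of_real (exp (- \<beta> * (cosh u)\<^sup>2)) * (2 * of_real (sin (2 * \<mu> * u)) / (of_real pi * of_real (sinh (\<mu> * pi))))"
        by blast
      then show "1 / (of_real pi * s) * (of_real (exp (- \<beta> * (cosh u)\<^sup>2)) * exp (2 * \<nu> * of_real u)
        - of_real (exp (- \<beta> * (cosh u)\<^sup>2)) * exp (- (2 * \<nu> * of_real u))) =
        of_real (exp (- \<beta> * (cosh u)\<^sup>2)) * of_real (2 * sin (2 * \<mu> * u) / (pi * sinh (\<mu> * pi)))"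
        unfolding s_eq by (simp only: of_real_mult of_real_divide of_real_numeral)
    qed
    finally show ?thesis .
  qed
  finally show ?thesis .
qed

subsection \<open>Bounds for Bessel functions\<close>

lemma exp_cosh_integrable: "(\<lambda>u::real. exp (- (cosh u)\<^sup>2)) integrable_on {0..}"
proof (rule measurable_bounded_by_integrable_imp_integrable)
  show "(\<lambda>u::real. exp (- u) * exp 1) integrable_on {0..}"
    using has_integral_exp_minus_to_infinity[of 1 0]
    by (intro integrable_on_mult_left) (auto simp: has_integral_iff)
  fix u :: real assume "u \<in> {0..}"
  have "1 + u \<le> exp u" by (rule exp_ge_add_one_self)
  moreover have "exp u \<le> 2 * cosh u" by (simp add: cosh_def)
  ultimately have "u \<le> 2 * cosh u - 1" by linarith
  also have "\<dots> \<le> (cosh u)\<^sup>2"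
    using zero_le_power2[of "cosh u - 1"] by (simp add: power2_eq_square algebra_simps)
  finally have "exp (- (cosh u)\<^sup>2) \<le> exp (- u)" by simp
  also have "\<dots> \<le> exp (- u) * exp 1" by simp
  finally show "norm (exp (- (cosh u)\<^sup>2)) \<le> exp (- u) * exp 1" by simp
qed (auto intro!: continuous_imp_measurable_on_sets_lebesgue continuous_intros)

lemma bounded_bser_unit:
  assumes "Re \<nu> \<ge> 0"
  shows "\<exists>B\<ge>0. \<forall>t\<in>{0..1}. norm (bser \<nu> (of_real t)) \<le> B"
proof -
  have "compact ((\<lambda>t. bser \<nu> (complex_of_real t)) ` {0..1})"
    by (intro compact_continuous_image continuous_intros assms) auto
  then obtain B where "\<forall>y\<in>(\<lambda>t. bser \<nu> (complex_of_real t)) ` {0..1}. norm y \<le> B"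
    using compact_imp_bounded bounded_iff by metis
  then show ?thesis by (intro exI[of _ "max B 0"]) (auto simp: le_max_iff_disj)
qed

text \<open>For an imaginary order the factor (x/2)^\<nu> has modulus 1, so there is no singularity
  at 0 and compactness suffices up to x = 2. From there on, where r = x/2 is at least 1, the energy
  estimate takes over.\<close>

lemma besselJ_bound:
  assumes "Re \<nu> = 0"
  shows "\<exists>K\<ge>0. \<forall>x>0. (1 + x) * (norm (besselJ \<nu> x))\<^sup>2 \<le> K"
proof -
  obtain B where B: "B \<ge> 0" "\<And>t. t \<in> {0..1} \<Longrightarrow> norm (bser \<nu> (of_real t)) \<le> B"
    using bounded_bser_unit[of \<nu>] assms by auto
  obtain E where E: "E \<ge> 0" "\<And>r. r \<ge> 1 \<Longrightarrow> (norm (bser \<nu> (of_real (r\<^sup>2))))\<^sup>2 \<le> E / r"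
    using bser_decay[OF assms] by auto
  have "(1 + x) * (norm (besselJ \<nu> x))\<^sup>2 \<le> 3 * B\<^sup>2 + 3 * E" if x: "x > 0" for x
  proof -
    have n: "norm (besselJ \<nu> x) = norm (bser \<nu> (of_real ((x / 2)\<^sup>2)))"
      using norm_real_powr_imaginary[OF _ assms, of "x / 2"] x assms
      by (simp add: besselJ_eq_bser norm_mult)
    show ?thesis
    proof (cases "x \<le> 2")
      case True
      then have "(x / 2)\<^sup>2 \<le> 1" using x by (intro power_le_one) auto
      then have "norm (besselJ \<nu> x) \<le> B" unfolding n by (intro B) auto
      then have "(1 + x) * (norm (besselJ \<nu> x))\<^sup>2 \<le> 3 * B\<^sup>2"
        using x True by (intro mult_mono power_mono) auto
      then show ?thesis using E(1) by simp
    next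
      case False
      then have "(norm (besselJ \<nu> x))\<^sup>2 \<le> E / (x / 2)" unfolding n by (intro E) auto
      then have "(1 + x) * (norm (besselJ \<nu> x))\<^sup>2 \<le> (1 + x) * (E / (x / 2))"
        using x by (intro mult_left_mono) auto
      also have "\<dots> = (2 * (1 + x) / x) * E" by simp
      also have "\<dots> \<le> 3 * E" using x False E(1) by (intro mult_right_mono) (auto simp: field_simps)
      finally show ?thesis using zero_le_power2[of B] by linarith
    qed
  qed
  then show ?thesis using B(1) E(1) by (intro exI[of _ "3 * B\<^sup>2 + 3 * E"]) auto
qed

lemma bessel_square_sum_bound:
  assumes \<mu>: "\<mu> \<noteq> 0"
  defines "\<nu> \<equiv> \<i> * complex_of_real \<mu>"
  shows "\<exists>K\<ge>0. \<forall>x>0. norm ((besselJ \<nu> x)\<^sup>2 + (besselY \<nu> x)\<^sup>2) \<le> K / (1 + x)"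
proof -
  have re: "Re \<nu> = 0" "Re (- \<nu>) = 0" by (simp_all add: \<nu>_def)
  obtain K1 where K1: "K1 \<ge> 0" "\<And>x. x > 0 \<Longrightarrow> (1 + x) * (norm (besselJ \<nu> x))\<^sup>2 \<le> K1"
    using besselJ_bound[OF re(1)] by auto
  obtain K2 where K2: "K2 \<ge> 0" "\<And>x. x > 0 \<Longrightarrow> (1 + x) * (norm (besselJ (- \<nu>) x))\<^sup>2 \<le> K2"
    using besselJ_bound[OF re(2)] by auto
  define s where "s = sin (\<nu> * of_real pi)"
  define c where "c = cos (\<nu> * of_real pi)"
  have "sinh (\<mu> * pi) \<noteq> 0" using \<mu> by simp
  then have s0: "s \<noteq> 0" unfolding s_def \<nu>_def sin_imaginary by simp
  define K where "K = (1 + norm c) * (K1 + K2) / (norm s)\<^sup>2"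
  have "norm ((besselJ \<nu> x)\<^sup>2 + (besselY \<nu> x)\<^sup>2) \<le> K / (1 + x)" if x: "x > 0" for x
  proof -
    define a where "a = norm (besselJ \<nu> x)"
    define b where "b = norm (besselJ (- \<nu>) x)"
    have "norm (besselJ \<nu> x * besselJ \<nu> x + besselJ (- \<nu>) x * besselJ (- \<nu>) x
       - 2 * c * (besselJ \<nu> x * besselJ (- \<nu>) x)) \<le> a * a + b * b + norm (2 * c) * (a * b)"
      unfolding a_def b_def norm_mult[symmetric]
      by (rule order_trans[OF norm_triangle_ineq4 add_mono[OF norm_triangle_ineq order_refl]])
    also have "\<dots> = a\<^sup>2 + b\<^sup>2 + norm c * (2 * a * b)" by (simp add: norm_mult power2_eq_square)
    also have "\<dots> \<le> a\<^sup>2 + b\<^sup>2 + norm c * (a\<^sup>2 + b\<^sup>2)"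
      by (intro add_left_mono mult_left_mono sum_squares_bound) auto
    also have "\<dots> = (1 + norm c) * (a\<^sup>2 + b\<^sup>2)" by (simp add: algebra_simps)
    also have "\<dots> \<le> (1 + norm c) * ((K1 + K2) / (1 + x))"
    proof (rule mult_left_mono)
      have "(1 + x) * (a\<^sup>2 + b\<^sup>2) \<le> K1 + K2"
        using K1(2)[OF x] K2(2)[OF x] by (simp add: a_def b_def algebra_simps)
      then show "a\<^sup>2 + b\<^sup>2 \<le> (K1 + K2) / (1 + x)" using x by (simp add: field_simps)
    qed auto
    finally have le: "norm (besselJ \<nu> x * besselJ \<nu> x + besselJ (- \<nu>) x * besselJ (- \<nu>) x
       - 2 * c * (besselJ \<nu> x * besselJ (- \<nu>) x)) \<le> (1 + norm c) * ((K1 + K2) / (1 + x))" .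
    have "norm ((besselJ \<nu> x)\<^sup>2 + (besselY \<nu> x)\<^sup>2) = norm (besselJ \<nu> x * besselJ \<nu> x + besselJ (- \<nu>) x * besselJ (- \<nu>) x
       - 2 * c * (besselJ \<nu> x * besselJ (- \<nu>) x)) / (norm s)\<^sup>2"
      unfolding bessel_square_sum[OF s0[unfolded s_def]] c_def[symmetric] s_def[symmetric] by (simp add: norm_divide norm_power)
    also have "\<dots> \<le> ((1 + norm c) * ((K1 + K2) / (1 + x))) / (norm s)\<^sup>2"
      by (intro divide_right_mono le) auto
    also have "\<dots> = K / (1 + x)" by (simp add: K_def)
    finally show ?thesis .
  qed
  moreover have "K \<ge> 0" using K1(1) K2(1) by (simp add: K_def)
  ultimately show ?thesis by blast
qed

lemma bser0_bound: "\<exists>B\<ge>0. \<forall>t\<ge>0. norm (bser 0 (of_real t)) \<le> B"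
proof -
  obtain B where B: "B \<ge> 0" "\<And>t. t \<in> {0..1} \<Longrightarrow> norm (bser 0 (of_real t)) \<le> B"
    using bounded_bser_unit[of 0] by auto
  obtain E where E: "E \<ge> 0" "\<And>r. r \<ge> 1 \<Longrightarrow> (norm (bser 0 (of_real (r\<^sup>2))))\<^sup>2 \<le> E / r"
    using bser_decay[of 0] by auto
  have "norm (bser 0 (of_real t)) \<le> max B (sqrt E)" if t: "t \<ge> 0" for t
  proof (cases "t \<le> 1")
    case True
    then show ?thesis using B(2)[of t] t by simp
  next
    case False
    then have "(norm (bser 0 (of_real ((sqrt t)\<^sup>2))))\<^sup>2 \<le> E / sqrt t" by (intro E) auto
    also have "\<dots> \<le> E / 1" using E(1) False by (intro divide_left_mono) auto
    finally have "norm (bser 0 (of_real t)) \<le> sqrt E" using t by (intro real_le_rsqrt) simp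
    then show ?thesis by simp
  qed
  then show ?thesis using B(1) by (intro exI[of _ "max B (sqrt E)"]) auto
qed

text \<open>As r times \<open>bser 1\<close> at r^2 is J_1(2r), this is the boundedness of sqrt r
  J_1(2r).\<close>

lemma bser1_bound: "\<exists>B\<ge>0. \<forall>r\<ge>0. r * sqrt r * norm (bser 1 (of_real (r\<^sup>2))) \<le> B"
proof -
  obtain B where B: "B \<ge> 0" "\<And>t. t \<in> {0..1} \<Longrightarrow> norm (bser 1 (of_real t)) \<le> B"
    using bounded_bser_unit[of 1] by auto
  obtain E where E: "E \<ge> 0" "\<And>r. r \<ge> 1 \<Longrightarrow> (norm (bser 1 (of_real (r\<^sup>2))))\<^sup>2 \<le> 4 * E / r ^ 3"
    using bser_decay[of 0] by auto
  have "r * sqrt r * norm (bser 1 (of_real (r\<^sup>2))) \<le> max B (sqrt (4 * E))" if r: "r \<ge> 0" for r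
  proof (cases "r \<le> 1")
    case True
    then have "r * sqrt r \<le> 1 * 1" using r by (intro mult_mono) auto
    moreover have "norm (bser 1 (of_real (r\<^sup>2))) \<le> B" using True r by (intro B) (auto intro: power_le_one)
    ultimately have "r * sqrt r * norm (bser 1 (of_real (r\<^sup>2))) \<le> 1 * B"
      using r by (intro mult_mono) auto
    then show ?thesis by simp
  next
    case False
    have "(r * sqrt r * norm (bser 1 (of_real (r\<^sup>2))))\<^sup>2 = r ^ 3 * (norm (bser 1 (of_real (r\<^sup>2))))\<^sup>2"
      using r by (simp add: power_mult_distrib power2_eq_square power3_eq_cube)
    also have "\<dots> \<le> r ^ 3 * (4 * E / r ^ 3)" using E(2)[of r] False by (intro mult_left_mono) auto
    also have "\<dots> = 4 * E" using False by simp
    finally have "r * sqrt r * norm (bser 1 (of_real (r\<^sup>2))) \<le> sqrt (4 * E)" by (rule real_le_rsqrt)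
    then show ?thesis by simp
  qed
  then show ?thesis using B(1) by (intro exI[of _ "max B (sqrt (4 * E))"]) auto
qed

text \<open>Take r = x sqrt q in \<open>bser1_bound\<close> and multiply by q^{1/4}. The resulting
  bound q^{1/4} is relaxed to 1 + q, which is still integrable against e^{-q}.\<close>

lemma bser1_weighted_bound:
  "\<exists>B\<ge>0. \<forall>x>0. \<forall>q\<ge>0. x * sqrt x * (q * norm (bser 1 (of_real (x\<^sup>2 * q)))) \<le> B * (1 + q)"
proof -
  obtain B where B: "B \<ge> 0" "\<And>r. r \<ge> 0 \<Longrightarrow> r * sqrt r * norm (bser 1 (of_real (r\<^sup>2))) \<le> B"
    using bser1_bound by auto
  have "x * sqrt x * (q * norm (bser 1 (of_real (x\<^sup>2 * q)))) \<le> B * (1 + q)" if x: "x > 0" and q: "q \<ge> 0" for x q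
  proof -
    define b where "b = norm (bser 1 (of_real (x\<^sup>2 * q)))"
    have sq: "(x * sqrt q)\<^sup>2 = x\<^sup>2 * q" using q by (simp add: power_mult_distrib)
    have qq: "sqrt (sqrt q) * sqrt (sqrt q) * sqrt q = q" using q by simp
    have "x * sqrt q * sqrt (x * sqrt q) * b \<le> B" unfolding b_def using B(2)[of "x * sqrt q"] x q by (simp only: sq) simp
    then have "x * sqrt q * sqrt (x * sqrt q) * b * sqrt (sqrt q) \<le> B * sqrt (sqrt q)"
      using q by (intro mult_right_mono) auto
    moreover have "x * sqrt q * sqrt (x * sqrt q) * b * sqrt (sqrt q) = x * sqrt x * ((sqrt (sqrt q) * sqrt (sqrt q) * sqrt q) * b)"
      by (simp only: real_sqrt_mult mult_ac)
    ultimately have "x * sqrt x * (q * b) \<le> B * sqrt (sqrt q)" unfolding qq by simp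
    also have "sqrt (sqrt q) \<le> 1 + q"
    proof (rule real_le_lsqrt)
      show "sqrt q \<le> (1 + q)\<^sup>2"
        using q by (intro real_le_lsqrt) (auto simp: power2_eq_square algebra_simps intro!: add_nonneg_nonneg)
    qed (use q in auto)
    then have "B * sqrt (sqrt q) \<le> B * (1 + q)" using B(1) by (rule mult_left_mono)
    finally show ?thesis unfolding b_def .
  qed
  then show ?thesis using B(1) by blast
qed

text \<open>The relation (t J_1(t))' = t J_0(t) in the variable q. The primitive equals sqrt q
  J_1(2x sqrt q)/x, and its factor 1/x is the gain of an integration by parts.\<close>

lemma has_vector_derivative_bser1_kernel:
  "((\<lambda>q. of_real q * bser 1 (of_real (x\<^sup>2 * q))) has_vector_derivative bser 0 (of_real (x\<^sup>2 * q))) (at q within A)"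
proof -
  have "((\<lambda>q. complex_of_real (x\<^sup>2 * q)) has_vector_derivative of_real (x\<^sup>2)) (at q within A)"
    by (rule has_vector_derivative_of_real) (auto intro!: derivative_eq_intros)
  from field_vector_diff_chain_within[OF this, of "bser 1" "- bser 2 (of_real (x\<^sup>2 * q))"]
  have "((\<lambda>q. bser 1 (of_real (x\<^sup>2 * q))) has_vector_derivative of_real (x\<^sup>2) * - bser 2 (of_real (x\<^sup>2 * q))) (at q within A)"
    using DERIV_subset[OF has_field_derivative_bser[of 1 "of_real (x\<^sup>2 * q)"]] by (simp add: o_def)
  moreover have "((\<lambda>q. complex_of_real q) has_vector_derivative 1) (at q within A)"
    using has_vector_derivative_of_real[of "\<lambda>q. q" 1] by simp
  ultimately have "((\<lambda>q. of_real q * bser 1 (of_real (x\<^sup>2 * q))) has_vector_derivative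
      of_real q * (of_real (x\<^sup>2) * - bser 2 (of_real (x\<^sup>2 * q))) + 1 * bser 1 (of_real (x\<^sup>2 * q))) (at q within A)"
    by (intro has_vector_derivative_mult)
  moreover have "of_real q * (of_real (x\<^sup>2) * - bser 2 (of_real (x\<^sup>2 * q))) + 1 * bser 1 (of_real (x\<^sup>2 * q)) = bser 0 (of_real (x\<^sup>2 * q))"
    using bser_rec[of 0 "of_real (x\<^sup>2 * q)"] by simp
  ultimately show ?thesis by (simp only:)
qed

subsection \<open>Pairing with Hankel transforms\<close>

text \<open>The kernel is J_0(2x sqrt q), written through \<open>bser\<close> so that it is smooth
  in q down to q = 0.\<close>

definition hankel0 :: "(real \<Rightarrow> complex) \<Rightarrow> real \<Rightarrow> complex" where
  "hankel0 h x = of_real x * integral {0..} (\<lambda>q. bser 0 (of_real (x\<^sup>2 * q)) * h q)"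

lemma exp_moment:
  assumes "a > 0"
  shows "((\<lambda>q. of_real (q ^ k * exp (- a * q))) has_integral (fact k / of_real a ^ Suc k :: complex)) {0..}"
proof -
  define f where "f t = complex_of_real t powr (of_nat (Suc k) - 1) / of_real (exp t)" for t :: real
  have im: "(\<lambda>q. a * q) ` {0<..} = {0<..}"
  proof (intro equalityI subsetI)
    fix t :: real assume "t \<in> {0<..}"
    then have "t = a * (t / a)" "t / a > 0" using assms by auto
    then show "t \<in> (\<lambda>q. a * q) ` {0<..}" by (metis greaterThan_iff image_eqI)
  qed (use assms in auto)
  have re: "Re (of_nat (Suc k)) > 0" by simp
  have "f absolutely_integrable_on {0<..} \<and> integral {0<..} f = Gamma (of_nat (Suc k))"
    unfolding f_def[abs_def]
    using absolutely_integrable_Gamma_integral'[OF re] integral_unique[OF Gamma_integral_complex'[OF re]] by simp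
  moreover have "Gamma (of_nat (Suc k)) = (fact k :: complex)"
    using Gamma_fact[of k, where ?'a = complex] by (simp add: add.commute)
  ultimately have f: "f absolutely_integrable_on {0<..} \<and> integral {0<..} f = fact k" by simp
  have "((\<lambda>q. a * q) has_real_derivative a) (at q within {0<..})" for q
    by (auto intro!: derivative_eq_intros)
  moreover have "inj_on (\<lambda>q. a * q) {0<..}" using assms by (auto intro!: inj_onI)
  ultimately have "(\<lambda>q. \<bar>a\<bar> *\<^sub>R f (a * q)) absolutely_integrable_on {0<..} \<and> integral {0<..} (\<lambda>q. \<bar>a\<bar> *\<^sub>R f (a * q)) = fact k"
    using f has_absolute_integral_change_of_variables_real[of "{0<..}" "\<lambda>q. a * q" "\<lambda>_. a" f "fact k"]
    unfolding im by simp
  then have "((\<lambda>q. \<bar>a\<bar> *\<^sub>R f (a * q)) has_integral fact k) {0<..}"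
    unfolding absolutely_integrable_on_def by (metis integrable_integral)
  from has_integral_mult_right[OF this, of "1 / of_real a ^ Suc k"]
  have "((\<lambda>q. 1 / of_real a ^ Suc k * (\<bar>a\<bar> *\<^sub>R f (a * q))) has_integral (fact k / of_real a ^ Suc k :: complex)) {0<..}"
    by simp
  then have "((\<lambda>q. of_real (q ^ k * exp (- a * q))) has_integral (fact k / of_real a ^ Suc k :: complex)) {0<..}"
  proof (rule has_integral_eq[rotated])
    fix q :: real assume "q \<in> {0<..}"
    then have "complex_of_real (a * q) powr (of_nat (Suc k) - 1) = of_real (a * q) ^ k"
      using assms by (simp add: powr_nat')
    then show "1 / of_real a ^ Suc k * (\<bar>a\<bar> *\<^sub>R f (a * q)) = (of_real (q ^ k * exp (- a * q)) :: complex)"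
      using assms by (simp add: f_def scaleR_conv_of_real power_mult_distrib exp_minus divide_simps)
  qed
  then show ?thesis
    by (rule has_integral_spike_set_eq[THEN iffD1, rotated 2])
       (auto intro: negligible_subset[of "{0}"])
qed



lemma exp_has_integral: "a > 0 \<Longrightarrow> ((\<lambda>q. exp (- a * q)) has_integral 1 / a) {0..}" for a :: real
  using has_integral_exp_minus_to_infinity[of a 0] by simp

text \<open>The Laplace transform of J_0(2x sqrt q) in q: the moments k!/a^{k+1} cancel one of the
  two factorials of the series. For the domination half of the exponent in e^{-aq} is spent on
  summing (aq/2)^k/k!.\<close>

lemma gaussian_hankel0:
  assumes a: "a > 0"
  shows "((\<lambda>q. bser 0 (of_real (x\<^sup>2 * q)) * of_real (exp (- a * q))) has_integral of_real (exp (- x\<^sup>2 / a) / a)) {0..}"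
proof -
  define F where "F k q = bcoef 0 k * of_real (x\<^sup>2) ^ k * of_real (q ^ k * exp (- a * q))" for k q
  define T where "T k = bcoef 0 k * of_real (x\<^sup>2) ^ k * (fact k / of_real a ^ Suc k)" for k
  have F: "(F k has_integral T k) {0..}" for k
    unfolding F_def T_def by (intro has_integral_mult_right exp_moment a)
  have rG: "rGamma (of_nat k + 1) = (1 / fact k :: complex)" for k
    using Gamma_fact[of k, where ?'a = complex] by (simp add: rGamma_inverse_Gamma divide_inverse add.commute)
  have bc: "bcoef 0 k = (-1) ^ k / (fact k * fact k)" for k
    by (simp add: bcoef_def rG)
  have h: "(\<lambda>q. exp (2 * x\<^sup>2 / a) * exp (- (a / 2) * q)) integrable_on {0..}"
    using exp_has_integral[of "a / 2"] a by (intro integrable_on_mult_right) (auto simp: has_integral_iff)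
  have le: "norm (\<Sum>k<n. F k q) \<le> exp (2 * x\<^sup>2 / a) * exp (- (a / 2) * q)" if "q \<in> {0..}" for n q
  proof -
    have q: "q \<ge> 0" using that by simp
    have "norm (F k q) \<le> exp (2 * x\<^sup>2 / a) * exp (- a * q) * ((a / 2 * q) ^ k / fact k)" for k
    proof -
      have "norm (F k q) = (x\<^sup>2) ^ k * q ^ k / (fact k * fact k) * exp (- a * q)"
        unfolding F_def bc using q by (simp add: norm_mult norm_divide norm_power)
      also have "(x\<^sup>2) ^ k * q ^ k / (fact k * fact k) = (2 * x\<^sup>2 / a) ^ k / fact k * ((a / 2 * q) ^ k / fact k)"
        using a by (simp add: power_divide power_mult_distrib)
      also have "\<dots> \<le> exp (2 * x\<^sup>2 / a) * ((a / 2 * q) ^ k / fact k)"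
        using a q by (intro mult_right_mono power_over_fact_le_exp) auto
      finally show ?thesis by (simp add: mult_ac)
    qed
    then have "norm (\<Sum>k<n. F k q) \<le> (\<Sum>k<n. exp (2 * x\<^sup>2 / a) * exp (- a * q) * ((a / 2 * q) ^ k / fact k))"
      by (intro sum_norm_le)
    also have "\<dots> \<le> exp (2 * x\<^sup>2 / a) * exp (- a * q) * exp (a / 2 * q)"
      unfolding sum_distrib_left[symmetric] using a q by (intro mult_left_mono sum_power_over_fact_le_exp) auto
    also have "exp (- a * q) * exp (a / 2 * q) = exp (- (a / 2) * q)"
      by (simp add: exp_add[symmetric] algebra_simps)
    then have "exp (2 * x\<^sup>2 / a) * exp (- a * q) * exp (a / 2 * q) = exp (2 * x\<^sup>2 / a) * exp (- (a / 2) * q)"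
      by (simp only: mult.assoc)
    finally show ?thesis .
  qed
  have sums: "(\<lambda>k. F k q) sums (bser 0 (of_real (x\<^sup>2 * q)) * of_real (exp (- a * q)))" for q
  proof -
    have "(\<lambda>k. bcoef 0 k * of_real (x\<^sup>2 * q) ^ k * of_real (exp (- a * q))) sums (bser 0 (of_real (x\<^sup>2 * q)) * of_real (exp (- a * q)))"
      unfolding bser_def by (intro sums_mult2 summable_sums summable_bser) simp
    moreover have "bcoef 0 k * of_real (x\<^sup>2 * q) ^ k * of_real (exp (- a * q)) = F k q" for k
      unfolding F_def by (simp add: power_mult_distrib)
    ultimately show ?thesis by simp
  qed
  have "T sums (exp (of_real (- x\<^sup>2 / a)) * (1 / of_real a))"
  proof -
    have "(\<lambda>k. of_real (- x\<^sup>2 / a) ^ k / fact k * (1 / of_real a)) sums (exp (of_real (- x\<^sup>2 / a)) * (1 / of_real a :: complex))"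
      by (intro sums_mult2 exp_power_sums)
    moreover have "of_real (- x\<^sup>2 / a) ^ k / fact k * (1 / of_real a) = T k" for k
    proof -
      have "complex_of_real (- x\<^sup>2 / a) = - 1 * (of_real (x\<^sup>2) / of_real a)" by simp
      then have "complex_of_real (- x\<^sup>2 / a) ^ k = (-1) ^ k * (of_real (x\<^sup>2) ^ k / of_real a ^ k)"
        by (simp only: power_mult_distrib power_divide)
      then show ?thesis unfolding T_def bc by simp
    qed
    ultimately show ?thesis by simp
  qed
  then have "integral {0..} (\<lambda>q. bser 0 (of_real (x\<^sup>2 * q)) * of_real (exp (- a * q))) = exp (of_real (- x\<^sup>2 / a)) * (1 / of_real a)"
    using dominated_sums(2)[OF F h le sums] by (rule sums_unique2[symmetric])
  also have "\<dots> = of_real (exp (- x\<^sup>2 / a) / a)" unfolding exp_of_real by simp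
  finally show ?thesis using dominated_sums(1)[OF F h le sums] by (simp add: has_integral_iff)
qed

section \<open>Uniform decay of Hankel transforms\<close>

lemma linear_exp_integrable: "(\<lambda>q::real. (1 + q) * exp (- q)) integrable_on {0..}"
proof -
  have "((\<lambda>q. of_real (q ^ 0 * exp (- 1 * q)) + of_real (q ^ 1 * exp (- 1 * q))) has_integral (fact 0 / of_real 1 ^ Suc 0 + fact 1 / of_real 1 ^ Suc 1 :: complex)) {0..}"
    by (intro has_integral_add exp_moment) auto
  from has_integral_linear[OF this bounded_linear_Re]
  have "(\<lambda>q::real. exp (- q) + q * exp (- q)) integrable_on {0..}" by (auto simp: o_def)
  then show ?thesis by (simp add: algebra_simps)
qed

text \<open>Merges an estimate near 0 and one at infinity into a single weight; the factor 2 comes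
  from sqrt(1 + x) being at most twice the larger of 1 and sqrt x.\<close>

lemma inverse_sqrt_bounds:
  assumes "x > 0" "c \<ge> 0" "y \<le> c * x" "y \<le> c / sqrt x"
  shows "y \<le> 2 * c / sqrt (1 + x)"
proof (cases "x \<le> 1")
  case True
  have "sqrt (1 + x) \<le> 2" using True by (intro real_le_lsqrt) auto
  then have "c * 1 \<le> c * (2 / sqrt (1 + x))" using assms by (intro mult_left_mono) (auto simp: field_simps)
  moreover have "c * x \<le> c * 1" using True assms by (intro mult_left_mono) auto
  moreover have "c * (2 / sqrt (1 + x)) = 2 * c / sqrt (1 + x)" by simp
  ultimately show ?thesis using assms(3) by linarith
next
  case False
  then have "sqrt (1 + x) \<le> sqrt (4 * x)" by (intro real_sqrt_le_mono) auto
  then have "sqrt (1 + x) \<le> 2 * sqrt x" by (simp add: real_sqrt_mult)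
  then have "c / sqrt x \<le> c * (2 / sqrt (1 + x))"
    using assms by (simp add: divide_simps mult_left_mono) (simp add: mult_left_mono mult.commute mult.left_commute)
  moreover have "c * (2 / sqrt (1 + x)) = 2 * c / sqrt (1 + x)" by simp
  ultimately show ?thesis using assms(4) by linarith
qed

lemma bser_mult_integrable:
  assumes "continuous_on {0..} h" "\<And>q. q \<ge> 0 \<Longrightarrow> norm (h q) \<le> L * exp (- q)"
  shows "(\<lambda>q. bser 0 (of_real (x\<^sup>2 * q)) * h q) integrable_on {0..}"
proof -
  obtain B where B: "B \<ge> 0" "\<And>t. t \<ge> 0 \<Longrightarrow> norm (bser 0 (of_real t)) \<le> B" using bser0_bound by auto
  have c: "continuous_on {0..} (\<lambda>q. bser 0 (of_real (x\<^sup>2 * q)) * h q)"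
    by (intro continuous_intros assms) auto
  show ?thesis
  proof (rule measurable_bounded_by_integrable_imp_integrable[OF continuous_imp_measurable_on_sets_lebesgue[OF c]])
    show "(\<lambda>q. B * (L * exp (- 1 * q))) integrable_on {0..}"
      using exp_has_integral[of 1] by (intro integrable_on_mult_right) (auto simp: has_integral_iff)
    show "norm (bser 0 (of_real (x\<^sup>2 * q)) * h q) \<le> B * (L * exp (- 1 * q))" if "q \<in> {0..}" for q
      unfolding norm_mult using that B(1) B(2)[of "x\<^sup>2 * q"] assms(2)[of q] by (intro mult_mono) auto
  qed auto
qed

text \<open>Direct estimation gives O(x), which is good near 0; integration by parts gives
  O(x^{-1/2}) at infinity. The constant is quantified before h, so that a whole sequence of
  approximants is dominated by one function of x.\<close>

lemma hankel0_bound: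
  "\<exists>A\<ge>0. \<forall>L h h'. L \<ge> 0 \<longrightarrow> (\<forall>q\<ge>0. (h has_vector_derivative h' q) (at q within {0..})) \<longrightarrow>
     (\<forall>q\<ge>0. norm (h q) \<le> L * exp (- q)) \<longrightarrow> (\<forall>q\<ge>0. norm (h' q) \<le> L * exp (- q)) \<longrightarrow>
     (\<forall>x>0. norm (hankel0 h x) \<le> A * L / sqrt (1 + x))"
proof -
  obtain B0 where B0: "B0 \<ge> 0" "\<And>t. t \<ge> 0 \<Longrightarrow> norm (bser 0 (of_real t)) \<le> B0" using bser0_bound by auto
  obtain B1 where B1: "B1 \<ge> 0" "\<And>x q. x > 0 \<Longrightarrow> q \<ge> 0 \<Longrightarrow> x * sqrt x * (q * norm (bser 1 (of_real (x\<^sup>2 * q)))) \<le> B1 * (1 + q)"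
    using bser1_weighted_bound by auto
  define C where "C = integral {0..} (\<lambda>q::real. (1 + q) * exp (- q))"
  have C: "C \<ge> 0" unfolding C_def by (rule integral_nonneg[OF linear_exp_integrable]) auto
  show ?thesis
  proof (intro exI[of _ "2 * ((B0 + B1) * C)"] conjI allI impI)
    show "0 \<le> 2 * ((B0 + B1) * C)" using B0(1) B1(1) C by simp
    fix L :: real and h h' :: "real \<Rightarrow> complex" and x :: real
    assume L: "L \<ge> 0" and h': "\<forall>q\<ge>0. (h has_vector_derivative h' q) (at q within {0..})"
      and le: "\<forall>q\<ge>0. norm (h q) \<le> L * exp (- q)" and le': "\<forall>q\<ge>0. norm (h' q) \<le> L * exp (- q)" and x: "x > 0"
    let ?b0 = "\<lambda>q. bser 0 (of_real (x\<^sup>2 * q))" and ?b1 = "\<lambda>q. bser 1 (of_real (x\<^sup>2 * q))"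
    have cont: "continuous_on {0..} h"
      using h' has_vector_derivative_continuous by (fastforce simp: continuous_on_eq_continuous_within)
    have int0: "(\<lambda>q. ?b0 q * h q) integrable_on {0..}"
      by (rule bser_mult_integrable[OF cont]) (use le in auto)
    have b0: "norm (?b0 q * h q) \<le> (B0 * L) * ((1 + q) * exp (- q))" if "q \<ge> 0" for q
    proof -
      have "norm (?b0 q * h q) \<le> B0 * (L * exp (- q))"
        unfolding norm_mult using that B0(1) B0(2)[of "x\<^sup>2 * q"] le by (intro mult_mono) auto
      also have "\<dots> = (B0 * L) * (1 * exp (- q))" by simp
      also have "\<dots> \<le> (B0 * L) * ((1 + q) * exp (- q))"
        using that B0(1) L by (intro mult_left_mono mult_right_mono) auto
      finally show ?thesis .
    qed
    have b1: "q * norm (?b1 q) * exp (- q) \<le> B1 / (x * sqrt x) * ((1 + q) * exp (- q))" if "q \<ge> 0" for q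
    proof -
      have "q * norm (?b1 q) \<le> B1 * (1 + q) / (x * sqrt x)"
        using B1(2)[OF x that] x by (subst pos_le_divide_eq) (auto simp: mult_ac)
      then have "q * norm (?b1 q) * exp (- q) \<le> B1 * (1 + q) / (x * sqrt x) * exp (- q)"
        by (rule mult_right_mono) simp
      then show ?thesis by simp
    qed
    have b1': "norm (of_real q * ?b1 q * h' q) \<le> (B1 * L / (x * sqrt x)) * ((1 + q) * exp (- q))" if "q \<ge> 0" for q
    proof -
      have "norm (of_real q * ?b1 q * h' q) \<le> q * norm (?b1 q) * (L * exp (- q))"
        unfolding norm_mult norm_of_real using that le' by (intro mult_mono) auto
      also have "\<dots> = L * (q * norm (?b1 q) * exp (- q))" by simp
      also have "\<dots> \<le> L * (B1 / (x * sqrt x) * ((1 + q) * exp (- q)))"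
        by (intro mult_left_mono b1 that L)
      finally show ?thesis by (simp add: mult_ac)
    qed
    \<comment> \<open>The boundary terms disappear: at 0 by the factor q, at infinity by the decay
      of \<open>h\<close>.\<close>
    define F where "F q = of_real q * ?b1 q * h q" for q
    have F': "(F has_vector_derivative of_real q * ?b1 q * h' q + ?b0 q * h q) (at q within {0..})" if "q \<ge> 0" for q
      unfolding F_def by (intro has_vector_derivative_mult has_vector_derivative_bser1_kernel) (use h' that in auto)
    have lim: "(F \<longlongrightarrow> 0) at_top"
    proof (rule Lim_null_comparison)
      have "((\<lambda>q. B1 * L / (x * sqrt x) * ((1 + q) * exp (- q))) \<longlongrightarrow> B1 * L / (x * sqrt x) * 0) at_top"
        by (intro tendsto_mult tendsto_const) real_asymp
      then show "((\<lambda>q. B1 * L / (x * sqrt x) * ((1 + q) * exp (- q))) \<longlongrightarrow> 0) at_top" by simp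
      show "\<forall>\<^sub>F q in at_top. norm (F q) \<le> B1 * L / (x * sqrt x) * ((1 + q) * exp (- q))"
      proof (rule eventually_mono[OF eventually_ge_at_top[of 0]])
        fix q :: real assume q: "0 \<le> q"
        have "norm (F q) \<le> q * norm (?b1 q) * (L * exp (- q))"
          unfolding F_def norm_mult norm_of_real using q le by (intro mult_mono) auto
        also have "\<dots> = L * (q * norm (?b1 q) * exp (- q))" by simp
        also have "\<dots> \<le> L * (B1 / (x * sqrt x) * ((1 + q) * exp (- q)))"
          by (intro mult_left_mono b1 q L)
        finally show "norm (F q) \<le> B1 * L / (x * sqrt x) * ((1 + q) * exp (- q))" by (simp add: mult_ac)
      qed
    qed
    have tot: "((\<lambda>q. of_real q * ?b1 q * h' q + ?b0 q * h q) has_integral (0 - F 0)) {0..}"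
    proof (rule has_integral_to_infinity[OF F' _ _ lim])
      show "(\<lambda>q. (B1 * L / (x * sqrt x) + B0 * L) * ((1 + q) * exp (- q))) integrable_on {0..}"
        by (intro integrable_on_mult_right linear_exp_integrable)
      show "norm (of_real q * ?b1 q * h' q + ?b0 q * h q) \<le> (B1 * L / (x * sqrt x) + B0 * L) * ((1 + q) * exp (- q))" if "q \<ge> 0" for q
        using norm_triangle_mono[OF b1'[OF that] b0[OF that]] by (simp only: distrib_right)
    qed
    have int1: "((\<lambda>q. of_real q * ?b1 q * h' q) has_integral (0 - F 0 - integral {0..} (\<lambda>q. ?b0 q * h q))) {0..}"
      using has_integral_diff[OF tot integrable_integral[OF int0]] by simp
    have eq: "integral {0..} (\<lambda>q. ?b0 q * h q) = - integral {0..} (\<lambda>q. of_real q * ?b1 q * h' q)"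
      using integral_unique[OF int1] by (simp add: F_def)
    have n0: "norm (integral {0..} (\<lambda>q. ?b0 q * h q)) \<le> B0 * L * C"
    proof -
      have "norm (integral {0..} (\<lambda>q. ?b0 q * h q)) \<le> integral {0..} (\<lambda>q. (B0 * L) * ((1 + q) * exp (- q)))"
        by (rule integral_norm_bound_integral[OF int0 integrable_on_mult_right[OF linear_exp_integrable]]) (use b0 in simp)
      then show ?thesis by (simp add: C_def)
    qed
    have n1: "norm (integral {0..} (\<lambda>q. of_real q * ?b1 q * h' q)) \<le> B1 * L / (x * sqrt x) * C"
    proof -
      have "norm (integral {0..} (\<lambda>q. of_real q * ?b1 q * h' q)) \<le> integral {0..} (\<lambda>q. (B1 * L / (x * sqrt x)) * ((1 + q) * exp (- q)))"
        by (rule integral_norm_bound_integral[OF has_integral_integrable[OF int1] integrable_on_mult_right[OF linear_exp_integrable]])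
           (use b1' in simp)
      then show ?thesis by (simp add: C_def)
    qed
    have "norm (hankel0 h x) = x * norm (integral {0..} (\<lambda>q. ?b0 q * h q))"
      unfolding hankel0_def norm_mult using x by simp
    moreover have "x * norm (integral {0..} (\<lambda>q. ?b0 q * h q)) \<le> x * (B0 * L * C)" using n0 x by (intro mult_left_mono) auto
    moreover have "x * norm (integral {0..} (\<lambda>q. ?b0 q * h q)) \<le> x * (B1 * L / (x * sqrt x) * C)"
      unfolding eq norm_minus_cancel using n1 x by (intro mult_left_mono) auto
    ultimately have u0: "norm (hankel0 h x) \<le> x * (B0 * L * C)" and u1: "norm (hankel0 h x) \<le> B1 * L * C / sqrt x"
      using x by simp_all
    have "norm (hankel0 h x) \<le> 2 * ((B0 + B1) * C * L) / sqrt (1 + x)"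
    proof (rule inverse_sqrt_bounds[OF x])
      show "0 \<le> (B0 + B1) * C * L" using B0(1) B1(1) C L by simp
      have "B0 * L * C \<le> (B0 + B1) * C * L" using B1(1) C L by (simp add: algebra_simps)
      then have "x * (B0 * L * C) \<le> x * ((B0 + B1) * C * L)" using x by (intro mult_left_mono) auto
      then have "norm (hankel0 h x) \<le> x * ((B0 + B1) * C * L)" using u0 by (rule order_trans[rotated])
      then show "norm (hankel0 h x) \<le> (B0 + B1) * C * L * x" by (simp only: mult.commute[of x])
      have "B1 * L * C \<le> (B0 + B1) * C * L" using B0(1) C L by (simp add: algebra_simps)
      then have "B1 * L * C / sqrt x \<le> (B0 + B1) * C * L / sqrt x" using x by (intro divide_right_mono) auto
      with u1 show "norm (hankel0 h x) \<le> (B0 + B1) * C * L / sqrt x" by (rule order_trans)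
    qed
    then show "norm (hankel0 h x) \<le> 2 * ((B0 + B1) * C) * L / sqrt (1 + x)" by (simp add: mult_ac)
  qed
qed

text \<open>The weight is the product of the decay 1/(1 + x) of J^2 + Y^2 and the decay 1/sqrt(1 +
  x) of the transforms; up to a constant it is the majorant in both passages to the limit over
  x.\<close>

lemma weight_integrable: "(\<lambda>x::real. 1 / ((1 + x) * sqrt (1 + x))) integrable_on {0<..}"
proof -
  define F where "F x = - 2 / sqrt (1 + x)" for x :: real
  have F: "(F has_real_derivative 1 / ((1 + x) * sqrt (1 + x))) (at x within A)" if "x \<ge> 0" for x A
    unfolding F_def using that
    by (auto intro!: derivative_eq_intros simp: field_simps)
  have I: "((\<lambda>x. 1 / ((1 + x) * sqrt (1 + x))) has_integral (F y - F 0)) {0..y}" if "y \<ge> 0" for y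
    using that F by (intro fundamental_theorem_of_calculus) (auto simp: has_real_derivative_iff_has_vector_derivative[symmetric])
  have "((\<lambda>x. 1 / ((1 + x) * sqrt (1 + x))) has_integral (0 - F 0)) {0..}"
  proof (rule has_integral_to_inf)
    show "(\<lambda>x. 1 / ((1 + x) * sqrt (1 + x))) integrable_on {0..y}" for y :: real
      by (cases "y \<ge> 0") (use I in auto)
    have "(F \<longlongrightarrow> 0) at_top" unfolding F_def by real_asymp
    then have "((\<lambda>y. F y - F 0) \<longlongrightarrow> 0 - F 0) at_top" by (intro tendsto_intros)
    moreover have "eventually (\<lambda>y. F y - F 0 = integral {0..y} (\<lambda>x. 1 / ((1 + x) * sqrt (1 + x)))) at_top"
      by (rule eventually_mono[OF eventually_ge_at_top[of 0]]) (rule integral_unique[OF I, symmetric])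
    ultimately show "((\<lambda>y. integral {0..y} (\<lambda>x. 1 / ((1 + x) * sqrt (1 + x)))) \<longlongrightarrow> 0 - F 0) at_top"
      by (rule Lim_transform_eventually)
  qed auto
  then have "((\<lambda>x. 1 / ((1 + x) * sqrt (1 + x))) has_integral (0 - F 0)) {0<..}"
    by (rule has_integral_spike_set_eq[THEN iffD1, rotated 2])
       (auto intro: negligible_subset[of "{0}"])
  then show ?thesis by blast
qed

lemma complex_polynomial_approx:
  fixes k :: "real \<Rightarrow> complex"
  assumes k: "continuous_on {0..1} k" and e: "e > 0"
  shows "\<exists>c n. \<forall>y\<in>{0..1}. norm (k y - (\<Sum>j\<le>n. c j * of_real (y ^ j))) < e"
proof -
  obtain g where g: "polynomial_function g" "\<And>y. y \<in> {0..1} \<Longrightarrow> norm (k y - g y) < e"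
    using Stone_Weierstrass_polynomial_function[OF _ k e] by auto
  have "real_polynomial_function (Re \<circ> g)" "real_polynomial_function (Im \<circ> g)"
    using g(1) bounded_linear_Re bounded_linear_Im unfolding polynomial_function_def by blast+
  then obtain a n1 b n2 where a: "Re \<circ> g = (\<lambda>x. \<Sum>i\<le>n1. a i * x ^ i)" and b: "Im \<circ> g = (\<lambda>x. \<Sum>i\<le>n2. b i * x ^ i)"
    unfolding real_polynomial_function_iff_sum by blast
  define c where "c j = Complex (if j \<le> n1 then a j else 0) (if j \<le> n2 then b j else 0)" for j
  have "g y = (\<Sum>j\<le>max n1 n2. c j * of_real (y ^ j))" for y
  proof (rule complex_eqI)
    have "Re (g y) = (\<Sum>i\<le>n1. a i * y ^ i)" using fun_cong[OF a, of y] by simp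
    also have "\<dots> = (\<Sum>j\<le>max n1 n2. (if j \<le> n1 then a j else 0) * y ^ j)"
      by (intro sum.mono_neutral_cong_left) auto
    finally show "Re (g y) = Re (\<Sum>j\<le>max n1 n2. c j * of_real (y ^ j))"
      unfolding Re_sum c_def by (simp del: of_real_power)
    have "Im (g y) = (\<Sum>i\<le>n2. b i * y ^ i)" using fun_cong[OF b, of y] by simp
    also have "\<dots> = (\<Sum>j\<le>max n1 n2. (if j \<le> n2 then b j else 0) * y ^ j)"
      by (intro sum.mono_neutral_cong_left) auto
    finally show "Im (g y) = Im (\<Sum>j\<le>max n1 n2. c j * of_real (y ^ j))"
      unfolding Im_sum c_def by (simp del: of_real_power)
  qed
  with g(2) show ?thesis by (intro exI[of _ c] exI[of _ "max n1 n2"]) simp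
qed

lemma hankel0_tendsto:
  assumes c: "\<And>N. continuous_on {0..} (hs N)"
    and le: "\<And>N q. q \<ge> 0 \<Longrightarrow> norm (hs N q) \<le> L * exp (- q)"
    and lim: "\<And>q. q \<ge> 0 \<Longrightarrow> (\<lambda>N. hs N q) \<longlonglongrightarrow> h q"
  shows "(\<lambda>N. hankel0 (hs N) x) \<longlonglongrightarrow> hankel0 h x"
proof -
  obtain B where B: "B \<ge> 0" "\<And>t. t \<ge> 0 \<Longrightarrow> norm (bser 0 (of_real t)) \<le> B" using bser0_bound by auto
  show ?thesis
    unfolding hankel0_def
  proof (rule tendsto_mult[OF tendsto_const], rule dominated_convergence(2)[where h = "\<lambda>q. B * (L * exp (- 1 * q))"])
  show "(\<lambda>q. bser 0 (of_real (x\<^sup>2 * q)) * hs N q) integrable_on {0..}" for N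
    by (rule bser_mult_integrable[OF c le])
  show "(\<lambda>q. B * (L * exp (- 1 * q))) integrable_on {0..}"
    using exp_has_integral[of 1] by (intro integrable_on_mult_right) (auto simp: has_integral_iff)
  show "norm (bser 0 (of_real (x\<^sup>2 * q)) * hs N q) \<le> B * (L * exp (- 1 * q))" if "q \<in> {0..}" for N q
    unfolding norm_mult using that B(1) B(2)[of "x\<^sup>2 * q"] le[of q N] by (intro mult_mono) auto
  show "(\<lambda>N. bser 0 (of_real (x\<^sup>2 * q)) * hs N q) \<longlonglongrightarrow> bser 0 (of_real (x\<^sup>2 * q)) * h q" if "q \<in> {0..}" for q
    using lim[of q] that by (intro tendsto_intros) auto
  qed
qed

text \<open>Every test function obtained by integrating a continuous function of $e^{-q}$ is a limit of
  exponential sums, with the uniform bounds needed to pass to the limit under both integrals. Hence a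
  functional is determined by its values on exponentials.\<close>
lemma hankel0_pairing:
  fixes \<Lambda> :: "(real \<Rightarrow> complex) \<Rightarrow> complex" and M :: "real \<Rightarrow> complex"
  assumes M: "K \<ge> 0" "\<And>x. x > 0 \<Longrightarrow> norm (M x) \<le> K / (1 + x)"
    and moment: "\<And>i::nat. ((\<lambda>x. of_real (x / real (Suc i) * exp (- x\<^sup>2 / real (Suc i))) * M x) has_integral
        \<Lambda> (\<lambda>q. of_real (exp (- real (Suc i) * q)))) {0<..}"
    and lin: "\<And>c n. \<Lambda> (\<lambda>q. \<Sum>j\<le>n. c j * of_real (exp (- real (Suc j) * q))) =
        (\<Sum>j\<le>n. c j * \<Lambda> (\<lambda>q. of_real (exp (- real (Suc j) * q))))"
    and cont: "\<And>hs h L. (\<And>N. continuous_on {0..} (hs N)) \<Longrightarrow> (\<And>N q. q \<ge> 0 \<Longrightarrow> norm (hs N q) \<le> L * exp (- q)) \<Longrightarrow>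
        (\<And>q. q \<ge> 0 \<Longrightarrow> (\<lambda>N. hs N q) \<longlonglongrightarrow> h q) \<Longrightarrow> (\<lambda>N. \<Lambda> (hs N)) \<longlonglongrightarrow> \<Lambda> h"
    and k: "continuous_on {0..1} k"
  defines "h \<equiv> \<lambda>q. integral {0..exp (- q)} k"
  shows "((\<lambda>x. hankel0 h x * M x) has_integral \<Lambda> h) {0<..}"
proof -
  have "compact (k ` {0..1})" using k by (intro compact_continuous_image) auto
  then obtain Kk0 where "\<forall>y\<in>k ` {0..1}. norm y \<le> Kk0" using compact_imp_bounded bounded_iff by metis
  then have Kk0: "norm (k y) \<le> Kk0" if "y \<in> {0..1}" for y using that by auto
  have Kk0n: "Kk0 \<ge> 0" using order_trans[OF norm_ge_zero Kk0[of 0]] by simp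
  \<comment> \<open>The polynomials chosen next stay within distance 1 of \<open>k\<close>, so this
    constant bounds all of them.\<close>
  define L where "L = Kk0 + 1"
  \<comment> \<open>Fitting the density \<open>k\<close> and not \<open>h\<close> bounds the
    resulting exponential sums and their derivatives alike by L e^{-q}, as
    \<open>hankel0_bound\<close> demands.\<close>
  have "\<forall>N. \<exists>c n. \<forall>y\<in>{0..1}. norm (k y - (\<Sum>j\<le>n. c j * of_real (y ^ j))) < 1 / real (Suc N)"
    using complex_polynomial_approx[OF k] by simp
  then obtain c n where cn: "\<And>N y. y \<in> {0..1} \<Longrightarrow> norm (k y - (\<Sum>j\<le>n N. c N j * of_real (y ^ j))) < 1 / real (Suc N)"
    by (metis (no_types))
  define p where "p N y = (\<Sum>j\<le>n N. c N j * of_real (y ^ j))" for N y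
  \<comment> \<open>Integrating y^j from 0 to e^{-q} gives e^{-(j+1)q}/(j+1). The exponents start at
    1, so every summand decays.\<close>
  define hs where "hs N q = (\<Sum>j\<le>n N. c N j / of_nat (Suc j) * of_real (exp (- real (Suc j) * q)))" for N q
  have p_le: "norm (p N y) \<le> L" if "y \<in> {0..1}" for N y
  proof -
    have "norm (p N y) \<le> norm (k y) + norm (k y - p N y)" by (metis norm_minus_commute norm_triangle_sub)
    also have "norm (k y - p N y) \<le> 1 / real (Suc N)" unfolding p_def using cn[OF that, of N] by simp
    also have "1 / real (Suc N) \<le> 1" by simp
    finally show ?thesis using Kk0[OF that] by (simp add: L_def)
  qed
  have epow: "exp (- real (Suc j) * q) = exp (- q) ^ Suc j" for j and q :: real
    by (simp only: exp_of_nat_mult[symmetric] mult_minus_left mult_minus_right)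
  have hs_int: "((\<lambda>y. p N y) has_integral hs N q) {0..exp (- q)}" for N q
  proof -
    have "((\<lambda>y. c N j * of_real (y ^ j)) has_integral c N j / of_nat (Suc j) * of_real (exp (- real (Suc j) * q))) {0..exp (- q)}" for j
    proof -
      have "((\<lambda>y. complex_of_real (y ^ Suc j) / of_nat (Suc j)) has_vector_derivative of_real (y ^ j)) (at y within {0..exp (- q)})" for y
      proof -
        have "((\<lambda>y. y ^ Suc j / real (Suc j)) has_real_derivative y ^ j) (at y within {0..exp (- q)})"
          by (rule DERIV_cong[OF DERIV_cdivide[OF DERIV_power[OF DERIV_ident]]]) (simp del: of_nat_Suc)
        from has_vector_derivative_of_real[OF this, where ?'a = complex] show ?thesis by (simp del: power_Suc of_nat_Suc)
      qed
      then have "((\<lambda>y. complex_of_real (y ^ j)) has_integral (of_real (exp (- q) ^ Suc j) / of_nat (Suc j) - of_real (0 ^ Suc j) / of_nat (Suc j))) {0..exp (- q)}"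
        by (intro fundamental_theorem_of_calculus) auto
      from has_integral_mult_right[OF this, of "c N j"] show ?thesis unfolding epow by simp
    qed
    then show ?thesis unfolding p_def hs_def by (intro has_integral_sum) auto
  qed
  have e01: "y \<in> {0..1}" if "y \<in> {0..exp (- q)}" "q \<ge> 0" for y q :: real
  proof -
    have "exp (- q) \<le> 1" using that(2) by simp
    then have "y \<le> 1" using that(1) by (meson atLeastAtMost_iff order_trans)
    with that(1) show ?thesis by simp
  qed
  have k_int: "k integrable_on {0..exp (- q)}" if "q \<ge> 0" for q
    by (intro integrable_continuous_interval continuous_on_subset[OF k] subsetI e01[OF _ that])
  have hs_le: "norm (hs N q) \<le> L * exp (- q)" if "q \<ge> 0" for N q
  proof -
    have "norm (hs N q) \<le> L * measure lborel {0..exp (- q)}"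
      by (rule has_integral_bound_real[OF _ _ hs_int]) (use p_le e01[OF _ that] Kk0n in \<open>auto simp: L_def\<close>)
    then show ?thesis by simp
  qed
  have hs_lim: "(\<lambda>N. hs N q) \<longlonglongrightarrow> h q" if "q \<ge> 0" for q
  proof -
    have "((\<lambda>N. hs N q - h q) \<longlonglongrightarrow> 0)"
    proof (rule Lim_null_comparison)
      show "(\<lambda>N. 1 / real (Suc N) * exp (- q)) \<longlonglongrightarrow> 0"
        using tendsto_mult_left_zero[OF LIMSEQ_inverse_real_of_nat, of "exp (- q)"] by (simp add: divide_inverse)
      show "\<forall>\<^sub>F N in sequentially. norm (hs N q - h q) \<le> 1 / real (Suc N) * exp (- q)"
      proof (rule always_eventually, rule allI)
        fix N
        have "((\<lambda>y. p N y - k y) has_integral (hs N q - h q)) {0..exp (- q)}"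
          unfolding h_def by (intro has_integral_diff hs_int integrable_integral k_int that)
        moreover have "norm (p N y - k y) \<le> 1 / real (Suc N)" if "y \<in> {0..exp (- q)}" for y
          using cn[of y N] e01[OF that \<open>q \<ge> 0\<close>] unfolding p_def[symmetric] by (simp add: norm_minus_commute)
        ultimately have "norm (hs N q - h q) \<le> 1 / real (Suc N) * measure lborel {0..exp (- q)}"
          by (intro has_integral_bound_real[of _ "{}"]) auto
        then show "norm (hs N q - h q) \<le> 1 / real (Suc N) * exp (- q)" by simp
      qed
    qed
    then show ?thesis by (rule LIM_zero_cancel)
  qed
  have hs': "(hs N has_vector_derivative - of_real (exp (- q)) * p N (exp (- q))) (at q within A)" for N q A
  proof -
    have "((\<lambda>q. c N j / of_nat (Suc j) * of_real (exp (- real (Suc j) * q))) has_vector_derivative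
        c N j / of_nat (Suc j) * of_real (exp (- real (Suc j) * q) * (- real (Suc j)))) (at q within A)" for j
      by (intro has_vector_derivative_mult_right has_vector_derivative_of_real) (auto intro!: derivative_eq_intros)
    then have "(hs N has_vector_derivative (\<Sum>j\<le>n N. c N j / of_nat (Suc j) * of_real (exp (- real (Suc j) * q) * (- real (Suc j))))) (at q within A)"
      unfolding hs_def by (intro has_vector_derivative_sum)
    also have "(\<Sum>j\<le>n N. c N j / of_nat (Suc j) * of_real (exp (- real (Suc j) * q) * (- real (Suc j)))) = - of_real (exp (- q)) * p N (exp (- q))"
      unfolding p_def sum_distrib_left
    proof (rule sum.cong[OF refl])
      fix j
      have "c N j / of_nat (Suc j) * of_real (exp (- real (Suc j) * q) * (- real (Suc j))) = - (c N j * of_real (exp (- real (Suc j) * q)))"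
        by (simp del: of_nat_Suc)
      then show "c N j / of_nat (Suc j) * of_real (exp (- real (Suc j) * q) * (- real (Suc j))) = - of_real (exp (- q)) * (c N j * of_real (exp (- q) ^ j))"
        unfolding epow by (simp add: mult_ac)
    qed
    finally show ?thesis .
  qed
  have hs'_le: "norm (- of_real (exp (- q)) * p N (exp (- q))) \<le> L * exp (- q)" if "q \<ge> 0" for N q
  proof -
    have "norm (p N (exp (- q))) * exp (- q) \<le> L * exp (- q)"
      using that by (intro mult_right_mono p_le) auto
    then show ?thesis by (simp add: norm_mult mult.commute)
  qed
  have hs_cont: "continuous_on {0..} (hs N)" for N
    unfolding hs_def by (intro continuous_intros)
  obtain A where A: "A \<ge> 0" and A': "\<forall>L h h'. L \<ge> 0 \<longrightarrow> (\<forall>q\<ge>0. (h has_vector_derivative h' q) (at q within {0..})) \<longrightarrow>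
     (\<forall>q\<ge>0. norm (h q) \<le> L * exp (- q)) \<longrightarrow> (\<forall>q\<ge>0. norm (h' q) \<le> L * exp (- q)) \<longrightarrow>
     (\<forall>x>0. norm (hankel0 h x) \<le> A * L / sqrt (1 + x))"
    using hankel0_bound by (elim exE conjE)
  have H_le: "norm (hankel0 (hs N) x) \<le> A * L / sqrt (1 + x)" if "x > 0" for N x
    by (rule A'[rule_format, of L "hs N" "\<lambda>q. - of_real (exp (- q)) * p N (exp (- q))" x])
       (use hs_le hs' hs'_le Kk0n that in \<open>auto simp: L_def\<close>)
  have H_eq: "hankel0 (hs N) x = (\<Sum>j\<le>n N. c N j / of_nat (Suc j) * of_real (x / real (Suc j) * exp (- x\<^sup>2 / real (Suc j))))" for N x
  proof -
    have "((\<lambda>q. \<Sum>j\<le>n N. c N j / of_nat (Suc j) * (bser 0 (of_real (x\<^sup>2 * q)) * of_real (exp (- real (Suc j) * q)))) has_integral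
       (\<Sum>j\<le>n N. c N j / of_nat (Suc j) * of_real (exp (- x\<^sup>2 / real (Suc j)) / real (Suc j)))) {0..}"
      by (intro has_integral_sum has_integral_mult_right gaussian_hankel0) auto
    moreover have "(\<Sum>j\<le>n N. c N j / of_nat (Suc j) * (bser 0 (of_real (x\<^sup>2 * q)) * of_real (exp (- real (Suc j) * q)))) =
        bser 0 (of_real (x\<^sup>2 * q)) * hs N q" for q
      unfolding hs_def sum_distrib_left by (simp only: mult_ac)
    ultimately have "integral {0..} (\<lambda>q. bser 0 (of_real (x\<^sup>2 * q)) * hs N q) =
        (\<Sum>j\<le>n N. c N j / of_nat (Suc j) * of_real (exp (- x\<^sup>2 / real (Suc j)) / real (Suc j)))"
      by (simp only: integral_unique)
    then show ?thesis unfolding hankel0_def by (simp add: sum_distrib_left mult_ac del: of_nat_Suc)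
  qed
  have I: "((\<lambda>x. hankel0 (hs N) x * M x) has_integral \<Lambda> (hs N)) {0<..}" for N
  proof -
    have "((\<lambda>x. \<Sum>j\<le>n N. c N j / of_nat (Suc j) * (of_real (x / real (Suc j) * exp (- x\<^sup>2 / real (Suc j))) * M x)) has_integral
       (\<Sum>j\<le>n N. c N j / of_nat (Suc j) * \<Lambda> (\<lambda>q. of_real (exp (- real (Suc j) * q))))) {0<..}"
      by (intro has_integral_sum has_integral_mult_right moment) auto
    moreover have "(\<Sum>j\<le>n N. c N j / of_nat (Suc j) * (of_real (x / real (Suc j) * exp (- x\<^sup>2 / real (Suc j))) * M x)) = hankel0 (hs N) x * M x" for x
      unfolding H_eq sum_distrib_right by (simp only: mult.assoc)
    moreover have "(\<Sum>j\<le>n N. c N j / of_nat (Suc j) * \<Lambda> (\<lambda>q. of_real (exp (- real (Suc j) * q)))) = \<Lambda> (hs N)"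
      unfolding lin[symmetric] hs_def[abs_def] ..
    ultimately show ?thesis by simp
  qed
  have D: "(\<lambda>x. A * L * K * (1 / ((1 + x) * sqrt (1 + x)))) integrable_on {0<..}"
    by (intro integrable_on_mult_right weight_integrable)
  have le: "norm (hankel0 (hs N) x * M x) \<le> A * L * K * (1 / ((1 + x) * sqrt (1 + x)))" if "x \<in> {0<..}" for N x
  proof -
    have "norm (hankel0 (hs N) x * M x) \<le> A * L / sqrt (1 + x) * (K / (1 + x))"
      unfolding norm_mult using that H_le M A Kk0n by (intro mult_mono) (auto simp: L_def)
    then show ?thesis by (simp add: mult_ac)
  qed
  have lim: "(\<lambda>N. hankel0 (hs N) x * M x) \<longlonglongrightarrow> hankel0 h x * M x" for x
    by (intro tendsto_intros hankel0_tendsto[OF hs_cont hs_le hs_lim])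
  note dc = dominated_convergence[OF has_integral_integrable[OF I] D le lim]
  have "(\<lambda>N. \<Lambda> (hs N)) \<longlonglongrightarrow> \<Lambda> h" by (rule cont[OF hs_cont hs_le hs_lim])
  then have "integral {0<..} (\<lambda>x. hankel0 h x * M x) = \<Lambda> h"
    using dc(2) unfolding integral_unique[OF I] by (rule LIMSEQ_unique[rotated])
  with dc(1) show ?thesis by (simp add: has_integral_iff)
qed

section \<open>Test functions pulled back along a curve in q\<close>

lemma continuous_bounded_imp_integrable:
  fixes f :: "real \<Rightarrow> 'a :: euclidean_space"
  assumes "continuous_on S f" "S \<in> sets lebesgue" "g integrable_on S" "\<And>s. s \<in> S \<Longrightarrow> norm (f s) \<le> g s"
  shows "f integrable_on S"
  by (rule measurable_bounded_by_integrable_imp_integrable[OF continuous_imp_measurable_on_sets_lebesgue])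
     (use assms in auto)

lemma weighted_pullback_integrable:
  assumes S: "S \<in> sets lebesgue" and \<rho>: "continuous_on S \<rho>" "\<And>s. s \<in> S \<Longrightarrow> \<rho> s \<ge> 0"
    and \<gamma>: "continuous_on S \<gamma>" "\<And>s. s \<in> S \<Longrightarrow> norm (\<gamma> s) \<le> C" and e: "(\<lambda>s. exp (- \<rho> s)) integrable_on S"
    and h: "continuous_on {0..} h" "\<And>q. q \<ge> 0 \<Longrightarrow> norm (h q) \<le> L * exp (- q)"
  shows "(\<lambda>s::real. h (\<rho> s) * \<gamma> s :: complex) integrable_on S"
proof (rule continuous_bounded_imp_integrable[OF _ S])
  show "continuous_on S (\<lambda>s. h (\<rho> s) * \<gamma> s)"
    by (intro continuous_on_mult \<gamma> continuous_on_compose2[OF h(1) \<rho>(1)]) (use \<rho>(2) in auto)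
  show "(\<lambda>s. L * C * exp (- \<rho> s)) integrable_on S" by (intro integrable_on_mult_right e)
  fix s assume s: "s \<in> S"
  then have "norm (h (\<rho> s) * \<gamma> s) \<le> L * exp (- \<rho> s) * C"
    unfolding norm_mult using h(2)[OF \<rho>(2)[OF s]] \<gamma>(2)[OF s] order_trans[OF norm_ge_zero h(2)[OF \<rho>(2)[OF s]]]
    by (intro mult_mono) auto
  then show "norm (h (\<rho> s) * \<gamma> s) \<le> L * C * exp (- \<rho> s)" by (simp add: mult_ac)
qed

text \<open>The common shape of the three integrals in \<open>bessel_functional\<close>, with \<rho>
  equal to (1 - cos A)/2, (1 + cos A)/2 or cosh^2 u. In each case e^{-\<rho>} is integrable and
  gives the majorant.\<close>

lemma weighted_pullback_tendsto:
  assumes S: "S \<in> sets lebesgue" and \<rho>: "continuous_on S \<rho>" "\<And>s. s \<in> S \<Longrightarrow> \<rho> s \<ge> 0"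
    and \<gamma>: "continuous_on S \<gamma>" "\<And>s. s \<in> S \<Longrightarrow> norm (\<gamma> s) \<le> C" and e: "(\<lambda>s. exp (- \<rho> s)) integrable_on S"
    and hs: "\<And>N. continuous_on {0..} (hs N)" "\<And>N q. q \<ge> 0 \<Longrightarrow> norm (hs N q) \<le> L * exp (- q)"
      "\<And>q. q \<ge> 0 \<Longrightarrow> (\<lambda>N. hs N q) \<longlonglongrightarrow> h q"
  shows "(\<lambda>N. integral S (\<lambda>s::real. hs N (\<rho> s) * \<gamma> s :: complex)) \<longlonglongrightarrow> integral S (\<lambda>s. h (\<rho> s) * \<gamma> s)"
proof (rule dominated_convergence(2))
  show "(\<lambda>s. hs N (\<rho> s) * \<gamma> s) integrable_on S" for N
    by (rule weighted_pullback_integrable[OF S \<rho> \<gamma> e hs(1) hs(2)])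
  show "(\<lambda>s. L * C * exp (- \<rho> s)) integrable_on S" by (intro integrable_on_mult_right e)
  fix s assume s: "s \<in> S"
  show "norm (hs N (\<rho> s) * \<gamma> s) \<le> L * C * exp (- \<rho> s)" for N
  proof -
    have "norm (hs N (\<rho> s) * \<gamma> s) \<le> L * exp (- \<rho> s) * C"
      unfolding norm_mult using hs(2)[OF \<rho>(2)[OF s]] \<gamma>(2)[OF s] order_trans[OF norm_ge_zero hs(2)[OF \<rho>(2)[OF s]]]
      by (intro mult_mono) auto
    then show ?thesis by (simp add: mult_ac)
  qed
  show "(\<lambda>N. hs N (\<rho> s) * \<gamma> s) \<longlonglongrightarrow> h (\<rho> s) * \<gamma> s"
    by (intro tendsto_mult tendsto_const hs(3) \<rho>(2) s)
qed

lemma compact_interval_norm_bound: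
  fixes f :: "real \<Rightarrow> complex"
  assumes "continuous_on {a..b} f"
  shows "\<exists>C\<ge>0. \<forall>s\<in>{a..b}. norm (f s) \<le> C"
proof -
  have "compact (f ` {a..b})" by (intro compact_continuous_image assms) auto
  then obtain C where C: "\<forall>y\<in>f ` {a..b}. norm y \<le> C" using compact_imp_bounded bounded_iff by metis
  then show ?thesis by (intro exI[of _ "max C 0"]) (auto simp: le_max_iff_disj)
qed

text \<open>The last summand is the part of the Hankel transform of $J^2+Y^2$ beyond the singularity at $q = 1$;
  the first two summands live on $q \<le> 1$, where the test functions of interest vanish.\<close>
definition bessel_functional :: "real \<Rightarrow> (real \<Rightarrow> complex) \<Rightarrow> (real \<Rightarrow> complex) \<Rightarrow> (real \<Rightarrow> complex) \<Rightarrow> complex" where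
  "bessel_functional \<mu> \<gamma>1 \<gamma>2 h =
     integral {-pi..pi} (\<lambda>A. h ((1 - cos A) / 2) * \<gamma>1 A) + integral {-pi..pi} (\<lambda>A. h ((1 + cos A) / 2) * \<gamma>2 A)
     + integral {0..} (\<lambda>u. h ((cosh u)\<^sup>2) * of_real (2 * sin (2 * \<mu> * u) / (pi * sinh (\<mu> * pi))))"

text \<open>\<open>hankel0_pairing\<close> for the functional whose values on exponentials are the
  moments of \<open>bessel_moment\<close>. One pair of weights, depending on \<mu> alone, serves all
  densities \<open>k\<close>.\<close>

lemma bessel_pairing:
  assumes \<mu>: "\<mu> \<noteq> 0"
  defines "\<nu> \<equiv> \<i> * complex_of_real \<mu>"
  shows "\<exists>\<gamma>1 \<gamma>2. \<forall>k. continuous_on {0..1} k \<longrightarrow>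
    ((\<lambda>x. hankel0 (\<lambda>q. integral {0..exp (- q)} k) x * ((besselJ \<nu> x)\<^sup>2 + (besselY \<nu> x)\<^sup>2)) has_integral
       bessel_functional \<mu> \<gamma>1 \<gamma>2 (\<lambda>q. integral {0..exp (- q)} k)) {0<..}"
proof -
  define s where "s = sin (\<nu> * of_real pi)"
  define \<gamma>1 where "\<gamma>1 A = (exp (- (\<i> * \<nu> * of_real A)) + exp (\<i> * \<nu> * of_real A)) / (4 * of_real pi * s\<^sup>2)" for A
  define \<gamma>2 where "\<gamma>2 A = - cos (\<nu> * of_real pi) / (2 * of_real pi * s\<^sup>2) * exp (- (\<i> * \<nu> * of_real A))" for A
  define \<gamma>3 where "\<gamma>3 u = complex_of_real (2 * sin (2 * \<mu> * u) / (pi * sinh (\<mu> * pi)))" for u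
  define P1 where "P1 h = integral {-pi..pi} (\<lambda>A. h ((1 - cos A) / 2) * \<gamma>1 A)" for h
  define P2 where "P2 h = integral {-pi..pi} (\<lambda>A. h ((1 + cos A) / 2) * \<gamma>2 A)" for h
  define P3 where "P3 h = integral {0..} (\<lambda>u. h ((cosh u)\<^sup>2) * \<gamma>3 u)" for h
  have \<Lambda>: "bessel_functional \<mu> \<gamma>1 \<gamma>2 = (\<lambda>h. P1 h + P2 h + P3 h)"
    by (simp add: fun_eq_iff bessel_functional_def P1_def P2_def P3_def \<gamma>3_def)
  have c1: "continuous_on {-pi..pi} \<gamma>1" unfolding \<gamma>1_def divide_inverse by (intro continuous_intros)
  have c2: "continuous_on {-pi..pi} \<gamma>2" unfolding \<gamma>2_def by (intro continuous_intros)
  have sh: "sinh (\<mu> * pi) \<noteq> 0" using \<mu> by simp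
  have c3: "continuous_on {0..} \<gamma>3" unfolding \<gamma>3_def using sh by (intro continuous_intros) auto
  obtain C1 where "\<forall>A\<in>{-pi..pi}. norm (\<gamma>1 A) \<le> C1" using compact_interval_norm_bound[OF c1] by auto
  note C1 = bspec[OF this]
  obtain C2 where "\<forall>A\<in>{-pi..pi}. norm (\<gamma>2 A) \<le> C2" using compact_interval_norm_bound[OF c2] by auto
  note C2 = bspec[OF this]
  have C3: "norm (\<gamma>3 u) \<le> 2 / (pi * \<bar>sinh (\<mu> * pi)\<bar>)" for u
    unfolding \<gamma>3_def norm_of_real using sh by (simp add: abs_mult divide_simps)
  have e1: "(\<lambda>A. exp (- ((1 - cos A) / 2))) integrable_on {-pi..pi}" and e2: "(\<lambda>A. exp (- ((1 + cos A) / 2))) integrable_on {-pi..pi}"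
    by (intro integrable_continuous_interval continuous_intros; simp)+
  have r1: "continuous_on {-pi..pi} (\<lambda>A. (1 - cos A) / 2)" "\<And>A. A \<in> {-pi..pi} \<Longrightarrow> (1 - cos A) / 2 \<ge> (0::real)"
    and r2: "continuous_on {-pi..pi} (\<lambda>A. (1 + cos A) / 2)" "\<And>A. A \<in> {-pi..pi} \<Longrightarrow> (1 + cos A) / 2 \<ge> (0::real)"
    and r3: "continuous_on {0..} (\<lambda>u::real. (cosh u)\<^sup>2)" "\<And>u::real. u \<in> {0..} \<Longrightarrow> (cosh u)\<^sup>2 \<ge> 0"
    using cos_ge_minus_one by (auto intro!: continuous_intros simp: add_nonneg_nonneg) (smt (verit) cos_ge_minus_one)+
  have S: "{-pi..pi} \<in> sets lebesgue" "{0::real..} \<in> sets lebesgue" by auto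
  have i1: "(\<lambda>A. h ((1 - cos A) / 2) * \<gamma>1 A) integrable_on {-pi..pi}"
    if "continuous_on {0..} h" "\<And>q. q \<ge> 0 \<Longrightarrow> norm (h q) \<le> L * exp (- q)" for h L
    by (rule weighted_pullback_integrable[OF S(1) r1(1) _ c1 _ e1 that(1)]; (rule that(2) r1(2) C1)?; assumption?)
  have t1: "(\<lambda>N. integral {-pi..pi} (\<lambda>A. hs N ((1 - cos A) / 2) * \<gamma>1 A)) \<longlonglongrightarrow> integral {-pi..pi} (\<lambda>A. h ((1 - cos A) / 2) * \<gamma>1 A)"
    if "\<And>N. continuous_on {0..} (hs N)" "\<And>N q. q \<ge> 0 \<Longrightarrow> norm (hs N q) \<le> L * exp (- q)"
      "\<And>q. q \<ge> 0 \<Longrightarrow> (\<lambda>N. hs N q) \<longlonglongrightarrow> h q" for hs h L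
    by (rule weighted_pullback_tendsto[OF S(1) r1(1) _ c1 _ e1 that(1)]; (rule that(2,3) r1(2) C1)?; assumption?)
  have i2: "(\<lambda>A. h ((1 + cos A) / 2) * \<gamma>2 A) integrable_on {-pi..pi}"
    if "continuous_on {0..} h" "\<And>q. q \<ge> 0 \<Longrightarrow> norm (h q) \<le> L * exp (- q)" for h L
    by (rule weighted_pullback_integrable[OF S(1) r2(1) _ c2 _ e2 that(1)]; (rule that(2) r2(2) C2)?; assumption?)
  have t2: "(\<lambda>N. integral {-pi..pi} (\<lambda>A. hs N ((1 + cos A) / 2) * \<gamma>2 A)) \<longlonglongrightarrow> integral {-pi..pi} (\<lambda>A. h ((1 + cos A) / 2) * \<gamma>2 A)"
    if "\<And>N. continuous_on {0..} (hs N)" "\<And>N q. q \<ge> 0 \<Longrightarrow> norm (hs N q) \<le> L * exp (- q)"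
      "\<And>q. q \<ge> 0 \<Longrightarrow> (\<lambda>N. hs N q) \<longlonglongrightarrow> h q" for hs h L
    by (rule weighted_pullback_tendsto[OF S(1) r2(1) _ c2 _ e2 that(1)]; (rule that(2,3) r2(2) C2)?; assumption?)
  have i3: "(\<lambda>A. h ((cosh A)\<^sup>2) * \<gamma>3 A) integrable_on {0..}"
    if "continuous_on {0..} h" "\<And>q. q \<ge> 0 \<Longrightarrow> norm (h q) \<le> L * exp (- q)" for h L
    by (rule weighted_pullback_integrable[OF S(2) r3(1) _ c3 _ exp_cosh_integrable that(1)]; (rule that(2) r3(2) C3)?; assumption?)
  have t3: "(\<lambda>N. integral {0..} (\<lambda>A. hs N ((cosh A)\<^sup>2) * \<gamma>3 A)) \<longlonglongrightarrow> integral {0..} (\<lambda>A. h ((cosh A)\<^sup>2) * \<gamma>3 A)"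
    if "\<And>N. continuous_on {0..} (hs N)" "\<And>N q. q \<ge> 0 \<Longrightarrow> norm (hs N q) \<le> L * exp (- q)"
      "\<And>q. q \<ge> 0 \<Longrightarrow> (\<lambda>N. hs N q) \<longlonglongrightarrow> h q" for hs h L
    by (rule weighted_pullback_tendsto[OF S(2) r3(1) _ c3 _ exp_cosh_integrable that(1)]; (rule that(2,3) r3(2) C3)?; assumption?)
  obtain K where K: "K \<ge> 0" "\<And>x. x > 0 \<Longrightarrow> norm ((besselJ \<nu> x)\<^sup>2 + (besselY \<nu> x)\<^sup>2) \<le> K / (1 + x)"
    using bessel_square_sum_bound[OF \<mu>] unfolding \<nu>_def by auto
  define E where "E j q = complex_of_real (exp (- real (Suc j) * q))" for j q
  have E: "continuous_on {0..} (E j)" "\<And>q. q \<ge> 0 \<Longrightarrow> norm (E j q) \<le> 1 * exp (- q)" for j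
  proof -
    show "continuous_on {0..} (E j)" unfolding E_def by (intro continuous_intros)
    show "norm (E j q) \<le> 1 * exp (- q)" if "q \<ge> 0" for q
    proof -
      have "1 * q \<le> real (Suc j) * q" using that by (intro mult_right_mono) auto
      then show ?thesis by (simp add: E_def del: of_nat_Suc)
    qed
  qed
  have linP: "integral T (\<lambda>t. (\<Sum>j\<le>n. c j * E j (\<rho> t)) * \<gamma> t) = (\<Sum>j\<le>n. c j * integral T (\<lambda>t. E j (\<rho> t) * \<gamma> t))"
    if "\<And>j. (\<lambda>t. E j (\<rho> t) * \<gamma> t) integrable_on T" for T :: "real set" and \<rho> \<gamma> c n
  proof -
    have "((\<lambda>t. \<Sum>j\<le>n. c j * (E j (\<rho> t) * \<gamma> t)) has_integral (\<Sum>j\<le>n. c j * integral T (\<lambda>t. E j (\<rho> t) * \<gamma> t))) T"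
      by (intro has_integral_sum has_integral_mult_right integrable_integral that) auto
    then show ?thesis by (simp add: integral_unique sum_distrib_right mult.assoc)
  qed
  have "((\<lambda>x. hankel0 (\<lambda>q. integral {0..exp (- q)} k) x * ((besselJ \<nu> x)\<^sup>2 + (besselY \<nu> x)\<^sup>2)) has_integral
       bessel_functional \<mu> \<gamma>1 \<gamma>2 (\<lambda>q. integral {0..exp (- q)} k)) {0<..}" if k: "continuous_on {0..1} k" for k
  proof (rule hankel0_pairing[OF K _ _ _ k])
    fix i :: nat
    show "((\<lambda>x. of_real (x / real (Suc i) * exp (- x\<^sup>2 / real (Suc i))) * ((besselJ \<nu> x)\<^sup>2 + (besselY \<nu> x)\<^sup>2)) has_integral
        bessel_functional \<mu> \<gamma>1 \<gamma>2 (\<lambda>q. of_real (exp (- real (Suc i) * q)))) {0<..}"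
      unfolding bessel_functional_def \<gamma>1_def \<gamma>2_def s_def \<nu>_def by (rule bessel_moment[OF \<mu>]) simp
  next
    fix c :: "nat \<Rightarrow> complex" and n
    show "bessel_functional \<mu> \<gamma>1 \<gamma>2 (\<lambda>q. \<Sum>j\<le>n. c j * of_real (exp (- real (Suc j) * q))) =
        (\<Sum>j\<le>n. c j * bessel_functional \<mu> \<gamma>1 \<gamma>2 (\<lambda>q. of_real (exp (- real (Suc j) * q))))"
      unfolding E_def[symmetric] \<Lambda> P1_def P2_def P3_def
      by (simp only: linP[OF i1[OF E]] linP[OF i2[OF E]] linP[OF i3[OF E]] sum.distrib[symmetric] distrib_left[symmetric])
  next
    fix hs :: "nat \<Rightarrow> real \<Rightarrow> complex" and h L
    assume hs: "\<And>N. continuous_on {0..} (hs N)" "\<And>N q. q \<ge> 0 \<Longrightarrow> norm (hs N q) \<le> L * exp (- q)"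
        "\<And>q. q \<ge> 0 \<Longrightarrow> (\<lambda>N. hs N q) \<longlonglongrightarrow> h q"
    show "(\<lambda>N. bessel_functional \<mu> \<gamma>1 \<gamma>2 (hs N)) \<longlonglongrightarrow> bessel_functional \<mu> \<gamma>1 \<gamma>2 h"
      unfolding \<Lambda> P1_def P2_def P3_def by (intro tendsto_add t1[OF hs] t2[OF hs] t3[OF hs])
  qed
  then show ?thesis by blast
qed

subsection \<open>Pairing with Lipschitz densities\<close>

text \<open>What \<open>hankel0\<close> becomes under q = cosh^2 u, dq = sinh 2u du: the kernel is
  J_0(2x cosh u), and the range of u covers only q at least 1.\<close>

definition cosh_transform :: "real \<Rightarrow> (real \<Rightarrow> complex) \<Rightarrow> real \<Rightarrow> complex" where
  "cosh_transform U g x = of_real x * integral {0..U} (\<lambda>u. bser 0 (of_real (x\<^sup>2 * (cosh u)\<^sup>2)) * of_real (sinh (2 * u)) * g u)"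

lemma cosh_square_derivative: "((\<lambda>u. (cosh u)\<^sup>2) has_real_derivative sinh (2 * u)) (at u within A)"
  by (auto intro!: derivative_eq_intros simp: sinh_double)

lemma cos_half_bounds: "0 \<le> (1 + cos A) / 2" "(1 + cos A) / 2 \<le> (1::real)" for A :: real
proof -
  have "0 \<le> 1 + cos A" by (smt (verit) cos_ge_minus_one)
  then show "0 \<le> (1 + cos A) / 2" by simp
  show "(1 + cos A) / 2 \<le> 1" by simp
qed

lemma cosh_square_mono: "0 \<le> u \<Longrightarrow> u \<le> v \<Longrightarrow> (cosh u)\<^sup>2 \<le> (cosh (v::real))\<^sup>2"
  by (intro power_mono) (auto simp: cosh_real_nonneg_le_iff)

lemma arcosh_sqrt_cosh_square: "u \<ge> 0 \<Longrightarrow> arcosh (sqrt ((cosh u)\<^sup>2)) = (u::real)"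
  by (simp add: arcosh_cosh_real)

lemma cosh_square_gt_1: "u > 0 \<Longrightarrow> (cosh (u::real))\<^sup>2 > 1"
  using cosh_real_nonneg_less_iff[of 0 u] by (intro one_less_power) auto

lemma cosh_square_ge_1: "(cosh (u::real))\<^sup>2 \<ge> 1"
  by (intro one_le_power cosh_real_ge_1)

lemma has_vector_derivative_zero_eq:
  fixes f :: "real \<Rightarrow> 'a :: real_normed_vector"
  assumes "convex S" "\<And>x. x \<in> S \<Longrightarrow> (f has_vector_derivative 0) (at x within S)" "x \<in> S" "y \<in> S"
  shows "f x = f y"
  using has_vector_derivative_zero_constant[OF assms(1,2)] assms(3,4) by metis

lemma hankel0_eq_cosh_transform:
  assumes U: "U \<ge> 0" and h: "continuous_on {0..} h" "\<And>q. 0 \<le> q \<Longrightarrow> q \<le> 1 \<Longrightarrow> h q = 0" "\<And>q. q \<ge> (cosh U)\<^sup>2 \<Longrightarrow> h q = 0"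
  shows "hankel0 h x = cosh_transform U (\<lambda>u. h ((cosh u)\<^sup>2)) x"
proof -
  let ?Q = "(cosh U)\<^sup>2"
  define f where "f q = bser 0 (of_real (x\<^sup>2 * q)) * h q" for q
  have f: "continuous_on {1..?Q} f"
    unfolding f_def by (intro continuous_intros continuous_on_subset[OF h(1)]) auto
  have Q: "?Q \<ge> 1" by (rule cosh_square_ge_1)
  have sub: "(\<lambda>u. (cosh u)\<^sup>2) ` {0..U} \<subseteq> {1..?Q}"
    using cosh_square_mono cosh_square_ge_1 by auto
  have "((\<lambda>u. sinh (2 * u) *\<^sub>R f ((cosh u)\<^sup>2)) has_integral integral {(cosh 0)\<^sup>2..(cosh U)\<^sup>2} f) {0..U}"
    by (rule has_integral_substitution[OF U _ sub f cosh_square_derivative]) (use Q in simp)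
  then have 1: "integral {0..U} (\<lambda>u. sinh (2 * u) *\<^sub>R f ((cosh u)\<^sup>2)) = integral {1..?Q} f"
    by (simp add: integral_unique)
  have "(f has_integral integral {1..?Q} f) {1..?Q}"
    by (intro integrable_integral integrable_continuous_interval f)
  then have "((\<lambda>q. if q \<in> {1..?Q} then f q else 0) has_integral integral {1..?Q} f) {0..}"
    by (subst has_integral_restrict) auto
  then have "(f has_integral integral {1..?Q} f) {0..}"
    by (rule has_integral_eq[rotated]) (use h in \<open>auto simp: f_def\<close>)
  then have "integral {0..} f = integral {0..U} (\<lambda>u. sinh (2 * u) *\<^sub>R f ((cosh u)\<^sup>2))"
    using 1 by (simp add: integral_unique)
  then show ?thesis
    unfolding hankel0_def cosh_transform_def f_def by (simp add: scaleR_conv_of_real mult_ac)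
qed

text \<open>To use \<open>bessel_pairing\<close>, g(u) must be h(cosh^2 u) with a continuous density
  k in y = e^{-q}. The inverse u = arcosh(sqrt q) has infinite slope at q = 1, which is why g' has
  to vanish near 0; the passage from h' to k divides by y, which is why g' has to vanish for large
  u. As h is then zero on q at most 1, the two angular integrals drop out.\<close>

lemma smooth_pairing:
  fixes g g' :: "real \<Rightarrow> complex"
  assumes \<mu>: "\<mu> \<noteq> 0" and \<delta>: "\<delta> > 0" and U: "U \<ge> 0"
    and g: "\<And>u. u \<ge> 0 \<Longrightarrow> (g has_vector_derivative g' u) (at u within {0..})"
    and g'_cont: "continuous_on {0..} g'"
    and zero: "\<And>u. 0 \<le> u \<Longrightarrow> u \<le> \<delta> \<Longrightarrow> g' u = 0" "\<And>u. u \<ge> U \<Longrightarrow> g' u = 0" "g 0 = 0" "\<And>u. u \<ge> U \<Longrightarrow> g u = 0"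
  defines "\<nu> \<equiv> \<i> * complex_of_real \<mu>"
  shows "((\<lambda>x. cosh_transform U g x * ((besselJ \<nu> x)\<^sup>2 + (besselY \<nu> x)\<^sup>2)) has_integral
       integral {0..U} (\<lambda>u. g u * of_real (2 * sin (2 * \<mu> * u) / (pi * sinh (\<mu> * pi))))) {0<..}"
proof -
  define c where "c = (cosh \<delta>)\<^sup>2"
  define Q where "Q = (cosh U)\<^sup>2"
  have c1: "c > 1" unfolding c_def by (rule cosh_square_gt_1[OF \<delta>])
  \<comment> \<open>The derivative of g with respect to q: g'(u) over dq/du = sinh 2u = 2 cosh u
    sinh u at u = arcosh(sqrt q).\<close>
  define \<kappa> where "\<kappa> q = (if q \<le> 1 then 0 else g' (arcosh (sqrt q)) / of_real (2 * sqrt q * sqrt (q - 1)))" for q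
  have arc: "arcosh (sqrt q) \<ge> 0" if "q \<ge> 1" for q :: real using that by simp
  have \<kappa>_lt: "\<kappa> q = 0" if "q < c" for q
  proof (cases "q \<le> 1")
    case False
    have "\<not> \<delta> < arcosh (sqrt q)"
    proof
      assume "\<delta> < arcosh (sqrt q)"
      then have "(cosh \<delta>)\<^sup>2 \<le> (cosh (arcosh (sqrt q)))\<^sup>2" using \<delta> by (intro cosh_square_mono) auto
      then show False using that False by (simp add: cosh_arcosh_real c_def)
    qed
    then show ?thesis using zero(1)[of "arcosh (sqrt q)"] False arc[of q] by (simp add: \<kappa>_def)
  qed (simp add: \<kappa>_def)
  have \<kappa>_gt: "\<kappa> q = 0" if "q \<ge> Q" for q
  proof (cases "q \<le> 1")
    case False
    have "U \<le> arcosh (sqrt q)"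
    proof (rule ccontr)
      assume "\<not> U \<le> arcosh (sqrt q)"
      then have *: "arcosh (sqrt q) < U" by simp
      have "cosh (arcosh (sqrt q)) < cosh U" using * False arc[of q] U by (subst cosh_real_nonneg_less_iff) auto
      then have "sqrt q < cosh U" using False by (simp add: cosh_arcosh_real)
      then have "q < Q" unfolding Q_def using False real_sqrt_less_iff[of q "(cosh U)\<^sup>2"] by simp
      then show False using that by simp
    qed
    then show ?thesis using zero(2) False by (simp add: \<kappa>_def)
  qed (simp add: \<kappa>_def)
  \<comment> \<open>Two open half-lines cover the real line because c > 1: on one the function is
    zero, on the other the formula is regular. Continuity of \<open>k\<close> is shown below in the
    same manner.\<close>
  have \<kappa>_cont: "continuous_on UNIV \<kappa>"
  proof -
    have "continuous_on {..<c} \<kappa>"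
      by (rule continuous_on_eq[OF continuous_on_const[of _ 0]]) (use \<kappa>_lt in auto)
    moreover have "continuous_on {1<..} \<kappa>"
    proof (rule continuous_on_eq)
      have "continuous_on {1<..} (\<lambda>q::real. arcosh (sqrt q))"
      proof (rule continuous_on_arcosh')
        show "continuous_on {1<..} (\<lambda>q::real. sqrt q)" by (intro continuous_intros)
      qed auto
      then have "continuous_on {1<..} (\<lambda>q. g' (arcosh (sqrt q)))"
        by (rule continuous_on_compose2[OF g'_cont]) (auto intro!: arc)
      then show "continuous_on {1<..} (\<lambda>q. g' (arcosh (sqrt q)) / of_real (2 * sqrt q * sqrt (q - 1)))"
        by (intro continuous_intros) auto
    qed (auto simp: \<kappa>_def)
    ultimately have "continuous_on ({..<c} \<union> {1<..}) \<kappa>" by (intro continuous_on_open_Un) auto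
    moreover have "{..<c} \<union> {1<..} = UNIV" using c1 by auto
    ultimately show ?thesis by simp
  qed
  \<comment> \<open>Solves h'(q) = -e^{-q} k(e^{-q}) = \<kappa>(q) for k, with y = e^{-q}.\<close>
  define k where "k y = (if y \<le> 0 then 0 else - \<kappa> (- ln y) / of_real y)" for y
  define \<eta> where "\<eta> = exp (- Q)"
  have k_lt: "k y = 0" if "y \<le> \<eta>" for y
  proof (cases "y \<le> 0")
    case False
    then have "ln y \<le> - Q" using that unfolding \<eta>_def by (metis exp_gt_zero ln_exp ln_le_cancel_iff not_le)
    then show ?thesis using \<kappa>_gt[of "- ln y"] by (simp add: k_def)
  qed (simp add: k_def)
  have k_cont: "continuous_on {0..1} k"
  proof -
    have "continuous_on {..<\<eta>} k"
      by (rule continuous_on_eq[OF continuous_on_const[of _ 0]]) (use k_lt in auto)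
    moreover have "continuous_on {0<..} k"
    proof (rule continuous_on_eq)
      show "continuous_on {0<..} (\<lambda>y. - \<kappa> (- ln y) / of_real y)"
        by (intro continuous_intros continuous_on_compose2[OF \<kappa>_cont]) auto
    qed (auto simp: k_def)
    ultimately have "continuous_on ({..<\<eta>} \<union> {0<..}) k" by (intro continuous_on_open_Un) auto
    moreover have "{0..1} \<subseteq> {..<\<eta>} \<union> {0<..}" unfolding \<eta>_def by auto
    ultimately show ?thesis by (rule continuous_on_subset)
  qed
  define h where "h q = integral {0..exp (- q)} k" for q
  have h': "(h has_vector_derivative \<kappa> q) (at q within {0..})" if "q \<ge> 0" for q
  proof -
    have e: "exp (- q) \<in> {0..1}" using that by auto
    have "((\<lambda>y. integral {0..y} k) has_vector_derivative k (exp (- q))) (at (exp (- q)) within {0..1})"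
      by (rule integral_has_vector_derivative[OF k_cont e])
    then have "((\<lambda>y. integral {0..y} k) has_vector_derivative k (exp (- q))) (at (exp (- q)) within (\<lambda>q. exp (- q)) ` {0..})"
      by (rule has_vector_derivative_within_subset) auto
    moreover have "((\<lambda>q. exp (- q)) has_vector_derivative - exp (- q)) (at q within {0..})"
      unfolding has_real_derivative_iff_has_vector_derivative[symmetric] by (auto intro!: derivative_eq_intros)
    ultimately have "(h has_vector_derivative (- exp (- q)) *\<^sub>R k (exp (- q))) (at q within {0..})"
      unfolding h_def by (intro vector_diff_chain_within[unfolded o_def])
    moreover have "(- exp (- q)) *\<^sub>R k (exp (- q)) = \<kappa> q" by (simp add: k_def scaleR_conv_of_real)
    ultimately show ?thesis by simp
  qed
  have h_cont: "continuous_on {0..} h"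
    unfolding continuous_on_eq_continuous_within
    by (intro ballI has_vector_derivative_continuous[OF h']) auto
  have h_gt: "h q = 0" if "q \<ge> Q" for q
  proof -
    have "exp (- q) \<le> \<eta>" using that by (simp add: \<eta>_def)
    then have "integral {0..exp (- q)} k = integral {0..exp (- q)} (\<lambda>_. 0)"
      by (intro integral_cong) (use k_lt in auto)
    then show ?thesis by (simp add: h_def)
  qed
  \<comment> \<open>The chain rule gives both sides the derivative g', and both vanish at
    \<open>U\<close>.\<close>
  have hg: "h ((cosh u)\<^sup>2) = g u" if u: "u \<ge> 0" for u
  proof -
    have "((\<lambda>u. h ((cosh u)\<^sup>2) - g u) has_vector_derivative 0) (at v within {0..})" if v: "v \<in> {0..}" for v
    proof -
      have "(h has_vector_derivative \<kappa> ((cosh v)\<^sup>2)) (at ((cosh v)\<^sup>2) within (\<lambda>u. (cosh u)\<^sup>2) ` {0..})"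
        by (rule has_vector_derivative_within_subset[OF h']) auto
      moreover have "((\<lambda>u. (cosh u)\<^sup>2) has_vector_derivative sinh (2 * v)) (at v within {0..})"
        unfolding has_real_derivative_iff_has_vector_derivative[symmetric] by (rule cosh_square_derivative)
      ultimately have "((\<lambda>u. h ((cosh u)\<^sup>2)) has_vector_derivative sinh (2 * v) *\<^sub>R \<kappa> ((cosh v)\<^sup>2)) (at v within {0..})"
        by (intro vector_diff_chain_within[unfolded o_def])
      moreover have "sinh (2 * v) *\<^sub>R \<kappa> ((cosh v)\<^sup>2) = g' v"
      proof (cases "v = 0")
        case True
        then show ?thesis using zero(1)[of 0] \<delta> by (simp add: \<kappa>_def)
      next
        case False
        then have v0: "v > 0" using v by simp
        have "sqrt ((cosh v)\<^sup>2 - 1) = sinh v"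
          using v0 by (simp add: cosh_square_eq real_sqrt_abs)
        then have "2 * sqrt ((cosh v)\<^sup>2) * sqrt ((cosh v)\<^sup>2 - 1) = sinh (2 * v)"
          by (simp add: sinh_double)
        moreover have "sinh (2 * v) \<noteq> 0" using v0 by simp
        ultimately show ?thesis
          using cosh_square_gt_1[OF v0] arcosh_sqrt_cosh_square[of v] v0
          by (simp add: \<kappa>_def scaleR_conv_of_real del: real_sqrt_abs)
      qed
      ultimately have "((\<lambda>u. h ((cosh u)\<^sup>2)) has_vector_derivative g' v) (at v within {0..})" by (simp only:)
      from has_vector_derivative_diff[OF this g[of v]] show ?thesis using v by simp
    qed
    then have "h ((cosh u)\<^sup>2) - g u = h ((cosh U)\<^sup>2) - g U"
      by (intro has_vector_derivative_zero_eq[of "{0..}" "\<lambda>u. h ((cosh u)\<^sup>2) - g u"]) (use u U in simp_all)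
    then show ?thesis using h_gt[of Q] zero(4)[of U] by (simp add: Q_def)
  qed
  have h_le: "h q = 0" if "0 \<le> q" "q \<le> 1" for q
  proof -
    have "(h has_vector_derivative 0) (at p within {0..1})" if "p \<in> {0..1}" for p
      using has_vector_derivative_within_subset[OF h'[of p], of "{0..1}"] that by (auto simp: \<kappa>_def)
    then have "h q = h 1"
      by (intro has_vector_derivative_zero_eq[of "{0..1}"]) (use that in auto)
    also have "h 1 = 0" using hg[of 0] zero(3) by simp
    finally show ?thesis .
  qed
  obtain \<gamma>1 \<gamma>2 where "((\<lambda>x. hankel0 h x * ((besselJ \<nu> x)\<^sup>2 + (besselY \<nu> x)\<^sup>2)) has_integral bessel_functional \<mu> \<gamma>1 \<gamma>2 h) {0<..}"
    using bessel_pairing[OF \<mu>] k_cont unfolding \<nu>_def h_def[abs_def] by blast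
  moreover have "hankel0 h x = cosh_transform U g x" for x
  proof -
    have "hankel0 h x = cosh_transform U (\<lambda>u. h ((cosh u)\<^sup>2)) x"
      by (rule hankel0_eq_cosh_transform[OF U h_cont h_le]) (use h_gt in \<open>auto simp: Q_def\<close>)
    also have "\<dots> = cosh_transform U g x"
      unfolding cosh_transform_def by (intro arg_cong2[of _ _ _ _ "(*)"] integral_cong refl) (use hg in auto)
    finally show ?thesis .
  qed
  moreover have "bessel_functional \<mu> \<gamma>1 \<gamma>2 h = integral {0..U} (\<lambda>u. g u * of_real (2 * sin (2 * \<mu> * u) / (pi * sinh (\<mu> * pi))))"
  proof -
    have "integral {-pi..pi} (\<lambda>A. h ((1 - cos A) / 2) * \<gamma>1 A) = integral {-pi..pi} (\<lambda>A. 0)"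
      by (intro integral_cong) (use h_le cos_ge_minus_one cos_le_one in auto)
    moreover have "integral {-pi..pi} (\<lambda>A. h ((1 + cos A) / 2) * \<gamma>2 A) = integral {-pi..pi} (\<lambda>A. 0)"
    proof (intro integral_cong)
      fix A :: real
      show "h ((1 + cos A) / 2) * \<gamma>2 A = 0" using cos_half_bounds[of A] by (simp add: h_le)
    qed
    moreover have "integral {0..} (\<lambda>u. h ((cosh u)\<^sup>2) * of_real (2 * sin (2 * \<mu> * u) / (pi * sinh (\<mu> * pi)))) =
        integral {0..U} (\<lambda>u. g u * of_real (2 * sin (2 * \<mu> * u) / (pi * sinh (\<mu> * pi))))"
    proof -
      define F where "F u = g u * of_real (2 * sin (2 * \<mu> * u) / (pi * sinh (\<mu> * pi)))" for u
      have "integral {0..} (\<lambda>u. h ((cosh u)\<^sup>2) * of_real (2 * sin (2 * \<mu> * u) / (pi * sinh (\<mu> * pi)))) =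
        integral {0..} (\<lambda>u. if u \<in> {0..U} then F u else 0)"
        by (intro integral_cong) (use hg zero(4) in \<open>auto simp: F_def\<close>)
      also have "\<dots> = integral {0..U} F"
        using Henstock_Kurzweil_Integration.integral_restrict_Int[of "{0..}" "{0..U}" F] U by (simp add: Int_absorb2)
      finally show ?thesis by (simp add: F_def[abs_def])
    qed
    ultimately show ?thesis by (simp add: bessel_functional_def)
  qed
  ultimately show ?thesis by simp
qed

text \<open>The analogue of \<open>hankel0_bound\<close> on a compact interval. The primitive of the
  kernel is cosh^2 u times \<open>bser 1\<close>, and the boundary terms vanish with g at 0 and
  \<open>U\<close>. The constant depends on \<open>U\<close> alone, so it is shared by all mollified
  functions.\<close>

lemma cosh_transform_bound:
  assumes U: "U \<ge> 0"
  shows "\<exists>A\<ge>0. \<forall>L g g'. L \<ge> 0 \<longrightarrow> (\<forall>u\<in>{0..U}. (g has_vector_derivative g' u) (at u within {0..U})) \<longrightarrow>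
     g 0 = 0 \<longrightarrow> g U = 0 \<longrightarrow> (\<forall>u\<in>{0..U}. norm (g u) \<le> L \<and> norm (g' u) \<le> L) \<longrightarrow>
     (\<forall>x>0. norm (cosh_transform U g x) \<le> A * L / sqrt (1 + x))"
proof -
  obtain B0 where B0: "B0 \<ge> 0" "\<forall>t\<ge>0. norm (bser 0 (of_real t)) \<le> B0" using bser0_bound by auto
  obtain B1 where B1: "B1 \<ge> 0" "\<forall>x>0. \<forall>q\<ge>0. x * sqrt x * (q * norm (bser 1 (of_real (x\<^sup>2 * q)))) \<le> B1 * (1 + q)"
    using bser1_weighted_bound by auto
  define Q where "Q = (cosh U)\<^sup>2"
  define C0 where "C0 = B0 * sinh (2 * U) * U"
  define C1 where "C1 = B1 * (1 + Q) * U"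
  have Q: "Q \<ge> 0" by (simp add: Q_def)
  have C: "C0 \<ge> 0" "C1 \<ge> 0" using U B0(1) B1(1) Q by (simp_all add: C0_def C1_def)
  show ?thesis
  proof (intro exI[of _ "2 * (C0 + C1)"] conjI allI impI)
    show "0 \<le> 2 * (C0 + C1)" using C by simp
    fix L x :: real and g g' :: "real \<Rightarrow> complex"
    assume L: "L \<ge> 0" and g': "\<forall>u\<in>{0..U}. (g has_vector_derivative g' u) (at u within {0..U})"
      and g0: "g 0 = 0" and gU: "g U = 0" and le: "\<forall>u\<in>{0..U}. norm (g u) \<le> L \<and> norm (g' u) \<le> L" and x: "x > 0"
    define f0 where "f0 u = bser 0 (of_real (x\<^sup>2 * (cosh u)\<^sup>2)) * of_real (sinh (2 * u)) * g u" for u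
    define K where "K u = of_real ((cosh u)\<^sup>2) * bser 1 (of_real (x\<^sup>2 * (cosh u)\<^sup>2))" for u :: real
    have g_cont: "continuous_on {0..U} g"
      unfolding continuous_on_eq_continuous_within
      by (intro ballI has_vector_derivative_continuous[OF bspec[OF g']])
    have int0: "f0 integrable_on {0..U}"
      unfolding f0_def by (intro integrable_continuous_interval continuous_intros g_cont) auto
    have K_le: "norm (K u) \<le> B1 * (1 + Q) / (x * sqrt x)" if "u \<in> {0..U}" for u
    proof -
      have "x * sqrt x * norm (K u) \<le> B1 * (1 + (cosh u)\<^sup>2)"
        using B1(2)[rule_format, OF x, of "(cosh u)\<^sup>2"] unfolding K_def norm_mult norm_of_real by simp
      also have "\<dots> \<le> B1 * (1 + Q)"
        using that B1(1) cosh_square_mono[of u U] unfolding Q_def by (intro mult_left_mono) auto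
      finally show ?thesis using x by (subst pos_le_divide_eq) (auto simp: mult_ac)
    qed
    have K': "(K has_vector_derivative sinh (2 * u) *\<^sub>R bser 0 (of_real (x\<^sup>2 * (cosh u)\<^sup>2))) (at u within {0..U})" for u
    proof -
      have "((\<lambda>u. (cosh u)\<^sup>2) has_vector_derivative sinh (2 * u)) (at u within {0..U})"
        unfolding has_real_derivative_iff_has_vector_derivative[symmetric] by (rule cosh_square_derivative)
      then show ?thesis
        unfolding K_def[abs_def] by (rule vector_diff_chain_within[unfolded o_def, OF _ has_vector_derivative_bser1_kernel])
    qed
    have tot: "((\<lambda>u. K u * g' u + sinh (2 * u) *\<^sub>R bser 0 (of_real (x\<^sup>2 * (cosh u)\<^sup>2)) * g u) has_integral (K U * g U - K 0 * g 0)) {0..U}"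
      by (rule fundamental_theorem_of_calculus[OF U])
         (intro has_vector_derivative_mult K' bspec[OF g'])
    moreover have "sinh (2 * u) *\<^sub>R bser 0 (of_real (x\<^sup>2 * (cosh u)\<^sup>2)) * g u = f0 u" for u
      by (simp add: f0_def scaleR_conv_of_real)
    ultimately have "((\<lambda>u. K u * g' u + f0 u) has_integral 0) {0..U}" using g0 gU by simp
    from has_integral_diff[OF this integrable_integral[OF int0]]
    have int1: "((\<lambda>u. K u * g' u) has_integral - integral {0..U} f0) {0..U}" by simp
    have n0: "norm (integral {0..U} f0) \<le> C0 * L"
    proof -
      have "norm (integral {0..U} f0) \<le> B0 * sinh (2 * U) * L * measure lborel {0..U}"
      proof (rule has_integral_bound_real[OF _ finite.emptyI integrable_integral[OF int0]])
        show "0 \<le> B0 * sinh (2 * U) * L" using B0(1) U L by simp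
        fix u assume u: "u \<in> {0..U} - {}"
        show "norm (f0 u) \<le> B0 * sinh (2 * U) * L"
          unfolding f0_def norm_mult norm_of_real using u B0(1) le L
          by (intro mult_mono B0(2)[rule_format]) (auto simp: sinh_real_le_iff)
      qed
      then show ?thesis using U by (simp add: C0_def mult_ac)
    qed
    have n1: "norm (integral {0..U} f0) \<le> C1 * L / (x * sqrt x)"
    proof -
      have "norm (- integral {0..U} f0) \<le> B1 * (1 + Q) / (x * sqrt x) * L * measure lborel {0..U}"
      proof (rule has_integral_bound_real[OF _ finite.emptyI int1])
        show "0 \<le> B1 * (1 + Q) / (x * sqrt x) * L" using B1(1) Q L x by simp
        fix u assume u: "u \<in> {0..U} - {}"
        show "norm (K u * g' u) \<le> B1 * (1 + Q) / (x * sqrt x) * L"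
          unfolding norm_mult using u K_le le L B1(1) Q x by (intro mult_mono) auto
      qed
      then show ?thesis using U by (simp add: C1_def mult_ac)
    qed
    have eq: "norm (cosh_transform U g x) = x * norm (integral {0..U} f0)"
      unfolding cosh_transform_def f0_def[abs_def, symmetric] norm_mult using x by simp
    have "norm (cosh_transform U g x) \<le> 2 * ((C0 + C1) * L) / sqrt (1 + x)"
    proof (rule inverse_sqrt_bounds[OF x])
      show "0 \<le> (C0 + C1) * L" using C L by simp
      have "norm (cosh_transform U g x) \<le> x * (C0 * L)" unfolding eq using n0 x by (intro mult_left_mono) auto
      also have "\<dots> \<le> x * ((C0 + C1) * L)" using x C L by (intro mult_left_mono mult_right_mono) auto
      finally show "norm (cosh_transform U g x) \<le> (C0 + C1) * L * x" by (simp only: mult.commute[of x])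
      have "norm (cosh_transform U g x) \<le> x * (C1 * L / (x * sqrt x))" unfolding eq using n1 x by (intro mult_left_mono) auto
      also have "\<dots> = C1 * L / sqrt x" using x by simp
      also have "\<dots> \<le> (C0 + C1) * L / sqrt x" using x C L by (intro divide_right_mono mult_right_mono) auto
      finally show "norm (cosh_transform U g x) \<le> (C0 + C1) * L / sqrt x" .
    qed
    then show "norm (cosh_transform U g x) \<le> 2 * (C0 + C1) * L / sqrt (1 + x)" by (simp only: mult.assoc)
  qed
qed

text \<open>The moving averages of $g$ over $[u - 2\delta, u - \delta]$ are continuously differentiable, vanish near $0$
  and keep the Lipschitz constant, so the smooth case applies to them and passes to the limit.\<close>
lemma lipschitz_pairing:
  fixes g :: "real \<Rightarrow> complex"
  assumes \<mu>: "\<mu> \<noteq> 0" and V: "V \<ge> 0" and lip: "\<And>s t. norm (g s - g t) \<le> L * \<bar>s - t\<bar>"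
    and zero: "\<And>u. u \<le> 0 \<Longrightarrow> g u = 0" "\<And>u. u \<ge> V \<Longrightarrow> g u = 0"
  defines "\<nu> \<equiv> \<i> * complex_of_real \<mu>" and "U \<equiv> V + 2"
  shows "((\<lambda>x. cosh_transform U g x * ((besselJ \<nu> x)\<^sup>2 + (besselY \<nu> x)\<^sup>2)) has_integral
       integral {0..U} (\<lambda>u. g u * of_real (2 * sin (2 * \<mu> * u) / (pi * sinh (\<mu> * pi))))) {0<..}"
proof -
  define M where "M x = (besselJ \<nu> x)\<^sup>2 + (besselY \<nu> x)\<^sup>2" for x
  define \<gamma> where "\<gamma> u = complex_of_real (2 * sin (2 * \<mu> * u) / (pi * sinh (\<mu> * pi)))" for u
  \<comment> \<open>The averages look back by at most 2\<delta>, which is at most 2, so they all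
    vanish from V + 2 on.\<close>
  have U: "U \<ge> 0" using V by (simp add: U_def)
  have L: "L \<ge> 0" using order_trans[OF norm_ge_zero lip[of 1 0]] by simp
  have sh: "sinh (\<mu> * pi) \<noteq> 0" using \<mu> by simp
  have \<gamma>_cont: "continuous_on A \<gamma>" for A unfolding \<gamma>_def using sh by (intro continuous_intros) auto
  have g_cont: "continuous_on A g" for A
  proof (rule continuous_on_subset[of UNIV])
    show "continuous_on UNIV g"
      unfolding continuous_on_iff
    proof (intro ballI allI impI)
      fix s e :: real assume e: "e > 0"
      show "\<exists>d>0. \<forall>t\<in>UNIV. dist t s < d \<longrightarrow> dist (g t) (g s) < e"
      proof (intro exI[of _ "e / (L + 1)"] conjI ballI impI)
        fix t assume "dist t s < e / (L + 1)"
        then have "(L + 1) * \<bar>t - s\<bar> < e" using L by (simp add: dist_real_def field_simps)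
        moreover have "norm (g t - g s) \<le> (L + 1) * \<bar>t - s\<bar>"
          by (rule order_trans[OF lip]) (intro mult_right_mono, auto)
        ultimately show "dist (g t) (g s) < e" by (simp add: dist_norm)
      qed (use e L in auto)
    qed
  qed auto
  \<comment> \<open>For nonnegative u the points u - 2\<delta> and u - \<delta> are at least -2. The
    lower limit -3 lies strictly to their left, so the primitive is differentiable there.\<close>
  define G where "G v = integral {-3..v} g" for v
  have G': "(G has_vector_derivative g v) (at v)" if "v > -3" for v
  proof -
    have "(G has_vector_derivative g v) (at v within {-3..v + 1})"
      unfolding G_def by (rule integral_has_vector_derivative[OF g_cont]) (use that in auto)
    moreover have "at v within {-3..v + 1} = at v" using that by (intro at_within_interior) auto
    ultimately show ?thesis by simp
  qed
  have G_int: "(g has_integral (G b - G a)) {a..b}" if "-3 < a" "a \<le> b" for a b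
    by (rule fundamental_theorem_of_calculus[OF that(2)]) (use G' that in \<open>auto intro: has_vector_derivative_at_within\<close>)
  define \<delta> where "\<delta> N = 1 / real (Suc N)" for N
  have \<delta>: "\<delta> N > 0" "\<delta> N \<le> 1" for N by (simp_all add: \<delta>_def)
  define gs where "gs N u = (1 / \<delta> N) *\<^sub>R (G (u - \<delta> N) - G (u - 2 * \<delta> N))" for N u
  define gs' where "gs' N u = (1 / \<delta> N) *\<^sub>R (g (u - \<delta> N) - g (u - 2 * \<delta> N))" for N u
  have gs'_der: "(gs N has_vector_derivative gs' N u) (at u within A)" if u: "u \<ge> 0" for N u A
  proof -
    have sh1: "((\<lambda>u. G (u - c)) has_vector_derivative g (u - c)) (at u within A)" if "c \<le> 2" for c
    proof -
      have "((\<lambda>u. u - c) has_vector_derivative 1) (at u)"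
        unfolding has_real_derivative_iff_has_vector_derivative[symmetric] by (auto intro!: derivative_eq_intros)
      moreover have "(G has_vector_derivative g (u - c)) (at (u - c))" by (rule G') (use u that in simp)
      ultimately have "((\<lambda>u. G (u - c)) has_vector_derivative 1 *\<^sub>R g (u - c)) (at u)"
        by (rule vector_diff_chain_at[unfolded o_def])
      then show ?thesis by (simp add: has_vector_derivative_at_within)
    qed
    have "((\<lambda>u. (1 / \<delta> N) *\<^sub>R (G (u - \<delta> N) - G (u - 2 * \<delta> N))) has_vector_derivative
        (1 / \<delta> N) *\<^sub>R (g (u - \<delta> N) - g (u - 2 * \<delta> N))) (at u within A)"
      using \<delta>[of N] by (intro bounded_linear.has_vector_derivative[OF bounded_linear_scaleR_right] has_vector_derivative_diff sh1) auto
    then show ?thesis by (simp add: gs_def[abs_def] gs'_def)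
  qed
  have gs_int: "((\<lambda>v. g v) has_integral \<delta> N *\<^sub>R gs N u) {u - 2 * \<delta> N..u - \<delta> N}" if "u \<ge> 0" for N u
    using G_int[of "u - 2 * \<delta> N" "u - \<delta> N"] \<delta>[of N] that by (simp add: gs_def)
  have gs_near: "norm (gs N u - g u) \<le> 2 * L * \<delta> N" if u: "u \<ge> 0" for N u
  proof -
    have len: "measure lborel {u - 2 * \<delta> N..u - \<delta> N} = \<delta> N" using \<delta>[of N] by simp
    have "((\<lambda>v. g u) has_integral \<delta> N *\<^sub>R g u) {u - 2 * \<delta> N..u - \<delta> N}"
      using has_integral_const_real[of "g u" "u - 2 * \<delta> N" "u - \<delta> N"] len by simp
    note diff = has_integral_diff[OF gs_int[OF u] this]
    have "norm (\<delta> N *\<^sub>R gs N u - \<delta> N *\<^sub>R g u) \<le> (2 * L * \<delta> N) * measure lborel {u - 2 * \<delta> N..u - \<delta> N}"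
    proof (rule has_integral_bound_real[OF _ finite.emptyI diff])
      show "0 \<le> 2 * L * \<delta> N" using L \<delta>[of N] by simp
      fix v assume "v \<in> {u - 2 * \<delta> N..u - \<delta> N} - {}"
      then have "\<bar>v - u\<bar> \<le> 2 * \<delta> N" using \<delta>[of N] by auto
      then have "L * \<bar>v - u\<bar> \<le> L * (2 * \<delta> N)" using L by (rule mult_left_mono)
      with lip[of v u] show "norm (g v - g u) \<le> 2 * L * \<delta> N" by simp
    qed
    then have "\<delta> N * norm (gs N u - g u) \<le> \<delta> N * (2 * L * \<delta> N)"
      unfolding len scaleR_diff_right[symmetric] using \<delta>[of N] by (simp add: mult.commute)
    then show ?thesis using \<delta>[of N] by simp
  qed
  have gs_zero: "gs N u = 0" if "u \<ge> 0" "\<And>v. v \<in> {u - 2 * \<delta> N..u - \<delta> N} \<Longrightarrow> g v = 0" for N u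
  proof -
    have "((\<lambda>v. 0) has_integral \<delta> N *\<^sub>R gs N u) {u - 2 * \<delta> N..u - \<delta> N}"
      by (rule has_integral_eq[OF _ gs_int[OF that(1)]]) (use that(2) in auto)
    then have "\<delta> N *\<^sub>R gs N u = 0" using has_integral_0 has_integral_unique by blast
    then show ?thesis using \<delta>[of N] by simp
  qed
  have gs_pairing: "((\<lambda>x. cosh_transform U (gs N) x * M x) has_integral integral {0..U} (\<lambda>u. gs N u * \<gamma> u)) {0<..}" for N
    unfolding M_def \<gamma>_def \<nu>_def
  proof (rule smooth_pairing[OF \<mu> \<delta>(1)[of N] U gs'_der])
    show "continuous_on {0..} (gs' N)"
      unfolding gs'_def by (intro continuous_intros continuous_on_compose2[OF g_cont[of UNIV]]) auto
    show "gs' N u = 0" if "0 \<le> u" "u \<le> \<delta> N" for u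
      using that \<delta>[of N] by (simp add: gs'_def zero(1))
    show "gs' N u = 0" if "u \<ge> U" for u
      using that \<delta>[of N] by (simp add: gs'_def zero(2) U_def)
    show "gs N 0 = 0" by (rule gs_zero) (use \<delta>[of N] in \<open>auto intro: zero(1)\<close>)
    show "gs N u = 0" if "u \<ge> U" for u
      by (rule gs_zero) (use that \<delta>[of N] U in \<open>auto intro!: zero(2) simp: U_def\<close>)
  qed auto
  obtain K where K: "K \<ge> 0" "\<And>x. x > 0 \<Longrightarrow> norm (M x) \<le> K / (1 + x)"
    using bessel_square_sum_bound[OF \<mu>] unfolding \<nu>_def M_def by auto
  obtain A where A: "A \<ge> 0" and A': "\<forall>L g g'. L \<ge> 0 \<longrightarrow> (\<forall>u\<in>{0..U}. (g has_vector_derivative g' u) (at u within {0..U})) \<longrightarrow>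
     g 0 = 0 \<longrightarrow> g U = 0 \<longrightarrow> (\<forall>u\<in>{0..U}. norm (g u) \<le> L \<and> norm (g' u) \<le> L) \<longrightarrow>
     (\<forall>x>0. norm (cosh_transform U g x) \<le> A * L / sqrt (1 + x))"
    using cosh_transform_bound[OF U] by (elim exE conjE)
  \<comment> \<open>One constant for the averages, which are at most LU + 2L, and for their
    derivatives, which are at most L.\<close>
  define C where "C = L * (U + 2)"
  have C: "C \<ge> 0" using L U by (simp add: C_def)
  have g_le: "norm (g u) \<le> L * U" if "u \<in> {0..U}" for u
  proof -
    have "norm (g u) \<le> L * \<bar>u\<bar>" using lip[of u 0] zero(1)[of 0] by simp
    also have "\<dots> \<le> L * U" using that L by (intro mult_left_mono) auto
    finally show ?thesis .
  qed
  have gs_le: "norm (gs N u) \<le> C" if u: "u \<in> {0..U}" for N u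
  proof -
    have "2 * L * \<delta> N \<le> 2 * L" using \<delta>[of N] L by (simp add: mult_left_le)
    moreover have "norm (gs N u) \<le> norm (g u) + norm (gs N u - g u)" by (metis add.commute norm_triangle_sub)
    ultimately have "norm (gs N u) \<le> L * U + 2 * L" using gs_near[of u N] g_le[OF u] u by simp
    then show ?thesis by (simp add: C_def algebra_simps)
  qed
  have gs'_le: "norm (gs' N u) \<le> C" for N u
  proof -
    have "norm (g (u - \<delta> N) - g (u - 2 * \<delta> N)) \<le> L * \<delta> N"
      using lip[of "u - \<delta> N" "u - 2 * \<delta> N"] \<delta>[of N] by simp
    then have "norm (gs' N u) \<le> L" using \<delta>[of N] by (simp add: gs'_def norm_scaleR pos_divide_le_eq mult.commute)
    also have "L \<le> C" using L U by (simp add: C_def mult_le_cancel_left1)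
    finally show ?thesis .
  qed
  have T_le: "norm (cosh_transform U (gs N) x) \<le> A * C / sqrt (1 + x)" if "x > 0" for N x
    by (rule A'[rule_format, of C "gs N" "gs' N" x])
       (use C gs_le gs'_le that gs'_der \<delta>[of N] U in \<open>auto intro!: gs_zero intro: zero simp: U_def\<close>)
  have gs_lim: "(\<lambda>N. gs N u) \<longlonglongrightarrow> g u" if "u \<ge> 0" for u
  proof -
    have "((\<lambda>N. gs N u - g u) \<longlonglongrightarrow> 0)"
    proof (rule Lim_null_comparison)
      show "(\<lambda>N. 2 * L * \<delta> N) \<longlonglongrightarrow> 0"
        using tendsto_mult_right_zero[OF LIMSEQ_inverse_real_of_nat, of "2 * L"] by (simp add: \<delta>_def divide_inverse)
      show "\<forall>\<^sub>F N in sequentially. norm (gs N u - g u) \<le> 2 * L * \<delta> N"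
        by (intro always_eventually allI gs_near that)
    qed
    then show ?thesis by (rule LIM_zero_cancel)
  qed
  have gs_cont: "continuous_on {0..U} (gs N)" for N
    unfolding continuous_on_eq_continuous_within
    by (intro ballI has_vector_derivative_continuous[OF gs'_der]) auto
  obtain B0 where B0: "B0 \<ge> 0" "\<forall>t\<ge>0. norm (bser 0 (of_real t)) \<le> B0" using bser0_bound by auto
  have T_lim: "(\<lambda>N. cosh_transform U (gs N) x) \<longlonglongrightarrow> cosh_transform U g x" for x
    unfolding cosh_transform_def
  proof (rule tendsto_mult[OF tendsto_const], rule dominated_convergence(2)[where h = "\<lambda>u. B0 * sinh (2 * U) * C"])
    show "(\<lambda>u. bser 0 (of_real (x\<^sup>2 * (cosh u)\<^sup>2)) * of_real (sinh (2 * u)) * gs N u) integrable_on {0..U}" for N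
      by (intro integrable_continuous_interval continuous_intros gs_cont) auto
    fix u assume u: "u \<in> {0..U}"
    show "norm (bser 0 (of_real (x\<^sup>2 * (cosh u)\<^sup>2)) * of_real (sinh (2 * u)) * gs N u) \<le> B0 * sinh (2 * U) * C" for N
      unfolding norm_mult norm_of_real using u B0(1) gs_le C by (intro mult_mono B0(2)[rule_format]) (auto simp: sinh_real_le_iff)
    show "(\<lambda>N. bser 0 (of_real (x\<^sup>2 * (cosh u)\<^sup>2)) * of_real (sinh (2 * u)) * gs N u) \<longlonglongrightarrow>
        bser 0 (of_real (x\<^sup>2 * (cosh u)\<^sup>2)) * of_real (sinh (2 * u)) * g u"
      using u by (intro tendsto_mult tendsto_const gs_lim) auto
  qed (rule integrable_const_ivl)
  have D: "(\<lambda>x. A * C * K * (1 / ((1 + x) * sqrt (1 + x)))) integrable_on {0<..}"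
    by (intro integrable_on_mult_right weight_integrable)
  have le: "norm (cosh_transform U (gs N) x * M x) \<le> A * C * K * (1 / ((1 + x) * sqrt (1 + x)))" if "x \<in> {0<..}" for N x
  proof -
    have "norm (cosh_transform U (gs N) x * M x) \<le> A * C / sqrt (1 + x) * (K / (1 + x))"
      unfolding norm_mult using that T_le K A C by (intro mult_mono) auto
    then show ?thesis by (simp add: mult_ac)
  qed
  have lim: "(\<lambda>N. cosh_transform U (gs N) x * M x) \<longlonglongrightarrow> cosh_transform U g x * M x" for x
    by (intro tendsto_mult tendsto_const T_lim)
  note dc = dominated_convergence[OF has_integral_integrable[OF gs_pairing] D le lim]
  have "(\<lambda>N. integral {0..U} (\<lambda>u. gs N u * \<gamma> u)) \<longlonglongrightarrow> integral {0..U} (\<lambda>u. g u * \<gamma> u)"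
  proof -
    obtain C3 where C3: "C3 \<ge> 0" "\<forall>u\<in>{0..U}. norm (\<gamma> u) \<le> C3" using compact_interval_norm_bound[OF \<gamma>_cont[of "{0..U}"]] by auto
    show ?thesis
    proof (rule dominated_convergence(2)[where h = "\<lambda>u. C * C3"])
      show "(\<lambda>u. gs N u * \<gamma> u) integrable_on {0..U}" for N
        by (intro integrable_continuous_interval continuous_intros gs_cont \<gamma>_cont)
      fix u assume u: "u \<in> {0..U}"
      show "norm (gs N u * \<gamma> u) \<le> C * C3" for N
        unfolding norm_mult using u gs_le C3 C by (intro mult_mono) auto
      show "(\<lambda>N. gs N u * \<gamma> u) \<longlonglongrightarrow> g u * \<gamma> u" using u by (intro tendsto_mult tendsto_const gs_lim) auto
    qed (rule integrable_const_ivl)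
  qed
  then have "integral {0<..} (\<lambda>x. cosh_transform U g x * M x) = integral {0..U} (\<lambda>u. g u * \<gamma> u)"
    using dc(2) unfolding integral_unique[OF gs_pairing] by (rule LIMSEQ_unique[rotated])
  with dc(1) have "((\<lambda>x. cosh_transform U g x * M x) has_integral integral {0..U} (\<lambda>u. g u * \<gamma> u)) {0<..}"
    by (simp add: has_integral_iff)
  then show ?thesis by (simp only: M_def \<gamma>_def)
qed

subsection \<open>Fourier sine series\<close>

text \<open>The Dirichlet kernel is expressed through the functions \<open>hsin m\<close>; as these are orthogonal on $[0, \pi]$,
  Bessel's inequality replaces the Riemann-Lebesgue lemma.\<close>
definition hsin :: "nat \<Rightarrow> real \<Rightarrow> real" where "hsin m t = sin ((real m + 1 / 2) * t)"

lemma cos_int_integral: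
  assumes "p \<noteq> 0"
  shows "((\<lambda>t. cos (of_int p * t)) has_integral 0) {0..pi}"
proof -
  have "((\<lambda>t. sin (of_int p * t) / of_int p) has_vector_derivative cos (of_int p * t)) (at t within {0..pi})" for t
    unfolding has_real_derivative_iff_has_vector_derivative[symmetric]
    using assms by (auto intro!: derivative_eq_intros)
  then have "((\<lambda>t. cos (of_int p * t)) has_integral (sin (of_int p * pi) / of_int p - sin (of_int p * 0) / of_int p)) {0..pi}"
    by (intro fundamental_theorem_of_calculus) auto
  then show ?thesis using sin_npi_int[of p] by (simp add: mult.commute)
qed

lemma hsin_orthogonal: "((\<lambda>t. hsin m t * hsin k t) has_integral (if m = k then pi / 2 else 0)) {0..pi}"
proof -
  define I where "I = (if m = k then pi else 0)"
  have 1: "((\<lambda>t. cos (of_int (int m - int k) * t)) has_integral I) {0..pi}"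
  proof (cases "m = k")
    case True
    then show ?thesis using has_integral_const_real[of "1::real" 0 pi] by (simp add: I_def)
  qed (use cos_int_integral[of "int m - int k"] in \<open>simp add: I_def\<close>)
  have 2: "((\<lambda>t. cos (of_int (int m + int k + 1) * t)) has_integral 0) {0..pi}"
    by (rule cos_int_integral) simp
  have "((\<lambda>t. 1 / 2 * (cos (of_int (int m - int k) * t) - cos (of_int (int m + int k + 1) * t))) has_integral 1 / 2 * (I - 0)) {0..pi}"
    by (intro has_integral_mult_right has_integral_diff 1 2)
  moreover have "1 / 2 * (cos (of_int (int m - int k) * t) - cos (of_int (int m + int k + 1) * t)) = hsin m t * hsin k t" for t
    unfolding hsin_def sin_times_sin by (simp add: algebra_simps)
  ultimately show ?thesis by (simp add: I_def split: if_splits)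
qed

text \<open>The left endpoint is excluded because the difference quotient integrated below is
  continuous only away from 0.\<close>

lemma has_integral_Ioc_iff:
  fixes f :: "real \<Rightarrow> 'a :: banach"
  shows "(f has_integral I) {a<..b} \<longleftrightarrow> (f has_integral I) {a..b}"
  by (rule has_integral_spike_set_eq) (auto intro: negligible_subset[of "{a}"])

lemma hsin_coefficients_tendsto_0:
  assumes q: "continuous_on {0<..pi} q" "\<And>t. t \<in> {0<..pi} \<Longrightarrow> \<bar>q t\<bar> \<le> C"
  shows "(\<lambda>m. integral {0<..pi} (\<lambda>t. q t * hsin m t)) \<longlonglongrightarrow> 0"
proof -
  let ?S = "{0<..pi}"
  have const: "(\<lambda>t::real. c) integrable_on ?S" for c :: real
  proof -
    have "((\<lambda>t::real. c) has_integral integral {0..pi} (\<lambda>t. c)) ?S"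
      unfolding has_integral_Ioc_iff by (intro integrable_integral integrable_const_ivl)
    then show ?thesis by blast
  qed
  have C: "C \<ge> 0" using order_trans[OF abs_ge_zero q(2)[of pi]] by simp
  have hs_cont: "continuous_on ?S (hsin m)" for m unfolding hsin_def by (intro continuous_intros)
  define c where "c m = integral ?S (\<lambda>t. q t * hsin m t)" for m
  have c: "((\<lambda>t. q t * hsin m t) has_integral c m) ?S" for m
    unfolding c_def
  proof (intro integrable_integral continuous_bounded_imp_integrable[OF _ _ const[of C]])
    show "norm (q t * hsin m t) \<le> C" if "t \<in> ?S" for t
    proof -
      have "\<bar>q t\<bar> * \<bar>hsin m t\<bar> \<le> C * 1" using q(2)[OF that] C by (intro mult_mono) (auto simp: hsin_def)
      then show ?thesis by (simp add: abs_mult)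
    qed
  qed (auto intro!: continuous_intros q hs_cont)
  have q2: "((\<lambda>t. q t * q t) has_integral integral ?S (\<lambda>t. q t * q t)) ?S"
  proof (intro integrable_integral continuous_bounded_imp_integrable[OF _ _ const[of "C * C"]])
    show "norm (q t * q t) \<le> C * C" if "t \<in> ?S" for t
      using mult_mono[OF q(2)[OF that] q(2)[OF that] C] by (simp add: abs_mult)
  qed (auto intro!: continuous_intros q)
  have bessel: "(\<Sum>m<N. (c m)\<^sup>2) \<le> pi / 2 * integral ?S (\<lambda>t. q t * q t)" for N
  proof -
    \<comment> \<open>The orthogonal projection of q onto the span of the first N functions; the
      factor 2/pi is the inverse of their squared norm pi/2. Bessel's inequality is the
      nonnegativity of the integral of (q - s)^2.\<close>
    define s where "s t = (\<Sum>m<N. 2 / pi * c m * hsin m t)" for t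
    have qs: "((\<lambda>t. q t * s t) has_integral (\<Sum>m<N. 2 / pi * (c m)\<^sup>2)) ?S"
    proof -
      have "((\<lambda>t. \<Sum>m<N. 2 / pi * c m * (q t * hsin m t)) has_integral (\<Sum>m<N. 2 / pi * c m * c m)) ?S"
        by (intro has_integral_sum has_integral_mult_right c) auto
      moreover have "(\<Sum>m<N. 2 / pi * c m * (q t * hsin m t)) = q t * s t" for t
        unfolding s_def sum_distrib_left by (simp only: mult_ac)
      ultimately show ?thesis by (simp add: power2_eq_square mult.assoc)
    qed
    have ss: "((\<lambda>t. s t * s t) has_integral (\<Sum>m<N. 2 / pi * (c m)\<^sup>2)) ?S"
    proof -
      have "((\<lambda>t. \<Sum>m<N. \<Sum>k<N. (2 / pi * c m) * (2 / pi * c k) * (hsin m t * hsin k t)) has_integral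
          (\<Sum>m<N. \<Sum>k<N. (2 / pi * c m) * (2 / pi * c k) * (if m = k then pi / 2 else 0))) ?S"
        unfolding has_integral_Ioc_iff by (intro has_integral_sum has_integral_mult_right hsin_orthogonal) auto
      moreover have "(\<Sum>m<N. \<Sum>k<N. (2 / pi * c m) * (2 / pi * c k) * (hsin m t * hsin k t)) = s t * s t" for t
        unfolding s_def sum_product by (simp only: mult_ac)
      moreover have "(\<Sum>m<N. \<Sum>k<N. (2 / pi * c m) * (2 / pi * c k) * (if m = k then pi / 2 else 0)) = (\<Sum>m<N. 2 / pi * (c m)\<^sup>2)"
      proof (rule sum.cong[OF refl])
        fix m assume m: "m \<in> {..<N}"
        have "(\<Sum>k<N. (2 / pi * c m) * (2 / pi * c k) * (if m = k then pi / 2 else 0)) =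
          (\<Sum>k<N. if m = k then (2 / pi * c m) * (2 / pi * c k) * (pi / 2) else 0)"
          by (rule sum.cong) auto
        also have "\<dots> = (2 / pi * c m) * (2 / pi * c m) * (pi / 2)" using m by (simp add: sum.delta)
        also have "\<dots> = 2 / pi * (c m)\<^sup>2" by (simp add: power2_eq_square)
        finally show "(\<Sum>k<N. (2 / pi * c m) * (2 / pi * c k) * (if m = k then pi / 2 else 0)) = 2 / pi * (c m)\<^sup>2" .
      qed
      ultimately show ?thesis by simp
    qed
    have "((\<lambda>t. q t * q t - 2 * (q t * s t) + s t * s t) has_integral
       (integral ?S (\<lambda>t. q t * q t) - 2 * (\<Sum>m<N. 2 / pi * (c m)\<^sup>2) + (\<Sum>m<N. 2 / pi * (c m)\<^sup>2))) ?S"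
      by (intro has_integral_add has_integral_diff has_integral_mult_right q2 qs ss)
    then have "0 \<le> integral ?S (\<lambda>t. q t * q t) - 2 * (\<Sum>m<N. 2 / pi * (c m)\<^sup>2) + (\<Sum>m<N. 2 / pi * (c m)\<^sup>2)"
    proof (rule has_integral_nonneg)
      fix t
      have "q t * q t - 2 * (q t * s t) + s t * s t = (q t - s t)\<^sup>2" by (simp add: power2_eq_square algebra_simps)
      then show "0 \<le> q t * q t - 2 * (q t * s t) + s t * s t" by simp
    qed
    then have "2 / pi * (\<Sum>m<N. (c m)\<^sup>2) \<le> integral ?S (\<lambda>t. q t * q t)"
      unfolding sum_distrib_left[symmetric] by simp
    then show ?thesis by (simp add: field_simps)
  qed
  have "summable (\<lambda>m. (c m)\<^sup>2)"
    by (rule summableI_nonneg_bounded[OF _ bessel]) simp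
  then have "(\<lambda>m. (c m)\<^sup>2) \<longlonglongrightarrow> 0" by (rule summable_LIMSEQ_zero)
  then have "(\<lambda>m. \<bar>c m\<bar>) \<longlonglongrightarrow> 0" using tendsto_real_sqrt[of "\<lambda>m. (c m)\<^sup>2" 0 sequentially] by simp
  then show ?thesis unfolding c_def by (rule tendsto_rabs_zero_cancel)
qed

text \<open>Stated as a product, hence valid also where sin(t/2) vanishes. Each induction step is
  the formula for a difference of two sines.\<close>

lemma dirichlet_kernel: "2 * sin (t / 2) * (1 / 2 + (\<Sum>n<N. cos (real (Suc n) * t))) = hsin N t"
proof (induction N)
  case 0
  then show ?case by (simp add: hsin_def)
next
  case (Suc N)
  have "((real (Suc N) + 1 / 2) * t - (real N + 1 / 2) * t) / 2 = t / 2"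
    "((real (Suc N) + 1 / 2) * t + (real N + 1 / 2) * t) / 2 = real (Suc N) * t" by (simp_all add: field_simps)
  then have "hsin (Suc N) t - hsin N t = 2 * sin (t / 2) * cos (real (Suc N) * t)"
    unfolding hsin_def sin_diff_sin by (simp only:)
  moreover have "2 * sin (t / 2) * (1 / 2 + (\<Sum>n<Suc N. cos (real (Suc n) * t))) =
     2 * sin (t / 2) * (1 / 2 + (\<Sum>n<N. cos (real (Suc n) * t))) + 2 * sin (t / 2) * cos (real (Suc N) * t)"
    by (simp add: distrib_left)
  ultimately show ?case unfolding Suc by simp
qed

text \<open>A coarse Jordan inequality: x - sin x is at most x^3/6, and x is at most 2 since pi < 4,
  so that x^2/6 is at most 2/3.\<close>

lemma sin_ge_third: "0 \<le> x \<Longrightarrow> x \<le> pi / 2 \<Longrightarrow> x / 3 \<le> sin (x::real)"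
proof -
  assume x: "0 \<le> x" "x \<le> pi / 2"
  have "(\<Sum>m<3. sin_coeff m * x ^ m) = x" by (simp add: sin_coeff_def eval_nat_numeral)
  then have "\<bar>sin x - x\<bar> \<le> inverse (fact 3) * \<bar>x\<bar> ^ 3" using Maclaurin_sin_bound[of x 3] by simp
  also have "inverse (fact 3) * \<bar>x\<bar> ^ 3 = x * x\<^sup>2 / 6"
    using x(1) by (simp add: fact_numeral power3_eq_cube power2_eq_square)
  finally have 1: "x - sin x \<le> x * x\<^sup>2 / 6" by linarith
  have "x \<le> 2" using x(2) pi_less_4 by linarith
  then have "x\<^sup>2 \<le> 2\<^sup>2" using x(1) by (intro power_mono) auto
  then have "x * x\<^sup>2 \<le> x * 4" using x(1) by (intro mult_left_mono) auto
  then show "x / 3 \<le> sin x" using 1 by linarith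
qed

lemma integral_symmetric_interval:
  fixes F :: "real \<Rightarrow> 'a :: euclidean_space"
  assumes "continuous_on {-pi..pi} F"
  shows "integral {-pi..pi} F = integral {0..pi} (\<lambda>t. F t + F (- t))"
proof -
  have i: "F integrable_on {-pi..pi}" "F integrable_on {0..pi}" "F integrable_on {-pi..0}"
    by (intro integrable_continuous_interval continuous_on_subset[OF assms]; simp)+
  have "integral {-pi..pi} F = integral {-pi..0} F + integral {0..pi} F"
    by (rule Henstock_Kurzweil_Integration.integral_combine[symmetric]) (use i in auto)
  also have "integral {-pi..0} F = integral {0..pi} (\<lambda>t. F (- t))"
    using Henstock_Kurzweil_Integration.integral_reflect_real[of pi 0 "\<lambda>t. F (- t)"] by simp
  also have "integral {0..pi} (\<lambda>t. F (- t)) + integral {0..pi} F = integral {0..pi} (\<lambda>t. F t + F (- t))"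
  proof -
    have "(\<lambda>t. F (- t)) integrable_on {0..pi}"
      by (intro integrable_continuous_interval continuous_on_compose2[OF assms] continuous_intros) auto
    then show ?thesis using i by (simp add: integral_add)
  qed
  finally show ?thesis .
qed

text \<open>Convergence at the single point 0 in the manner of Dini: the Lipschitz condition at 0
  bounds the symmetrised difference quotient \<open>q\<close>, whose coefficients against
  \<open>hsin\<close> tend to 0. The vanishing mean removes the constant term of the cosine
  series.\<close>

lemma dirichlet_convergence:
  fixes \<kappa> :: "real \<Rightarrow> real"
  assumes c: "continuous_on {-pi..pi} \<kappa>" and lip: "\<And>t. t \<in> {-pi..pi} \<Longrightarrow> \<bar>\<kappa> t - \<kappa> 0\<bar> \<le> C * \<bar>t\<bar>"
    and mean: "integral {-pi..pi} \<kappa> = 0"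
  shows "(\<lambda>n. 1 / pi * integral {-pi..pi} (\<lambda>t. \<kappa> t * cos (real (Suc n) * t))) sums \<kappa> 0"
proof -
  define \<sigma> where "\<sigma> t = \<kappa> t + \<kappa> (- t)" for t
  define q where "q t = (\<sigma> t - 2 * \<kappa> 0) / (2 * sin (t / 2))" for t
  define D where "D N t = 1 / 2 + (\<Sum>n<N. cos (real (Suc n) * t))" for N t
  have \<sigma>_cont: "continuous_on {0..pi} \<sigma>"
    unfolding \<sigma>_def by (intro continuous_intros continuous_on_compose2[OF c]) auto
  have D_cont: "continuous_on A (D N)" for A N unfolding D_def by (intro continuous_intros)
  have "C * pi \<ge> 0" using order_trans[OF abs_ge_zero lip[of pi]] by simp
  then have C: "C \<ge> 0" using pi_gt_zero by (simp add: zero_le_mult_iff)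
  have sin_pos: "sin (t / 2) > 0" if "t \<in> {0<..pi}" for t using that by (intro sin_gt_zero) auto
  have q_cont: "continuous_on {0<..pi} q"
    unfolding q_def by (intro continuous_intros continuous_on_subset[OF \<sigma>_cont]) (use sin_pos in fastforce)+
  \<comment> \<open>The numerator is at most 2Ct, and 2 sin(t/2) is at least t/3 by
    \<open>sin_ge_third\<close>.\<close>
  have q_le: "\<bar>q t\<bar> \<le> 6 * C" if t: "t \<in> {0<..pi}" for t
  proof -
    have "\<bar>\<sigma> t - 2 * \<kappa> 0\<bar> \<le> \<bar>\<kappa> t - \<kappa> 0\<bar> + \<bar>\<kappa> (- t) - \<kappa> 0\<bar>" by (simp add: \<sigma>_def)
    also have "\<dots> \<le> C * \<bar>t\<bar> + C * \<bar>- t\<bar>" using t by (intro add_mono lip) auto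
    finally have 1: "\<bar>\<sigma> t - 2 * \<kappa> 0\<bar> \<le> 2 * C * t" using t by simp
    have "t / 2 / 3 \<le> sin (t / 2)" by (rule sin_ge_third) (use t in auto)
    then have "6 * C * (2 * (t / 6)) \<le> 6 * C * (2 * sin (t / 2))" using C by (intro mult_left_mono) auto
    with 1 have "\<bar>\<sigma> t - 2 * \<kappa> 0\<bar> \<le> 6 * C * (2 * sin (t / 2))" by simp
    then show ?thesis unfolding q_def abs_divide using sin_pos[OF t] by (simp add: pos_divide_le_eq)
  qed
  have D_int: "integral {0..pi} (D N) = pi / 2" for N
  proof -
    have "((\<lambda>t. 1 / 2 + (\<Sum>n<N. cos (of_int (int (Suc n)) * t))) has_integral (pi / 2 + (\<Sum>n<N. 0))) {0..pi}"
      using has_integral_const_real[of "1 / 2 :: real" 0 pi]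
      by (intro has_integral_add has_integral_sum cos_int_integral) auto
    then show ?thesis unfolding D_def by (simp add: integral_unique)
  qed
  have partial: "(\<Sum>n<N. 1 / pi * integral {-pi..pi} (\<lambda>t. \<kappa> t * cos (real (Suc n) * t))) =
     1 / pi * integral {0<..pi} (\<lambda>t. q t * hsin N t) + \<kappa> 0" for N
  proof -
    have sc: "(\<lambda>t. \<sigma> t * cos (real (Suc n) * t)) integrable_on {0..pi}" for n
      by (intro integrable_continuous_interval continuous_intros \<sigma>_cont)
    have s0: "(\<lambda>t. \<sigma> t * (1 / 2)) integrable_on {0..pi}"
      by (intro integrable_continuous_interval continuous_intros \<sigma>_cont)
    have coef: "integral {-pi..pi} (\<lambda>t. \<kappa> t * cos (real (Suc n) * t)) = integral {0..pi} (\<lambda>t. \<sigma> t * cos (real (Suc n) * t))" for n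
    proof -
      have "\<kappa> t * cos (real (Suc n) * t) + \<kappa> (- t) * cos (real (Suc n) * - t) = \<sigma> t * cos (real (Suc n) * t)" for t
        unfolding \<sigma>_def mult_minus_right cos_minus by (simp only: distrib_right)
      then show ?thesis
        by (subst integral_symmetric_interval) (simp_all only: continuous_intros c)
    qed
    have m0: "integral {0..pi} (\<lambda>t. \<sigma> t * (1 / 2)) = 0"
      using mean integral_symmetric_interval[OF c] by (simp add: \<sigma>_def[abs_def])
    have "((\<lambda>t. \<sigma> t * (1 / 2) + (\<Sum>n<N. \<sigma> t * cos (real (Suc n) * t))) has_integral
        (integral {0..pi} (\<lambda>t. \<sigma> t * (1 / 2)) + (\<Sum>n<N. integral {0..pi} (\<lambda>t. \<sigma> t * cos (real (Suc n) * t))))) {0..pi}"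
      by (intro has_integral_add has_integral_sum integrable_integral sc s0) auto
    moreover have "\<sigma> t * (1 / 2) + (\<Sum>n<N. \<sigma> t * cos (real (Suc n) * t)) = \<sigma> t * D N t" for t
      unfolding D_def distrib_left sum_distrib_left ..
    ultimately have s1: "((\<lambda>t. \<sigma> t * D N t) has_integral (\<Sum>n<N. integral {-pi..pi} (\<lambda>t. \<kappa> t * cos (real (Suc n) * t)))) {0..pi}"
      unfolding m0 coef by simp
    have s2: "((\<lambda>t. 2 * \<kappa> 0 * D N t) has_integral (2 * \<kappa> 0 * (pi / 2))) {0..pi}"
      unfolding D_int[of N, symmetric] by (intro has_integral_mult_right integrable_integral integrable_continuous_interval D_cont)
    have "((\<lambda>t. \<sigma> t * D N t - 2 * \<kappa> 0 * D N t) has_integral ((\<Sum>n<N. integral {-pi..pi} (\<lambda>t. \<kappa> t * cos (real (Suc n) * t))) - 2 * \<kappa> 0 * (pi / 2))) {0<..pi}"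
      unfolding has_integral_Ioc_iff by (rule has_integral_diff[OF s1 s2])
    then have "((\<lambda>t. q t * hsin N t) has_integral ((\<Sum>n<N. integral {-pi..pi} (\<lambda>t. \<kappa> t * cos (real (Suc n) * t))) - 2 * \<kappa> 0 * (pi / 2))) {0<..pi}"
    proof (rule has_integral_eq[rotated])
      fix t assume t: "t \<in> {0<..pi}"
      have "hsin N t = 2 * sin (t / 2) * D N t" unfolding D_def by (rule dirichlet_kernel[symmetric])
      moreover have "a / (2 * s) * (2 * s * d) = a * d" if "s > 0" for a s d :: real using that by simp
      ultimately show "\<sigma> t * D N t - 2 * \<kappa> 0 * D N t = q t * hsin N t"
        unfolding q_def left_diff_distrib[symmetric] using sin_pos[OF t] by (simp only:)
    qed
    then have "integral {0<..pi} (\<lambda>t. q t * hsin N t) = (\<Sum>n<N. integral {-pi..pi} (\<lambda>t. \<kappa> t * cos (real (Suc n) * t))) - \<kappa> 0 * pi"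
      by (simp add: integral_unique)
    then show ?thesis unfolding sum_distrib_left[symmetric] by (simp add: diff_divide_distrib)
  qed
  have "(\<lambda>N. 1 / pi * integral {0<..pi} (\<lambda>t. q t * hsin N t) + \<kappa> 0) \<longlonglongrightarrow> 1 / pi * 0 + \<kappa> 0"
    by (intro tendsto_intros hsin_coefficients_tendsto_0[OF q_cont q_le])
  then show ?thesis unfolding sums_def partial by simp
qed

section \<open>Sine series tested against a kernel\<close>

lemma integral_period:
  fixes P :: "real \<Rightarrow> real"
  assumes c: "\<And>A. continuous_on A P" and per: "\<And>s. P (s + 2 * pi) = P s" and u: "0 \<le> u" "u \<le> pi"
  shows "integral {-pi..pi} (\<lambda>t. P (u + t)) = integral {-pi..pi} P"
proof -
  have i: "P integrable_on {a..b}" for a b by (rule integrable_continuous_interval[OF c])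
  have "integral {-pi..pi} (\<lambda>t. P (u + t)) = integral {-pi + u..pi + u} P"
    using integral_shift_real_ivl[of "-pi + u" u "pi + u" P] by (simp add: add.commute)
  also have "\<dots> = integral {-pi + u..pi} P + integral {pi..pi + u} P"
    by (rule Henstock_Kurzweil_Integration.integral_combine[symmetric]) (use u i in auto)
  also have "integral {pi..pi + u} P = integral {-pi..-pi + u} P"
  proof -
    have "integral {pi - 2 * pi..pi + u - 2 * pi} (\<lambda>x. P (x + 2 * pi)) = integral {pi..pi + u} P"
      by (rule integral_shift_real_ivl)
    then show ?thesis by (simp add: per)
  qed
  also have "integral {-pi + u..pi} P + integral {-pi..-pi + u} P = integral {-pi..pi} P"
    using Henstock_Kurzweil_Integration.integral_combine[of "-pi" "-pi + u" pi P] u i by simp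
  finally show ?thesis .
qed

text \<open>Convergence of the series of g itself is bypassed. The correlation \<kappa>(t) of
  \<open>K\<close> with the translate of \<open>g\<close> by t inherits the Lipschitz bound, its
  cosine coefficients factor into products of sine coefficients, and \<kappa>(0) is the integral
  sought. So one application of \<open>dirichlet_convergence\<close> at 0 suffices. The interval
  from -pi to 2 pi is the range of u + t.\<close>

lemma sine_series:
  fixes g K :: "real \<Rightarrow> real"
  assumes per: "\<And>s. g (s + 2 * pi) = g s" and odd: "\<And>s. g (- s) = - g s"
    and lip: "\<And>s t. s \<in> {-pi..2 * pi} \<Longrightarrow> t \<in> {-pi..2 * pi} \<Longrightarrow> \<bar>g s - g t\<bar> \<le> L * \<bar>s - t\<bar>"
    and g_cont: "\<And>A. continuous_on A g" and K_cont: "continuous_on {0..pi} K"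
  shows "(\<lambda>n. integral {0..pi} (\<lambda>u. K u * sin (real (Suc n) * u)) * (2 / pi * integral {0..pi} (\<lambda>u. g u * sin (real (Suc n) * u))))
     sums integral {0..pi} (\<lambda>u. K u * g u)"
proof -
  define \<kappa> where "\<kappa> t = integral {0..pi} (\<lambda>u. K u * g (u + t))" for t
  have L: "L \<ge> 0" using order_trans[OF abs_ge_zero lip[of 1 0]] pi_ge_two by simp
  have g_add: "continuous_on A (\<lambda>u. g (u + t))" for A t
    by (intro continuous_on_compose2[OF g_cont[of UNIV]] continuous_intros) auto
  have K_int: "(\<lambda>u. K u * g (u + t)) integrable_on {0..pi}" for t
    by (intro integrable_continuous_interval continuous_intros K_cont g_add)
  have \<kappa>_cont: "continuous_on {-pi..pi} \<kappa>"
  proof -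
    have "continuous_on ({-pi..pi} \<times> cbox 0 pi) (\<lambda>(t, u). K u * g (u + t))"
      unfolding split_beta
      by (intro continuous_on_mult continuous_on_compose2[OF K_cont] continuous_on_compose2[OF g_cont[of UNIV]] continuous_intros) auto
    from integral_continuous_on_param[OF this] show ?thesis by (simp add: \<kappa>_def[abs_def])
  qed
  obtain B where B: "B \<ge> 0" "\<forall>u\<in>{0..pi}. \<bar>K u\<bar> \<le> B"
    using compact_interval_norm_bound[of 0 pi "\<lambda>u. complex_of_real (K u)"] K_cont by (auto intro: continuous_intros)
  have \<kappa>_lip: "\<bar>\<kappa> t - \<kappa> 0\<bar> \<le> B * L * pi * \<bar>t\<bar>" if t: "t \<in> {-pi..pi}" for t
  proof -
    note d = has_integral_diff[OF integrable_integral[OF K_int[of t]] integrable_integral[OF K_int[of 0]]]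
    have "norm (\<kappa> t - \<kappa> 0) \<le> (B * (L * \<bar>t\<bar>)) * measure lborel {0..pi}"
      unfolding \<kappa>_def
    proof (rule has_integral_bound_real[OF _ finite.emptyI d])
      show "0 \<le> B * (L * \<bar>t\<bar>)" using B L by simp
      fix u assume u: "u \<in> {0..pi} - {}"
      have "\<bar>g (u + t) - g (u + 0)\<bar> \<le> L * \<bar>u + t - (u + 0)\<bar>" using u t by (intro lip) auto
      then have "\<bar>K u\<bar> * \<bar>g (u + t) - g (u + 0)\<bar> \<le> B * (L * \<bar>t\<bar>)" using u B by (intro mult_mono) auto
      then show "norm (K u * g (u + t) - K u * g (u + 0)) \<le> B * (L * \<bar>t\<bar>)"
        by (simp add: abs_mult[symmetric] right_diff_distrib)
    qed
    then show ?thesis by (simp add: mult_ac)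
  qed
  \<comment> \<open>After exchanging the integrals, periodicity moves the translation from g to the
    cosine, and oddness of g leaves only the product of sines in cos(n(s - u)).\<close>
  have coef: "integral {-pi..pi} (\<lambda>t. \<kappa> t * cos (real n * t)) =
      integral {0..pi} (\<lambda>u. K u * sin (real n * u)) * (2 * integral {0..pi} (\<lambda>u. g u * sin (real n * u)))" for n
  proof -
    define S where "S = 2 * integral {0..pi} (\<lambda>u. g u * sin (real n * u))"
    have inner: "integral {-pi..pi} (\<lambda>t. g (u + t) * cos (real n * t)) = sin (real n * u) * S" if u: "u \<in> {0..pi}" for u
    proof -
      define P where "P s = g s * cos (real n * (s - u))" for s
      have "P (s + 2 * pi) = P s" for s
      proof -
        have "real n * (s + 2 * pi - u) = real n * (s - u) + of_nat n * (2 * pi)" by (simp add: algebra_simps)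
        then have "cos (real n * (s + 2 * pi - u)) = cos (real n * (s - u))" using cos.plus_of_nat[of "real n * (s - u)" n] by (simp only: mult_ac of_real_eq_id id_apply)
        then show ?thesis by (simp add: P_def per)
      qed
      moreover have "continuous_on A P" for A unfolding P_def by (intro continuous_intros g_cont)
      ultimately have "integral {-pi..pi} (\<lambda>t. P (u + t)) = integral {-pi..pi} P"
        using u by (intro integral_period) auto
      moreover have "P (u + t) = g (u + t) * cos (real n * t)" for t by (simp add: P_def)
      ultimately have "integral {-pi..pi} (\<lambda>t. g (u + t) * cos (real n * t)) = integral {-pi..pi} P" by simp
      also have "\<dots> = integral {0..pi} (\<lambda>t. P t + P (- t))"
        by (rule integral_symmetric_interval) fact
      also have "\<dots> = integral {0..pi} (\<lambda>t. (2 * sin (real n * u)) * (g t * sin (real n * t)))"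
      proof (rule integral_cong)
        fix t
        have "P t + P (- t) = g t * (cos (real n * t - real n * u) - cos (real n * t + real n * u))"
          unfolding P_def odd by (simp add: right_diff_distrib cos_add cos_diff algebra_simps)
        then show "P t + P (- t) = (2 * sin (real n * u)) * (g t * sin (real n * t))"
          by (simp add: cos_add cos_diff)
      qed
      also have "\<dots> = 2 * sin (real n * u) * integral {0..pi} (\<lambda>t. g t * sin (real n * t))" by (rule integral_mult_right)
      finally show ?thesis by (simp only: S_def mult_ac)
    qed
    have "integral {-pi..pi} (\<lambda>t. \<kappa> t * cos (real n * t)) = integral {-pi..pi} (\<lambda>t. integral {0..pi} (\<lambda>u. K u * g (u + t) * cos (real n * t)))"
      unfolding \<kappa>_def by simp
    also have "\<dots> = integral {0..pi} (\<lambda>u. integral {-pi..pi} (\<lambda>t. K u * g (u + t) * cos (real n * t)))"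
    proof -
      have "continuous_on (cbox (-pi, 0) (pi, pi)) (\<lambda>(t, u). K u * g (u + t) * cos (real n * t))"
        unfolding split_beta
        by (intro continuous_on_mult continuous_on_compose2[OF K_cont] continuous_on_compose2[OF g_cont[of UNIV]] continuous_intros)
           (auto simp: cbox_Pair_eq)
      from integral_swap_continuous[OF this] show ?thesis by simp
    qed
    also have "\<dots> = integral {0..pi} (\<lambda>u. K u * sin (real n * u) * S)"
      by (rule integral_cong) (simp add: mult.assoc inner)
    finally show ?thesis by (simp add: S_def)
  qed
  \<comment> \<open>In the case n = 0 of \<open>coef\<close> the sines vanish while the cosine is
    1.\<close>
  have "integral {-pi..pi} \<kappa> = 0" using coef[of 0] by simp
  from dirichlet_convergence[OF \<kappa>_cont \<kappa>_lip this]
  have "(\<lambda>n. 1 / pi * integral {-pi..pi} (\<lambda>t. \<kappa> t * cos (real (Suc n) * t))) sums \<kappa> 0" .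
  moreover have "1 / pi * integral {-pi..pi} (\<lambda>t. \<kappa> t * cos (real (Suc n) * t)) =
     integral {0..pi} (\<lambda>u. K u * sin (real (Suc n) * u)) * (2 / pi * integral {0..pi} (\<lambda>u. g u * sin (real (Suc n) * u)))" for n
    unfolding coef by (simp only: times_divide_eq_left times_divide_eq_right mult_1_left)
  ultimately show ?thesis by (simp add: \<kappa>_def)
qed

lemma sine_series_complex:
  fixes g :: "real \<Rightarrow> complex" and K :: "real \<Rightarrow> real"
  assumes per: "\<And>s. g (s + 2 * pi) = g s" and odd: "\<And>s. g (- s) = - g s"
    and lip: "\<And>s t. s \<in> {-pi..2 * pi} \<Longrightarrow> t \<in> {-pi..2 * pi} \<Longrightarrow> norm (g s - g t) \<le> L * \<bar>s - t\<bar>"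
    and g_cont: "\<And>A. continuous_on A g" and K_cont: "continuous_on {0..pi} K"
  shows "(\<lambda>n. of_real (integral {0..pi} (\<lambda>u. K u * sin (real (Suc n) * u))) * (2 / of_real pi * integral {0..pi} (\<lambda>u. g u * of_real (sin (real (Suc n) * u)))))
     sums integral {0..pi} (\<lambda>u. of_real (K u) * g u)"
proof -
  have int: "(\<lambda>u. g u * of_real (k u)) integrable_on {0..pi}" if "continuous_on {0..pi} k" for k
    by (intro integrable_continuous_interval continuous_intros g_cont that)
  have re: "Re (integral {0..pi} (\<lambda>u. g u * of_real (k u))) = integral {0..pi} (\<lambda>u. Re (g u) * k u)"
    and im: "Im (integral {0..pi} (\<lambda>u. g u * of_real (k u))) = integral {0..pi} (\<lambda>u. Im (g u) * k u)"
    if "continuous_on {0..pi} k" for k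
    using integral_linear[OF int[OF that] bounded_linear_Re] integral_linear[OF int[OF that] bounded_linear_Im]
    by (simp_all add: o_def)
  have sc: "continuous_on {0..pi} (\<lambda>u. sin (real (Suc n) * u))" for n by (intro continuous_intros)
  have pr: "2 / complex_of_real pi = of_real (2 / pi)" by simp
  have r: "(\<lambda>n. integral {0..pi} (\<lambda>u. K u * sin (real (Suc n) * u)) * (2 / pi * integral {0..pi} (\<lambda>u. Re (g u) * sin (real (Suc n) * u))))
     sums integral {0..pi} (\<lambda>u. K u * Re (g u))"
  proof (rule sine_series[of _ L])
    show "\<bar>Re (g s) - Re (g t)\<bar> \<le> L * \<bar>s - t\<bar>" if "s \<in> {-pi..2 * pi}" "t \<in> {-pi..2 * pi}" for s t
      using order_trans[OF abs_Re_le_cmod lip[OF that]] by simp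
  qed (auto simp: per odd intro!: continuous_intros g_cont K_cont)
  have i: "(\<lambda>n. integral {0..pi} (\<lambda>u. K u * sin (real (Suc n) * u)) * (2 / pi * integral {0..pi} (\<lambda>u. Im (g u) * sin (real (Suc n) * u))))
     sums integral {0..pi} (\<lambda>u. K u * Im (g u))"
  proof (rule sine_series[of _ L])
    show "\<bar>Im (g s) - Im (g t)\<bar> \<le> L * \<bar>s - t\<bar>" if "s \<in> {-pi..2 * pi}" "t \<in> {-pi..2 * pi}" for s t
      using order_trans[OF abs_Im_le_cmod lip[OF that]] by simp
  qed (auto simp: per odd intro!: continuous_intros g_cont K_cont)
  have comm: "(\<lambda>u. of_real (K u) * g u) = (\<lambda>u. g u * of_real (K u))" by (simp add: mult.commute)
  have ReT: "Re (of_real a * (of_real b * z)) = a * (b * Re z)" and ImT: "Im (of_real a * (of_real b * z)) = a * (b * Im z)" for a b z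
    by simp_all
  show ?thesis
    unfolding sums_complex_iff pr ReT ImT re[OF sc] im[OF sc] comm re[OF K_cont] im[OF K_cont]
    using r i by (simp only: mult.commute[of "Re _" "K _"] mult.commute[of "Im _" "K _"])
qed

subsection \<open>The expansion\<close>

text \<open>The gauge integral over a half-line is by definition a limit over intervals containing
  large balls; symmetric intervals then give the one-sided truncations.\<close>

lemma improper_integral_eq:
  assumes "(F has_integral I) {0..}"
  shows "improper_integral_0_inf F = I"
proof -
  have "((\<lambda>R. integral {0..R} F) \<longlongrightarrow> I) at_top"
  proof (rule tendstoI)
    fix e :: real assume "e > 0"
    then obtain B where B: "B > 0" "\<And>a b. ball 0 B \<subseteq> cbox a b \<Longrightarrow>
        \<exists>z. ((\<lambda>x. if x \<in> {0..} then F x else 0) has_integral z) (cbox a b) \<and> norm (z - I) < e"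
      using has_integral'[THEN iffD1, OF assms, rule_format, OF \<open>e > 0\<close>] by blast
    show "\<forall>\<^sub>F R in at_top. dist (integral {0..R} F) I < e"
    proof (rule eventually_mono[OF eventually_ge_at_top[of B]])
      fix R assume R: "B \<le> R"
      have "ball 0 B \<subseteq> cbox (- R) R" using R by (auto simp: dist_real_def)
      then obtain z where z: "((\<lambda>x. if x \<in> {0..} then F x else 0) has_integral z) (cbox (- R) R)" "norm (z - I) < e"
        using B(2) by blast
      have "z = integral ({0..} \<inter> {- R..R}) F"
        using z(1) Henstock_Kurzweil_Integration.integral_restrict_Int[of "{- R..R}" "{0..}" F] by (simp add: integral_unique)
      also have "{0..} \<inter> {- R..R} = {0..R}" using R B(1) by auto
      finally show "dist (integral {0..R} F) I < e" using z(2) by (simp add: dist_norm)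
    qed
  qed
  then show ?thesis unfolding improper_integral_0_inf_def by (intro tendsto_Lim) auto
qed

text \<open>J_0 is real on the real line; this allows the kernel to enter
  \<open>sine_series_complex\<close>, where it is real-valued.\<close>

lemma bser0_real: "bser 0 (of_real t) = of_real (Re (bser 0 (of_real t)))"
proof -
  have "(\<lambda>k. bcoef 0 k * of_real t ^ k) sums bser 0 (of_real t)"
    unfolding bser_def by (intro summable_sums summable_bser) simp
  then have "(\<lambda>k. Im (bcoef 0 k * of_real t ^ k)) sums Im (bser 0 (of_real t))" by (simp only: sums_complex_iff)
  moreover have "Im (bcoef 0 k * of_real t ^ k) = 0" for k
  proof -
    have "rGamma (of_nat k + 0 + 1) = complex_of_real (rGamma (real k + 1))"
      by (simp add: rGamma_complex_of_real[symmetric])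
    then have "bcoef 0 k * of_real t ^ k = of_real ((-1) ^ k / fact k * rGamma (real k + 1) * t ^ k)"
      by (simp add: bcoef_def)
    then show ?thesis by (simp only: Im_complex_of_real)
  qed
  ultimately have "(\<lambda>k. 0) sums Im (bser 0 (of_real t))" by (simp only:)
  then have "Im (bser 0 (of_real t)) = 0" by (rule sums_unique2[OF _ sums_zero])
  then show ?thesis by (simp add: complex_eq_iff)
qed

lemma besselJ_0_cosh:
  assumes "x > 0"
  shows "besselJ 0 (2 * x * cosh u) = bser 0 (of_real (x\<^sup>2 * (cosh u)\<^sup>2))"
proof -
  have "cosh u \<noteq> 0" by simp
  then have "x * cosh u \<noteq> 0" using assms by simp
  then show ?thesis by (simp add: besselJ_eq_bser power_mult_distrib)
qed

text \<open>A path between two points is cut at the odd multiples of pi. Each piece is a translate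
  of a piece of the basic interval, and since the lengths add up the constant does not grow.\<close>

lemma periodic_lipschitz:
  fixes \<psi> :: "real \<Rightarrow> 'a :: real_normed_vector"
  assumes per: "\<And>u. \<psi> (u + 2 * pi) = \<psi> u"
    and lip: "\<And>u v. u \<in> {-pi..pi} \<Longrightarrow> v \<in> {-pi..pi} \<Longrightarrow> norm (\<psi> u - \<psi> v) \<le> C * \<bar>u - v\<bar>"
  shows "norm (\<psi> s - \<psi> t) \<le> C * \<bar>s - t\<bar>"
proof -
  interpret periodic_fun_simple \<psi> "2 * pi" by standard (rule per)
  have up: "norm (\<psi> s - \<psi> t) \<le> C * (t - s)"
    if "s \<in> {-pi..pi}" "s \<le> t" "t \<le> (2 * real n + 1) * pi" for s t n
    using that
  proof (induction n arbitrary: t)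
    case 0
    then show ?case using lip[of s t] by simp
  next
    case (Suc n)
    \<comment> \<open>The last cut: beyond it the function repeats its values from -pi on, and
      before it the induction hypothesis applies.\<close>
    define p where "p = (2 * real n + 1) * pi"
    have p: "pi \<le> p" by (simp add: p_def algebra_simps)
    show ?case
    proof (cases "t \<le> p")
      case True
      then show ?thesis using Suc.IH Suc.prems by (simp add: p_def)
    next
      case False
      have "\<psi> p = \<psi> (- pi)" and "\<psi> t = \<psi> (t - p - pi)"
        using minus_of_nat[of p "Suc n"] minus_of_nat[of t "Suc n"] by (simp_all add: p_def algebra_simps)
      moreover have "norm (\<psi> (- pi) - \<psi> (t - p - pi)) \<le> C * \<bar>- pi - (t - p - pi)\<bar>"
        using False Suc.prems by (intro lip) (auto simp: p_def algebra_simps)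
      ultimately have "norm (\<psi> p - \<psi> t) \<le> C * (t - p)" using False by simp
      moreover have "norm (\<psi> s - \<psi> p) \<le> C * (p - s)" using Suc.prems p by (intro Suc.IH) (auto simp flip: p_def)
      ultimately show ?thesis
        using norm_triangle_ineq[of "\<psi> s - \<psi> p" "\<psi> p - \<psi> t"] by (simp add: algebra_simps)
    qed
  qed
  have main: "norm (\<psi> s - \<psi> t) \<le> C * (t - s)" if "s \<le> t" for s t
  proof -
    \<comment> \<open>Counts the periods by which s and t are translated together so that s falls
      into the basic interval.\<close>
    define k where "k = \<lfloor>(s + pi) / (2 * pi)\<rfloor>"
    have "of_int k \<le> (s + pi) / (2 * pi)" "(s + pi) / (2 * pi) \<le> of_int k + 1" unfolding k_def by linarith+
    then have s': "s - of_int k * (2 * pi) \<in> {-pi..pi}" by (simp add: field_simps)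
    obtain n :: nat where "(t - of_int k * (2 * pi)) / pi \<le> real n" using real_arch_simple by blast
    then have "t - of_int k * (2 * pi) \<le> real n * pi" by (simp add: pos_divide_le_eq)
    also have "\<dots> \<le> (2 * real n + 1) * pi" by (intro mult_right_mono) auto
    finally show ?thesis using up[OF s', of "t - of_int k * (2 * pi)" n] that by (simp add: minus_of_int)
  qed
  show ?thesis using main[of s t] main[of t s] by (cases "s \<le> t") (simp_all add: norm_minus_commute)
qed

theorem theorem2:
  fixes \<psi> :: "real \<Rightarrow> complex" and C :: real
    and \<phi> :: "real \<Rightarrow> real \<Rightarrow> complex" and f :: "real \<Rightarrow> complex"
    and a :: "nat \<Rightarrow> complex" and \<Phi> :: "nat \<Rightarrow> real \<Rightarrow> complex"
  assumes periodic: "\<And>u. \<psi> (u + 2 * pi) = \<psi> u"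
    and C_pos: "C > 0"
    and lipschitz: "\<And>u v. u \<in> {-pi..pi} \<Longrightarrow> v \<in> {-pi..pi} \<Longrightarrow> norm (\<psi> u - \<psi> v) \<le> C * \<bar>u - v\<bar>"
    and f_def: "\<And>x. x > 0 \<Longrightarrow> f x = of_real x *
                  integral {-pi..pi} (\<lambda>u. besselJ 0 (2 * x * cosh u) * \<psi> u * of_real (sinh (2 * u)))"
    and a_def: "\<And>n. a n = improper_integral_0_inf
                  (\<lambda>x. ((besselJ (\<i> * of_nat n / 2) x)\<^sup>2 + (besselY (\<i> * of_nat n / 2) x)\<^sup>2) * f x)"
    and Phi_def: "\<And>n x. x > 0 \<Longrightarrow> \<Phi> n x = of_real x *
                  integral {0..pi} (\<lambda>u. besselJ 0 (2 * x * cosh u) * of_real (sinh (2 * u) * sin (real n * u)))"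
  shows "\<And>x. x > 0 \<Longrightarrow>
           (\<lambda>n. of_real (sinh (pi * real (Suc n) / 2)) * \<Phi> (Suc n) x * a (Suc n)) sums f x"
proof -
  define g where "g u = \<psi> u - \<psi> (- u)" for u
  \<comment> \<open>\<open>lipschitz_pairing\<close> asks for a function on the whole line that
    vanishes outside an interval. Extension by zero keeps the Lipschitz bound because g vanishes at
    0 by oddness and at pi by oddness and periodicity.\<close>
  define g0 where "g0 u = (if u \<in> {0..pi} then g u else 0)" for u
  define B where "B x u = bser 0 (of_real (x\<^sup>2 * (cosh u)\<^sup>2)) * of_real (sinh (2 * u))" for x u
  have \<psi>_lip: "norm (\<psi> s - \<psi> t) \<le> C * \<bar>s - t\<bar>" for s t by (rule periodic_lipschitz[OF periodic lipschitz])
  have g_lip: "norm (g s - g t) \<le> 2 * C * \<bar>s - t\<bar>" for s t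
  proof -
    have "norm (g s - g t) \<le> norm (\<psi> s - \<psi> t) + norm (\<psi> (- s) - \<psi> (- t))"
      unfolding g_def using norm_triangle_ineq4[of "\<psi> s - \<psi> t" "\<psi> (- s) - \<psi> (- t)"] by (simp add: algebra_simps)
    also have "\<dots> \<le> C * \<bar>s - t\<bar> + C * \<bar>- s - - t\<bar>" by (intro add_mono \<psi>_lip)
    finally show ?thesis by (simp add: abs_minus_commute)
  qed
  have \<psi>_cont: "continuous_on A \<psi>" for A
    using C_pos \<psi>_lip by (intro lipschitz_on_continuous_on[of C]) (auto simp: lipschitz_on_def dist_norm)
  have g_cont: "continuous_on A g" for A
    using C_pos g_lip by (intro lipschitz_on_continuous_on[of "2 * C"]) (auto simp: lipschitz_on_def dist_norm)
  have g_odd: "g (- s) = - g s" for s by (simp add: g_def)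
  have g_per: "g (s + 2 * pi) = g s" for s
    using periodic[of s] periodic[of "- s - 2 * pi"] by (simp add: g_def algebra_simps)
  have g_0: "g 0 = 0" and g_pi: "g pi = 0" using periodic[of "- pi"] by (simp_all add: g_def)
  have g0_lip: "norm (g0 s - g0 t) \<le> 2 * C * \<bar>s - t\<bar>" for s t
  proof -
    \<comment> \<open>Extension by zero coincides here with evaluation at the nearest point of the
      interval, and this projection does not increase distances.\<close>
    have "g0 u = g (max 0 (min pi u))" for u by (auto simp: g0_def max_def min_def g_0 g_pi)
    then have "norm (g0 s - g0 t) \<le> 2 * C * \<bar>max 0 (min pi s) - max 0 (min pi t)\<bar>" by (simp only: g_lip)
    also have "\<dots> \<le> 2 * C * \<bar>s - t\<bar>" using C_pos by (intro mult_left_mono) auto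
    finally show ?thesis .
  qed
  have g0_integral: "integral {0..pi + 2} (\<lambda>u. h u * g0 u) = integral {0..pi} (\<lambda>u. h u * g u)" for h
    using Henstock_Kurzweil_Integration.integral_restrict_Int[of "{0..pi + 2}" "{0..pi}" "\<lambda>u. h u * g u"] by (simp add: g0_def if_distrib[of "(*) _"] cong: if_cong)
  have B_cont: "continuous_on A (B x)" for A x unfolding B_def by (intro continuous_intros) auto
  have f_integral: "f x = of_real x * integral {0..pi} (\<lambda>u. B x u * g u)" if x: "x > 0" for x
  proof -
    have "f x = of_real x * integral {-pi..pi} (\<lambda>u. B x u * \<psi> u)"
      unfolding f_def[OF x] besselJ_0_cosh[OF x] B_def by (simp only: mult_ac)
    also have "integral {-pi..pi} (\<lambda>u. B x u * \<psi> u) = integral {0..pi} (\<lambda>u. B x u * \<psi> u + B x (- u) * \<psi> (- u))"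
      by (intro integral_symmetric_interval continuous_on_mult B_cont \<psi>_cont)
    finally show ?thesis by (simp add: B_def g_def right_diff_distrib)
  qed
  have f_transform: "f x = cosh_transform (pi + 2) g0 x" if "x > 0" for x
    unfolding cosh_transform_def g0_integral f_integral[OF that] B_def ..
  have a: "of_real (sinh (pi * real n / 2)) * a n = 2 / of_real pi * integral {0..pi} (\<lambda>u. g u * of_real (sin (real n * u)))"
    if n: "n > 0" for n
  proof -
    define M where "M x = (besselJ (\<i> * of_nat n / 2) x)\<^sup>2 + (besselY (\<i> * of_nat n / 2) x)\<^sup>2" for x
    define S where "S = sinh (pi * real n / 2)"
    define h where "h u = complex_of_real (2 * sin (real n * u) / (pi * S))" for u
    have S: "S \<noteq> 0" using n by (simp add: S_def)
    have "g0 u = 0" if "u \<le> 0 \<or> u \<ge> pi" for u using that by (auto simp: g0_def g_0 g_pi)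
    moreover have "real n / 2 \<noteq> 0" "pi \<ge> 0" using n by simp_all
    moreover have "\<i> * of_real (real n / 2) = \<i> * of_nat n / 2" "2 * (real n / 2) * u = real n * u"
      "real n / 2 * pi = pi * real n / 2" for u by simp_all
    ultimately have "((\<lambda>x. cosh_transform (pi + 2) g0 x * M x) has_integral integral {0..pi + 2} (\<lambda>u. g0 u * h u)) {0<..}"
      using lipschitz_pairing[of "real n / 2" pi g0, OF _ _ g0_lip] by (simp only: M_def h_def S_def simp_thms)
    also have "integral {0..pi + 2} (\<lambda>u. g0 u * h u) = integral {0..pi} (\<lambda>u. h u * g u)"
      using g0_integral[of h] by (simp only: mult.commute)
    finally have "((\<lambda>x. M x * f x) has_integral integral {0..pi} (\<lambda>u. h u * g u)) {0<..}"
      by (rule has_integral_eq[rotated]) (simp add: f_transform)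
    then have "((\<lambda>x. M x * f x) has_integral integral {0..pi} (\<lambda>u. h u * g u)) {0..}"
      by (rule has_integral_spike_set_eq[THEN iffD1, rotated 2]) (auto intro!: negligible_subset[OF negligible_sing[of 0]])
    then have "a n = integral {0..pi} (\<lambda>u. h u * g u)"
      unfolding a_def M_def by (rule improper_integral_eq)
    also have "\<dots> = integral {0..pi} (\<lambda>u. (2 / of_real (pi * S)) * (g u * of_real (sin (real n * u))))"
      by (simp add: h_def mult_ac)
    also have "\<dots> = 2 / of_real (pi * S) * integral {0..pi} (\<lambda>u. g u * of_real (sin (real n * u)))"
      by (rule integral_mult_right)
    finally show ?thesis using S by (simp add: S_def)
  qed
  fix x :: real assume x: "x > 0"
  define K where "K u = Re (bser 0 (of_real (x\<^sup>2 * (cosh u)\<^sup>2))) * sinh (2 * u)" for u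
  have K: "of_real (K u) = B x u" for u
    unfolding K_def B_def of_real_mult using bser0_real[of "x\<^sup>2 * (cosh u)\<^sup>2"] by simp
  have K_cont: "continuous_on {0..pi} K" unfolding K_def by (intro continuous_intros) auto
  have \<Phi>: "\<Phi> n x = of_real x * of_real (integral {0..pi} (\<lambda>u. K u * sin (real n * u)))" for n
  proof -
    have "(\<lambda>u. K u * sin (real n * u)) integrable_on {0..pi}"
      by (intro integrable_continuous_interval continuous_intros K_cont)
    from integral_linear[OF this bounded_linear_of_real[where 'a = complex]]
    have "of_real (integral {0..pi} (\<lambda>u. K u * sin (real n * u))) = integral {0..pi} (\<lambda>u. B x u * of_real (sin (real n * u)))"
      by (simp add: o_def K)
    then show ?thesis unfolding Phi_def[OF x] besselJ_0_cosh[OF x] B_def by (simp add: mult_ac)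
  qed
  have "(\<lambda>n. of_real x * (of_real (integral {0..pi} (\<lambda>u. K u * sin (real (Suc n) * u))) *
      (2 / of_real pi * integral {0..pi} (\<lambda>u. g u * of_real (sin (real (Suc n) * u)))))) sums
      (of_real x * integral {0..pi} (\<lambda>u. of_real (K u) * g u))"
    by (intro sums_mult sine_series_complex[of g "2 * C"] g_per g_odd g_lip g_cont K_cont)
  moreover have "of_real (sinh (pi * real (Suc n) / 2)) * \<Phi> (Suc n) x * a (Suc n) =
      of_real x * (of_real (integral {0..pi} (\<lambda>u. K u * sin (real (Suc n) * u))) *
      (2 / of_real pi * integral {0..pi} (\<lambda>u. g u * of_real (sin (real (Suc n) * u)))))" for n
    unfolding \<Phi> a[OF zero_less_Suc, symmetric] by (simp only: mult_ac)
  ultimately show "(\<lambda>n. of_real (sinh (pi * real (Suc n) / 2)) * \<Phi> (Suc n) x * a (Suc n)) sums f x"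
    by (simp only: f_integral[OF x] K)
qed

end
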